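(* Let $X$ be an infinite-dimensional complex Banach space and $T\in L(X)$. (a) Let $\mathbf R$ be one of $\mathcal B_+$, $\mathcal B_-$, $\mathcal B$, $\Phi_+$, $\Phi_-$, $\Phi$, $\mathcal W_+$, $\mathcal W_-$, $\mathcal W$. If $\sigma_{\mathbf R}(T)=\partial\sigma_{\mathbf R}(T)=\operatorname{acc}\sigma_{\mathbf R}(T)$, then $$\sigma_{ec}(T)\subset\sigma_{gKR}(T)=\sigma_{gK}(T)=\sigma_{Kt}(T)=\sigma_{eK}(T)=\sigma_{\mathbf R}(T)=\sigma_{\mathbf{gDR}\mathbf R}(T).$$ (b) Let $(\mathbf R,\mathbf R')$ be one of the pairs $(\mathcal M,\mathcal B_+)$, $(\mathcal Q,\mathcal B_-)$, $(L(X)^{-1},\mathcal B)$. If $\sigma_{\mathbf R}(T)=\partial\sigma_{\mathbf R}(T)\subset\operatorname{acc}\sigma_{\mathbf R'}(T)$, then $$\sigma_{ec}(T)\subset\sigma_{gKR}(T)=\sigma_{gK}(T)=\sigma_{Kt}(T)=\sigma_{eK}(T)=\sigma_K(T)=\sigma_{\mathbf R}(T)=\sigma_{\mathbf{gDR}\mathbf R}(T).$$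
   Context: $\sigma_{ec}(T)=\{\lambda: R(T-\lambda)\text{ is not closed}\}$. $S$ is Kato if $R(S)$ is closed and $N(S)\subset R(S^n)$ for all $n$; $S$ is Riesz if $S-\lambda$ is Fredholm for all $\lambda\ne0$. For an operator $S$ and closed $S$-invariant $M,N$ with $X=M\oplus N$ and $S_M$ Kato: if $S_N$ is Riesz, $S$ admits a GKRD; if $S_N$ is quasinilpotent, a GKD; if $S_N$ is nilpotent, $S$ is of Kato type; if $N$ is finite-dimensional and $S_N$ nilpotent, $S$ is essentially Kato. $\sigma_{gKR}$, $\sigma_{gK}$, $\sigma_{Kt}$, $\sigma_{eK}$, $\sigma_K$: sets of $\lambda$ with $T-\lambda$ not admitting a GKRD, not admitting a GKD, not of Kato type, not essentially Kato, not Kato. Classes: $\mathcal M$ bounded below; $\mathcal Q$ surjective; $L(X)^{-1}$ invertible; $\Phi_+$: finite-dimensional kernel and closed range; $\Phi_-$: finite-codimensional range; $\Phi=\Phi_+\cap\Phi_-$; $\mathcal W_+,\mathcal W_-,\mathcal W$: in $\Phi_+,\Phi_-,\Phi$ with index $\le0,\ge0,=0$; $\mathcal B_+$: $\Phi_+$ with finite ascent; $\mathcal B_-$: $\Phi_-$ with finite descent; $\mathcal B$: Fredholm with finite ascent and descent. $\sigma_{\mathbf R}(T)=\{\lambda:T-\lambda\notin\mathbf R\}$; $\sigma_{\mathbf{gDR}\mathbf R}(T)$ is the set of $\lambda$ for which there are no closed $(T-\lambda)$-invariant $M,N$ with $X=M\oplus N$, $(T-\lambda)_M\in\mathbf R$,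 $(T-\lambda)_N$ Riesz. $\partial$, $\operatorname{acc}$: boundary, accumulation points. *)

theory Defs
  imports "HOL-Analysis.Analysis"
begin

text \<open>HOL-Analysis has no complex vector spaces; a complex Banach space is a real
Banach space with a compatible complex scalar multiplication.\<close>

class complex_banach = banach +
  fixes cscale :: "complex \<Rightarrow> 'a \<Rightarrow> 'a"
  assumes cscale_add_right: "cscale a (x + y) = cscale a x + cscale a y"
    and cscale_add_left: "cscale (a + b) x = cscale a x + cscale b x"
    and cscale_cscale: "cscale a (cscale b x) = cscale (a * b) x"
    and cscale_one: "cscale 1 x = x"
    and cscale_of_real: "cscale (complex_of_real r) x = scaleR r x"
    and norm_cscale: "norm (cscale a x) = cmod a * norm x"

definition bop :: "('a::complex_banach \<Rightarrow> 'a) \<Rightarrow> bool" where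
  "bop T \<longleftrightarrow> bounded_linear T \<and> (\<forall>c x. T (cscale c x) = cscale c (T x))"

definition csubspace :: "'a::complex_banach set \<Rightarrow> bool" where
  "csubspace M \<longleftrightarrow> subspace M \<and> (\<forall>c x. x \<in> M \<longrightarrow> cscale c x \<in> M)"

definition fdim :: "'a::real_vector set \<Rightarrow> bool" where
  "fdim A \<longleftrightarrow> (\<exists>B. finite B \<and> A \<subseteq> span B)"

definition shift :: "('a::complex_banach \<Rightarrow> 'a) \<Rightarrow> complex \<Rightarrow> 'a \<Rightarrow> 'a" where
  "shift T l = (\<lambda>x. T x - cscale l x)"

text \<open>A predicate P M S speaks about the restriction S_M of S to M.\<close>

definition ker_on :: "'a::real_vector set \<Rightarrow> ('a \<Rightarrow> 'a) \<Rightarrow> 'a set" where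
  "ker_on M S = {x \<in> M. S x = 0}"

definition is_compl :: "'a::real_vector set \<Rightarrow> 'a set \<Rightarrow> 'a set \<Rightarrow> bool" where
  "is_compl M R F \<longleftrightarrow> subspace F \<and> F \<subseteq> M \<and> fdim F \<and> R \<inter> F \<subseteq> {0}
     \<and> M \<subseteq> {r + f | r f. r \<in> R \<and> f \<in> F}"

definition fin_codim :: "'a::real_vector set \<Rightarrow> 'a set \<Rightarrow> bool" where
  "fin_codim M R \<longleftrightarrow> (\<exists>F. is_compl M R F)"

definition bounded_below_on :: "'a::complex_banach set \<Rightarrow> ('a \<Rightarrow> 'a) \<Rightarrow> bool" where
  "bounded_below_on M S \<longleftrightarrow> (\<exists>c>0. \<forall>x\<in>M. c * norm x \<le> norm (S x))"

definition surj_on :: "'a::complex_banach set \<Rightarrow> ('a \<Rightarrow> 'a) \<Rightarrow> bool" where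
  "surj_on M S \<longleftrightarrow> S ` M = M"

definition invertible_on :: "'a::complex_banach set \<Rightarrow> ('a \<Rightarrow> 'a) \<Rightarrow> bool" where
  "invertible_on M S \<longleftrightarrow> (\<exists>R. (\<forall>x\<in>M. R x \<in> M \<and> R (S x) = x \<and> S (R x) = x)
      \<and> (\<exists>C. \<forall>x\<in>M. norm (R x) \<le> C * norm x))"

definition upper_semi_fredholm_on :: "'a::complex_banach set \<Rightarrow> ('a \<Rightarrow> 'a) \<Rightarrow> bool" where
  "upper_semi_fredholm_on M S \<longleftrightarrow> fdim (ker_on M S) \<and> closed (S ` M)"

definition lower_semi_fredholm_on :: "'a::complex_banach set \<Rightarrow> ('a \<Rightarrow> 'a) \<Rightarrow> bool" where
  "lower_semi_fredholm_on M S \<longleftrightarrow> fin_codim M (S ` M)"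

definition fredholm_on :: "'a::complex_banach set \<Rightarrow> ('a \<Rightarrow> 'a) \<Rightarrow> bool" where
  "fredholm_on M S \<longleftrightarrow> upper_semi_fredholm_on M S \<and> lower_semi_fredholm_on M S"

text \<open>Index conditions (dimensions are real dimensions; the comparison is the same
as for complex dimensions). Index = dim ker - codim range, possibly infinite.\<close>
definition index_le0_on :: "'a::complex_banach set \<Rightarrow> ('a \<Rightarrow> 'a) \<Rightarrow> bool" where
  "index_le0_on M S \<longleftrightarrow> \<not> fin_codim M (S ` M)
     \<or> (\<exists>F. is_compl M (S ` M) F \<and> fdim (ker_on M S) \<and> dim (ker_on M S) \<le> dim F)"

definition index_ge0_on :: "'a::complex_banach set \<Rightarrow> ('a \<Rightarrow> 'a) \<Rightarrow> bool" where
  "index_ge0_on M S \<longleftrightarrow> \<not> fdim (ker_on M S)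
     \<or> (\<exists>F. is_compl M (S ` M) F \<and> dim F \<le> dim (ker_on M S))"

definition index_eq0_on :: "'a::complex_banach set \<Rightarrow> ('a \<Rightarrow> 'a) \<Rightarrow> bool" where
  "index_eq0_on M S \<longleftrightarrow> fdim (ker_on M S)
     \<and> (\<exists>F. is_compl M (S ` M) F \<and> dim F = dim (ker_on M S))"

definition weyl_plus_on :: "'a::complex_banach set \<Rightarrow> ('a \<Rightarrow> 'a) \<Rightarrow> bool" where
  "weyl_plus_on M S \<longleftrightarrow> upper_semi_fredholm_on M S \<and> index_le0_on M S"

definition weyl_minus_on :: "'a::complex_banach set \<Rightarrow> ('a \<Rightarrow> 'a) \<Rightarrow> bool" where
  "weyl_minus_on M S \<longleftrightarrow> lower_semi_fredholm_on M S \<and> index_ge0_on M S"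

definition weyl_on :: "'a::complex_banach set \<Rightarrow> ('a \<Rightarrow> 'a) \<Rightarrow> bool" where
  "weyl_on M S \<longleftrightarrow> fredholm_on M S \<and> index_eq0_on M S"

definition finite_ascent_on :: "'a::complex_banach set \<Rightarrow> ('a \<Rightarrow> 'a) \<Rightarrow> bool" where
  "finite_ascent_on M S \<longleftrightarrow> (\<exists>n. ker_on M (S ^^ n) = ker_on M (S ^^ Suc n))"

definition finite_descent_on :: "'a::complex_banach set \<Rightarrow> ('a \<Rightarrow> 'a) \<Rightarrow> bool" where
  "finite_descent_on M S \<longleftrightarrow> (\<exists>n. (S ^^ n) ` M = (S ^^ Suc n) ` M)"

definition browder_plus_on :: "'a::complex_banach set \<Rightarrow> ('a \<Rightarrow> 'a) \<Rightarrow> bool" where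
  "browder_plus_on M S \<longleftrightarrow> upper_semi_fredholm_on M S \<and> finite_ascent_on M S"

definition browder_minus_on :: "'a::complex_banach set \<Rightarrow> ('a \<Rightarrow> 'a) \<Rightarrow> bool" where
  "browder_minus_on M S \<longleftrightarrow> lower_semi_fredholm_on M S \<and> finite_descent_on M S"

definition browder_on :: "'a::complex_banach set \<Rightarrow> ('a \<Rightarrow> 'a) \<Rightarrow> bool" where
  "browder_on M S \<longleftrightarrow> fredholm_on M S \<and> finite_ascent_on M S \<and> finite_descent_on M S"

definition kato_on :: "'a::complex_banach set \<Rightarrow> ('a \<Rightarrow> 'a) \<Rightarrow> bool" where
  "kato_on M S \<longleftrightarrow> closed (S ` M) \<and> (\<forall>n. ker_on M S \<subseteq> (S ^^ n) ` M)"

definition riesz_on :: "'a::complex_banach set \<Rightarrow> ('a \<Rightarrow> 'a) \<Rightarrow> bool" where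
  "riesz_on N S \<longleftrightarrow> (\<forall>l. l \<noteq> 0 \<longrightarrow> fredholm_on N (shift S l))"

text \<open>Quasinilpotent: the spectral radius lim ||S_N^n||^(1/n) is 0.\<close>
definition quasinilpotent_on :: "'a::complex_banach set \<Rightarrow> ('a \<Rightarrow> 'a) \<Rightarrow> bool" where
  "quasinilpotent_on N S \<longleftrightarrow>
     (\<forall>e>0. \<exists>k. \<forall>n\<ge>k. \<forall>x\<in>N. norm ((S ^^ n) x) \<le> e ^ n * norm x)"

definition nilpotent_on :: "'a::complex_banach set \<Rightarrow> ('a \<Rightarrow> 'a) \<Rightarrow> bool" where
  "nilpotent_on N S \<longleftrightarrow> (\<exists>n. \<forall>x\<in>N. (S ^^ n) x = 0)"

definition fd_nilpotent_on :: "'a::complex_banach set \<Rightarrow> ('a \<Rightarrow> 'a) \<Rightarrow> bool" where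
  "fd_nilpotent_on N S \<longleftrightarrow> fdim N \<and> nilpotent_on N S"

definition decomp :: "('a::complex_banach set \<Rightarrow> ('a \<Rightarrow> 'a) \<Rightarrow> bool)
     \<Rightarrow> ('a set \<Rightarrow> ('a \<Rightarrow> 'a) \<Rightarrow> bool) \<Rightarrow> ('a \<Rightarrow> 'a) \<Rightarrow> bool" where
  "decomp P Q S \<longleftrightarrow> (\<exists>M N. csubspace M \<and> csubspace N \<and> closed M \<and> closed N
      \<and> M \<inter> N = {0} \<and> (\<forall>x. \<exists>m\<in>M. \<exists>n\<in>N. x = m + n)
      \<and> S ` M \<subseteq> M \<and> S ` N \<subseteq> N \<and> P M S \<and> Q N S)"

definition spec_ec :: "('a::complex_banach \<Rightarrow> 'a) \<Rightarrow> complex set" where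
  "spec_ec T = {l. \<not> closed (range (shift T l))}"

definition spec_cls :: "('a::complex_banach set \<Rightarrow> ('a \<Rightarrow> 'a) \<Rightarrow> bool) \<Rightarrow> ('a \<Rightarrow> 'a) \<Rightarrow> complex set" where
  "spec_cls R T = {l. \<not> R UNIV (shift T l)}"

definition spec_dec :: "('a::complex_banach set \<Rightarrow> ('a \<Rightarrow> 'a) \<Rightarrow> bool)
     \<Rightarrow> ('a set \<Rightarrow> ('a \<Rightarrow> 'a) \<Rightarrow> bool) \<Rightarrow> ('a \<Rightarrow> 'a) \<Rightarrow> complex set" where
  "spec_dec P Q T = {l. \<not> decomp P Q (shift T l)}"

abbreviation spec_gKR where "spec_gKR T \<equiv> spec_dec kato_on riesz_on T"
abbreviation spec_gK where "spec_gK T \<equiv> spec_dec kato_on quasinilpotent_on T"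
abbreviation spec_Kt where "spec_Kt T \<equiv> spec_dec kato_on nilpotent_on T"
abbreviation spec_eK where "spec_eK T \<equiv> spec_dec kato_on fd_nilpotent_on T"
abbreviation spec_K where "spec_K T \<equiv> spec_cls kato_on T"
abbreviation spec_gDR where "spec_gDR R T \<equiv> spec_dec R riesz_on T"

definition acc :: "complex set \<Rightarrow> complex set" where
  "acc A = {z. z islimpt A}"

end

(* Let T - l = A + B on M + N with A Kato and B Riesz. For small nonzero m the operator B - m is
   Browder of index 0, while A - m stays Kato with the nullity and the defect of A; hence all of
   nullity, defect, index sign, ascent and descent conditions on T - l - m are decided by A alone,
   independently of m. So each of the classes considered either contains T - l - m for all small
   nonzero m or for none of them, which is impossible if l is both a boundary point of the one
   spectrum and an accumulation point of the other. Conversely every semi-Fredholm operator is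
   essentially Kato, because chains v, S v, ..., S^(n-1) v ending in the kernel outside the range
   of S^n can be split off one by one.

   Since only finitely many dimensions have to be compared at a time, a crude gap estimate with a
   constant depending on the dimension suffices: it makes "dimension at most n" locally constant,
   and connectedness does the rest. *)
theory Submission
  imports Defs
begin

section \<open>Relative dimension\<close>

text \<open>A Kato operator is rigid because every kernel of \<open>S - l\<close> lies in the
  hyperrange, which \<open>S\<close> maps onto itself with a uniform bound \<open>C\<close> on
  preimages. Kernels and ranges of \<open>S - a\<close> and \<open>S - b\<close> therefore differ by
  a gap of at most a multiple of \<open>C * cmod (a - b)\<close>, for all \<open>a\<close> and
  \<open>b\<close> in a disc whose radius depends on \<open>C\<close> only. Comparing dimensions up
  to \<open>n\<close> needs steps that shrink with \<open>n\<close>, but the disc does not shrink;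
  so nullity and defect are constant on it even when they are infinite, and both are counted in
  \<open>enat\<close>. The Riesz part is Browder of index zero away from 0 because this is an open
  and closed condition in the punctured plane that holds far out, where subtracting the scalar gives
  a bijection. Splitting off a chain needs a closed invariant complement. A continuous functional
  vanishing on the range of \<open>S ^^ n\<close> cuts it out, which is where a Hahn-Banach argument
  enters. The hypotheses on boundary and accumulation points serve one inclusion,
  \<open>spec_cls R T\<close> in \<open>spec_gKR T\<close>; the remaining inclusions hold for every
  \<open>T\<close> and close the circle.\<close>

definition rel_le :: "'a::real_vector set \<Rightarrow> 'a set \<Rightarrow> nat \<Rightarrow> bool" where
  "rel_le V W n \<longleftrightarrow> (\<exists>C. finite C \<and> card C \<le> n \<and> V \<subseteq> span (W \<union> C))"

text \<open>For subspaces this is the dimension of \<open>(V + W) / W\<close>, obtained without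
  quotient spaces by counting extra generators. The infimum over no \<open>n\<close> at all is
  infinite. With \<open>W = {0}\<close> it measures a kernel, with \<open>V = M\<close> the cokernel
  of an operator on \<open>M\<close>.\<close>

definition rdim :: "'a::real_vector set \<Rightarrow> 'a set \<Rightarrow> enat" where
  "rdim V W = (INF n\<in>{n. rel_le V W n}. enat n)"

abbreviation sumset :: "'a::plus set \<Rightarrow> 'a set \<Rightarrow> 'a set" where
  "sumset A B \<equiv> {a + b | a b. a \<in> A \<and> b \<in> B}"

lemma rel_le_mono: "rel_le V W m \<Longrightarrow> m \<le> n \<Longrightarrow> rel_le V W n"
  unfolding rel_le_def using order_trans by blast

lemma rdim_le_iff: "rdim V W \<le> enat n \<longleftrightarrow> rel_le V W n"
proof
  assume a: "rdim V W \<le> enat n"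
  have ne: "{n. rel_le V W n} \<noteq> {}"
  proof
    assume "{n. rel_le V W n} = {}"
    then have "rdim V W = \<infinity>" unfolding rdim_def by (simp add: Inf_enat_def)
    then show False using a by simp
  qed
  then have "rdim V W \<in> enat ` {n. rel_le V W n}"
    unfolding rdim_def Inf_enat_def by (auto intro: LeastI)
  then show "rel_le V W n" using a rel_le_mono by auto
next
  assume "rel_le V W n"
  then show "rdim V W \<le> enat n" unfolding rdim_def by (auto intro: INF_lower)
qed

lemma rdim_eqI:
  assumes "\<And>n. rel_le V W n \<longleftrightarrow> rel_le V' W' n"
  shows "rdim V W = rdim V' W'"
proof -
  have "rel_le V W = rel_le V' W'" using assms by (rule ext)
  then show ?thesis unfolding rdim_def by simp
qed

lemma rdim_finite_iff: "rdim V W < \<infinity> \<longleftrightarrow> (\<exists>n. rel_le V W n)"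
  by (metis enat_ord_simps(4) enat.exhaust enat_ord_code(4) order_le_less_trans order_refl rdim_le_iff)

lemma exists_nontrivial_relation:
  fixes q :: "'b \<Rightarrow> 'a::real_vector"
  assumes "finite B" "finite C" "q ` B \<subseteq> span C" "card C < card B"
  shows "\<exists>c. (\<exists>b\<in>B. c b \<noteq> 0) \<and> (\<Sum>b\<in>B. c b *\<^sub>R q b) = 0"
proof (cases "inj_on q B")
  case False
  then obtain b b' where b: "b \<in> B" "b' \<in> B" "b \<noteq> b'" "q b = q b'"
    by (auto simp: inj_on_def)
  let ?c = "\<lambda>x. if x = b then 1 else if x = b' then -1 else (0::real)"
  have "(\<Sum>x\<in>B. ?c x *\<^sub>R q x) = (\<Sum>x\<in>{b,b'}. ?c x *\<^sub>R q x)"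
    using assms(1) b by (intro sum.mono_neutral_right) auto
  also have "\<dots> = 0" using b by simp
  finally show ?thesis using b by (intro exI[of _ ?c]) auto
next
  case True
  have "dependent (q ` B)"
  proof (rule ccontr)
    assume "independent (q ` B)"
    then have "card (q ` B) \<le> card C"
      using independent_span_bound[OF assms(2) _ assms(3)] by blast
    then show False using True assms(4) by (simp add: card_image)
  qed
  then obtain u where u: "\<exists>v\<in>q ` B. u v \<noteq> 0" "(\<Sum>v\<in>q ` B. u v *\<^sub>R v) = 0"
    using dependent_finite[of "q ` B"] assms(1) by auto
  then show ?thesis
    using True by (intro exI[of _ "\<lambda>b. u (q b)"]) (auto simp: sum.reindex)
qed

lemma finite_basis:
  assumes "fdim V"
  obtains B where "finite B" "B \<subseteq> V" "independent B" "V \<subseteq> span B" "card B = dim V"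
proof -
  obtain B where B: "B \<subseteq> V" "independent B" "V \<subseteq> span B" "card B = dim V"
    by (rule basis_exists)
  obtain D where "finite D" "V \<subseteq> span D" using assms unfolding fdim_def by blast
  then have "finite B" using independent_span_bound B by blast
  with B that show thesis by blast
qed

lemma span_subspace_Un:
  assumes "subspace W"
  shows "span (W \<union> C) = sumset W (span C)"
proof -
  have "span W = W" using assms by (simp add: span_eq_iff)
  then show ?thesis by (simp only: span_Un)
qed

text \<open>Too many independent vectors in \<open>F\<close> would have dependent components in
  \<open>span C\<close>. The same coefficients then give a combination lying in both
  \<open>R\<close> and \<open>F\<close>, hence zero. The bound is proved for finite independent sets
  first, so that it also excludes an infinite basis.\<close>

lemma dim_le_complement:
  assumes R: "subspace R" and F: "subspace F" "R \<inter> F \<subseteq> {0}"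
    and C: "finite C" "F \<subseteq> span (R \<union> C)"
  shows "fdim F \<and> dim F \<le> card C"
proof -
  have bound: "card B \<le> card C" if B: "finite B" "B \<subseteq> F" "independent B" for B
  proof (rule ccontr)
    assume "\<not> card B \<le> card C"
    have "\<exists>q. \<forall>b\<in>B. q b \<in> span C \<and> b - q b \<in> R"
    proof (intro bchoice ballI)
      fix b assume "b \<in> B"
      then obtain w c where "b = w + c" "w \<in> R" "c \<in> span C"
        using B(2) C(2) span_subspace_Un[OF R] by blast
      then show "\<exists>y. y \<in> span C \<and> b - y \<in> R" by (intro exI[of _ c]) simp
    qed
    then obtain q where q: "\<forall>b\<in>B. q b \<in> span C \<and> b - q b \<in> R" by blast
    obtain c where c: "\<exists>b\<in>B. c b \<noteq> 0" "(\<Sum>b\<in>B. c b *\<^sub>R q b) = 0"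
    proof -
      have "q ` B \<subseteq> span C" using q by blast
      then show ?thesis
        using exists_nontrivial_relation[OF B(1) C(1)] that \<open>\<not> card B \<le> card C\<close> by (meson not_le)
    qed
    have "(\<Sum>b\<in>B. c b *\<^sub>R b) = (\<Sum>b\<in>B. c b *\<^sub>R (b - q b))"
      using c(2) by (simp add: scaleR_diff_right sum_subtractf)
    also have "\<dots> \<in> R" using q R by (intro subspace_sum) (auto intro: subspace_scale)
    finally have "(\<Sum>b\<in>B. c b *\<^sub>R b) \<in> R" .
    moreover have "(\<Sum>b\<in>B. c b *\<^sub>R b) \<in> F"
      using B F by (intro subspace_sum) (auto intro: subspace_scale)
    ultimately have "(\<Sum>b\<in>B. c b *\<^sub>R b) = 0" using F by blast
    then show False using B c(1) by (auto simp: independent_explicit_finite_subsets)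
  qed
  obtain B where B: "B \<subseteq> F" "independent B" "F \<subseteq> span B" "card B = dim F"
    by (rule basis_exists)
  have "finite B"
  proof (rule ccontr)
    assume "infinite B"
    then obtain D where "D \<subseteq> B" "finite D" "card D = Suc (card C)"
      using infinite_arbitrarily_large by blast
    then show False using bound[of D] B by (auto dest: independent_mono)
  qed
  then show ?thesis using bound[of B] B unfolding fdim_def by auto
qed

lemma is_complD:
  assumes "is_compl V R F"
  shows "subspace F" "F \<subseteq> V" "fdim F" "R \<inter> F \<subseteq> {0}"
    "\<And>x. x \<in> V \<Longrightarrow> \<exists>r\<in>R. \<exists>f\<in>F. x = r + f"
  using assms unfolding is_compl_def by (simp_all, blast)

text \<open>A basis \<open>B\<close> of \<open>R\<close> is extended to a basis \<open>D\<close> of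
  \<open>V\<close>, and \<open>D - B\<close> spans the complement. The linear map \<open>p\<close>
  fixing \<open>R\<close> and killing \<open>F\<close> shows that the two meet only in 0.\<close>

lemma complement_exists:
  assumes R: "subspace R" "R \<subseteq> V" and V: "subspace V" and n: "rel_le V R n"
  shows "\<exists>F. is_compl V R F \<and> dim F \<le> n"
proof -
  obtain B where B: "B \<subseteq> R" "independent B" "R \<subseteq> span B"
    by (rule basis_exists)
  obtain D where D: "B \<subseteq> D" "D \<subseteq> V" "independent D" "V \<subseteq> span D"
    using maximal_independent_subset_extend[of B V] B R by (metis order_trans)
  define F where "F = span (D - B)"
  have "\<exists>p. linear p \<and> (\<forall>x\<in>D. p x = (if x \<in> B then x else 0))"
    using D(3) by (rule linear_independent_extend)
  then obtain p where p: "linear p" "\<And>x. x \<in> D \<Longrightarrow> p x = (if x \<in> B then x else 0)"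
    by blast
  have pR: "p x = x" if "x \<in> R" for x
  proof -
    have "x \<in> span B" using that B by blast
    moreover have "p y = id y" if "y \<in> B" for y using that p(2) D(1) by auto
    ultimately have "p x = id x" using linear_eq_on_span[OF p(1) linear_id] by metis
    then show ?thesis by simp
  qed
  have pF: "p x = 0" if "x \<in> F" for x
  proof -
    have "p y = 0" if "y \<in> D - B" for y using that p(2) by auto
    then show ?thesis
      using linear_eq_0_on_span[OF p(1)] \<open>x \<in> F\<close> unfolding F_def by metis
  qed
  have "R \<inter> F \<subseteq> {0}" using pR pF by force
  have FV: "F \<subseteq> V" using D(2) V unfolding F_def by (intro span_minimal) auto
  have VRF: "V \<subseteq> sumset R F"
  proof -
    have "span D = span (B \<union> (D - B))" using D(1) by (simp add: Un_absorb1)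
    also have "\<dots> \<subseteq> sumset R F"
      using span_minimal[OF B(1) R(1)] unfolding span_Un F_def by blast
    finally show ?thesis using D(4) by blast
  qed
  obtain C where C: "finite C" "card C \<le> n" "V \<subseteq> span (R \<union> C)"
    using n unfolding rel_le_def by blast
  have sF: "subspace F" unfolding F_def by simp
  have "fdim F \<and> dim F \<le> card C"
    using R C FV \<open>R \<inter> F \<subseteq> {0}\<close> sF by (intro dim_le_complement[of R F C]) auto
  then have "is_compl V R F" "dim F \<le> n"
    using VRF FV \<open>R \<inter> F \<subseteq> {0}\<close> C(2) sF unfolding is_compl_def by simp_all
  then show ?thesis by blast
qed

lemma is_compl_rel_le:
  assumes "is_compl V R F" "subspace R"
  shows "rel_le V R n \<longleftrightarrow> dim F \<le> n"
proof
  assume "rel_le V R n"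
  then obtain C where C: "finite C" "card C \<le> n" "V \<subseteq> span (R \<union> C)"
    unfolding rel_le_def by blast
  moreover have "F \<subseteq> span (R \<union> C)" using C assms unfolding is_compl_def by blast
  ultimately show "dim F \<le> n"
    using dim_le_complement[of R F C] assms unfolding is_compl_def by auto
next
  assume n: "dim F \<le> n"
  have "fdim F" using assms unfolding is_compl_def by simp
  then obtain B where B: "finite B" "F \<subseteq> span B" "card B = dim F"
    using finite_basis by metis
  have "V \<subseteq> span (R \<union> B)"
    using assms B unfolding is_compl_def span_subspace_Un[OF assms(2)] by blast
  then show "rel_le V R n" using B n unfolding rel_le_def by metis
qed

text \<open>All finite-dimensional complements thus have the same dimension, so the existential
  choice of \<open>F\<close> in the index conditions is unambiguous.\<close>

lemma is_compl_rdim: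
  assumes "is_compl V R F" "subspace R"
  shows "rdim V R = enat (dim F)"
  using is_compl_rel_le[OF assms] rdim_le_iff
  by (metis antisym enat_ord_simps(1) linorder_le_cases le_refl enat_ile)

lemma fin_codim_iff:
  assumes "subspace R" "R \<subseteq> V" "subspace V"
  shows "fin_codim V R \<longleftrightarrow> rdim V R < \<infinity>"
  unfolding rdim_finite_iff fin_codim_def
  using complement_exists[OF assms] is_compl_rel_le[OF _ assms(1)] by blast

lemma fdim_is_compl: "fdim V \<Longrightarrow> subspace V \<Longrightarrow> is_compl V {0} V"
  unfolding is_compl_def by auto

lemma fdim_iff_rdim: "fdim V \<longleftrightarrow> rdim V {0} < \<infinity>"
proof -
  have "span (insert 0 C) = span C" for C :: "'a set"
    using span_insert_0 by blast
  then show ?thesis unfolding rdim_finite_iff rel_le_def fdim_def by auto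
qed

lemma rdim_zero_eq_dim:
  assumes "fdim V" "subspace V"
  shows "rdim V {0} = enat (dim V)"
  using is_compl_rdim[OF fdim_is_compl[OF assms]] subspace_single_0 by auto

lemma fdim_subset: "fdim V \<Longrightarrow> U \<subseteq> V \<Longrightarrow> fdim U"
  unfolding fdim_def by blast

lemma fdim_sums: "fdim U \<Longrightarrow> fdim V \<Longrightarrow> fdim (sumset U V)"
  unfolding fdim_def
proof (elim exE conjE)
  fix B C assume *: "finite B" "U \<subseteq> span B" "finite C" "V \<subseteq> span C"
  then have "sumset U V \<subseteq> span (B \<union> C)"
    unfolding span_Un by blast
  then show "\<exists>B. finite B \<and> sumset U V \<subseteq> span B"
    using * by blast
qed

lemma dim_direct_sum:
  assumes U: "subspace U" "fdim U" and V: "subspace V" "fdim V" and UV: "U \<inter> V \<subseteq> {0}"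
  shows "dim (sumset U V) = dim U + dim V"
proof -
  obtain B where B: "finite B" "B \<subseteq> U" "independent B" "U \<subseteq> span B" "card B = dim U"
    using finite_basis[OF U(2)] .
  obtain C where C: "finite C" "C \<subseteq> V" "independent C" "V \<subseteq> span C" "card C = dim V"
    using finite_basis[OF V(2)] .
  have sB: "span B = U" and sC: "span C = V"
    using B C U V by (auto intro: span_minimal dest: subsetD simp: subset_antisym span_minimal)
  have disj: "B \<inter> C = {}"
    using B(2,3) C(2) UV dependent_zero by blast
  have "independent (B \<union> C)"
  proof (rule independent_if_scalars_zero)
    fix f x assume f: "(\<Sum>x\<in>B \<union> C. f x *\<^sub>R x) = 0" and x: "x \<in> B \<union> C"
    let ?b = "\<Sum>x\<in>B. f x *\<^sub>R x" and ?c = "\<Sum>x\<in>C. f x *\<^sub>R x"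
    have s: "?b + ?c = 0" using f B(1) C(1) disj by (simp add: sum.union_disjoint)
    have "?b \<in> U" "?c \<in> V"
      using B C U V by (auto intro!: subspace_sum subspace_scale)
    moreover have "?b = - ?c" using s by (simp add: eq_neg_iff_add_eq_0)
    ultimately have "?b = 0" "?c = 0" using UV V(1) subspace_neg by fastforce+
    then show "f x = 0"
      using x B(1,3) C(1,3) by (auto simp: independent_explicit_finite_subsets)
  qed (use B C in auto)
  moreover have "span (B \<union> C) = sumset U V"
    unfolding span_Un sB sC by simp
  ultimately have "dim (sumset U V) = card (B \<union> C)"
    by (metis dim_span dim_eq_card_independent)
  then show ?thesis using B C disj by (simp add: card_Un_disjoint)
qed

text \<open>The generators are projected to \<open>V1\<close> along \<open>V2\<close>. For
  \<open>x\<close> in \<open>V1\<close> the leftover component lies in \<open>V1\<close> and in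
  \<open>V2\<close>, so it vanishes. This is what settles additivity when one summand contributes
  infinity.\<close>

lemma rel_le_direct_summand:
  assumes W: "subspace W1" "subspace W2" "W1 \<subseteq> V1" "W2 \<subseteq> V2"
    and V: "subspace V1" "subspace V2" "V1 \<inter> V2 \<subseteq> {0}"
    and n: "rel_le (sumset V1 V2) (sumset W1 W2) n"
  shows "rel_le V1 W1 n"
proof -
  let ?V = "sumset V1 V2" and ?W = "sumset W1 W2"
  have sW: "subspace ?W" and sV: "subspace ?V"
    using W V by (auto intro: subspace_sums)
  obtain F where F: "is_compl ?V ?W F" "dim F \<le> n"
    using complement_exists[OF sW _ sV n] W by blast
  obtain B where B: "finite B" "B \<subseteq> F" "F \<subseteq> span B" "card B = dim F"
    using finite_basis[OF is_complD(3)[OF F(1)]] by metis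
  have "\<exists>q. \<forall>b\<in>B. q b \<in> V1 \<and> b - q b \<in> V2"
  proof (intro bchoice ballI)
    fix b assume "b \<in> B"
    then have "b \<in> ?V" using B(2) is_complD(2)[OF F(1)] by blast
    then obtain x y where "b = x + y" "x \<in> V1" "y \<in> V2" by blast
    then show "\<exists>x. x \<in> V1 \<and> b - x \<in> V2" by (intro exI[of _ x]) simp
  qed
  then obtain q where q: "\<And>b. b \<in> B \<Longrightarrow> q b \<in> V1 \<and> b - q b \<in> V2" by blast
  have "V1 \<subseteq> span (W1 \<union> q ` B)"
  proof
    fix x assume x: "x \<in> V1"
    have "x \<in> ?V"
      using x subspace_0[OF V(2)] by (intro CollectI exI[of _ x] exI[of _ 0]) simp
    from is_complD(5)[OF F(1) this]
    obtain w f where wf: "x = w + f" "w \<in> ?W" "f \<in> F" by blast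
    obtain w1 w2 where w: "w = w1 + w2" "w1 \<in> W1" "w2 \<in> W2" using wf by blast
    have "f \<in> span B" using wf(3) B(3) by blast
    then obtain c where c: "f = (\<Sum>b\<in>B. c b *\<^sub>R b)"
      unfolding span_finite[OF B(1)] by blast
    let ?s = "\<Sum>b\<in>B. c b *\<^sub>R q b"
    have "?s \<in> V1" using q V(1) by (intro subspace_sum subspace_scale) simp_all
    moreover have "w1 \<in> V1" using w(2) W(3) by blast
    ultimately have 1: "x - (w1 + ?s) \<in> V1"
      using x V(1) by (intro subspace_diff subspace_add)
    have "x - (w1 + ?s) = w2 + (\<Sum>b\<in>B. c b *\<^sub>R (b - q b))"
      using wf(1) w(1) c by (simp add: scaleR_diff_right sum_subtractf)
    moreover have "w2 \<in> V2" using w(3) W(4) by blast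
    then have "w2 + (\<Sum>b\<in>B. c b *\<^sub>R (b - q b)) \<in> V2"
      using q V(2) by (intro subspace_add subspace_sum subspace_scale) simp_all
    ultimately have "x = w1 + ?s" using 1 V(3) by force
    moreover have "w1 + ?s \<in> span (W1 \<union> q ` B)"
      using w(2) by (intro span_add span_sum span_scale; intro span_base) auto
    ultimately show "x \<in> span (W1 \<union> q ` B)" by simp
  qed
  moreover have "card (q ` B) \<le> n" using card_image_le[OF B(1), of q] B F by simp
  ultimately show ?thesis using B(1) unfolding rel_le_def by blast
qed

lemma sums_commute:
  fixes A B :: "'a::ab_semigroup_add set"
  shows "sumset A B = sumset B A"
proof -
  have "sumset A B \<subseteq> sumset B A" for A B :: "'a set"
  proof
    fix x assume "x \<in> sumset A B"
    then obtain a b where "x = a + b" "a \<in> A" "b \<in> B" by blast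
    then have "x = b + a" "a \<in> A" "b \<in> B" by (simp_all add: add.commute)
    then show "x \<in> sumset B A" by blast
  qed
  then show ?thesis by blast
qed

text \<open>The source of additivity of nullity and defect. If a summand is infinite, the projection
  argument above makes the total infinite; otherwise the complements of the two summands add up to a
  complement.\<close>

lemma rdim_direct_sum:
  assumes W: "subspace W1" "subspace W2" "W1 \<subseteq> V1" "W2 \<subseteq> V2"
    and V: "subspace V1" "subspace V2" "V1 \<inter> V2 \<subseteq> {0}"
  shows "rdim (sumset V1 V2) (sumset W1 W2)
    = rdim V1 W1 + rdim V2 W2" (is "rdim ?V ?W = _")
proof (cases "rdim V1 W1 = \<infinity> \<or> rdim V2 W2 = \<infinity>")
  case True
  have "rdim ?V ?W = \<infinity>"
  proof (rule ccontr)
    assume "rdim ?V ?W \<noteq> \<infinity>"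
    then obtain n where n: "rel_le ?V ?W n" using rdim_finite_iff by auto
    have "sumset V1 V2 = sumset V2 V1"
      "sumset W1 W2 = sumset W2 W1"
      by (rule sums_commute)+
    then have n': "rel_le (sumset V2 V1) (sumset W2 W1) n"
      using n by simp
    have "rel_le V1 W1 n" using rel_le_direct_summand[OF W V n] .
    moreover have "rel_le V2 W2 n"
      by (rule rel_le_direct_summand[OF W(2,1,4,3) V(2,1) _ n']) (use V in auto)
    ultimately show False using True rdim_finite_iff by (metis enat_ord_simps(6))
  qed
  then show ?thesis using True by auto
next
  case False
  have "\<exists>F. is_compl V1 W1 F" "\<exists>F. is_compl V2 W2 F"
    using False W V fin_codim_iff[of W1 V1] fin_codim_iff[of W2 V2]
    unfolding fin_codim_def by auto
  then obtain F1 F2 where F1: "is_compl V1 W1 F1" and F2: "is_compl V2 W2 F2" by blast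
  let ?F = "sumset F1 F2"
  have sF: "subspace F1" "subspace F2" "fdim F1" "fdim F2" "F1 \<inter> F2 \<subseteq> {0}"
    "F1 \<subseteq> V1" "F2 \<subseteq> V2"
    using is_complD[OF F1] is_complD[OF F2] V(3) by blast+
  have uniq: "a = c \<and> b = d" if "a + b = c + d" "a \<in> V1" "c \<in> V1" "b \<in> V2" "d \<in> V2" for a b c d
  proof -
    have "a - c = d - b" using that(1) by (simp add: algebra_simps)
    moreover have "a - c \<in> V1" "d - b \<in> V2" using that V by (auto intro: subspace_diff)
    ultimately have "a - c = 0" "d - b = 0" using V(3) by auto
    then show ?thesis by simp
  qed
  have "is_compl ?V ?W ?F"
    unfolding is_compl_def
  proof (intro conjI)
    show "subspace ?F" "fdim ?F" using sF by (auto intro: subspace_sums fdim_sums)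
    show "?F \<subseteq> ?V" using sF by blast
    show "?W \<inter> ?F \<subseteq> {0}"
    proof
      fix x assume "x \<in> ?W \<inter> ?F"
      then obtain a b c d where x: "x = a + b" "x = c + d" "a \<in> W1" "b \<in> W2" "c \<in> F1" "d \<in> F2"
        by blast
      then have "a = c \<and> b = d" using W sF by (intro uniq) auto
      then have "a \<in> W1 \<inter> F1" "b \<in> W2 \<inter> F2" using x by auto
      then have "a = 0" "b = 0" using is_complD(4)[OF F1] is_complD(4)[OF F2] by blast+
      then show "x \<in> {0}" using x by simp
    qed
    show "?V \<subseteq> sumset ?W ?F"
    proof
      fix x assume "x \<in> ?V"
      then obtain a b where x: "x = a + b" "a \<in> V1" "b \<in> V2" by blast
      obtain r f where a: "a = r + f" "r \<in> W1" "f \<in> F1" using x is_complD(5)[OF F1] by metis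
      obtain s g where b: "b = s + g" "s \<in> W2" "g \<in> F2" using x is_complD(5)[OF F2] by metis
      have "x = (r + s) + (f + g)" using x a b by (simp add: algebra_simps)
      then show "x \<in> sumset ?W ?F" using a b by blast
    qed
  qed
  then have "rdim ?V ?W = enat (dim ?F)"
    using is_compl_rdim subspace_sums[OF W(1,2)] by blast
  also have "dim ?F = dim F1 + dim F2" using dim_direct_sum sF by blast
  finally show ?thesis using is_compl_rdim[OF F1 W(1)] is_compl_rdim[OF F2 W(2)] by simp
qed

lemma rdim_self: "rdim V V = 0"
proof -
  have "rel_le V V 0" unfolding rel_le_def by (intro exI[of _ "{}"]) (auto intro: span_base)
  then show ?thesis using rdim_le_iff[of V V 0] by (simp flip: zero_enat_def)
qed

lemma rdim_eq_0_iff: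
  assumes "subspace W" "W \<subseteq> V"
  shows "rdim V W = 0 \<longleftrightarrow> V = W"
proof
  assume "rdim V W = 0"
  then have "rel_le V W 0" using rdim_le_iff[of V W 0] by (simp flip: zero_enat_def)
  then show "V = W"
  proof -
    assume "rel_le V W 0"
    then have "V \<subseteq> span W" unfolding rel_le_def by auto
    moreover have "span W = W" using assms by (simp add: span_eq_iff)
    ultimately show "V = W" using assms by blast
  qed
qed (simp add: rdim_self)

text \<open>Provides the decreasing quantity when chains are split off an operator with finite
  nullity.\<close>

lemma dim_strict_mono:
  assumes "subspace U" "subspace V" "fdim V" "U \<subset> V"
  shows "dim U < dim V"
proof -
  have U: "fdim U" using assms fdim_subset by blast
  have "\<exists>F. is_compl V U F"
  proof -
    obtain n where "rel_le V {0} n" using assms(3) fdim_iff_rdim rdim_finite_iff by blast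
    then have "rel_le V U n"
      unfolding rel_le_def using subspace_0[OF assms(1)]
      by (meson Un_mono empty_subsetI insert_subset order_refl order_trans span_mono)
    then show ?thesis using complement_exists[of U V n] assms by auto
  qed
  then obtain F where F: "is_compl V U F" by blast
  have V: "V = sumset U F"
  proof
    show "V \<subseteq> sumset U F" using is_complD(5)[OF F] by blast
    show "sumset U F \<subseteq> V"
      using is_complD(2)[OF F] assms by (auto intro!: subspace_add)
  qed
  have "dim (sumset U F) = dim U + dim F"
    using assms(1) U is_complD[OF F] by (intro dim_direct_sum)
  then have "dim V = dim U + dim F" using V by simp
  moreover have "dim F \<noteq> 0"
  proof
    assume "dim F = 0"
    moreover have "fdim F" by (rule is_complD(3)[OF F])
    then obtain B where "finite B" "F \<subseteq> span B" "card B = dim F"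
      using finite_basis by metis
    ultimately have "F \<subseteq> {0}" by simp
    have "u + f \<in> U" if "u \<in> U" "f \<in> F" for u f
      using that \<open>F \<subseteq> {0}\<close> by auto
    then have "sumset U F \<subseteq> U" by blast
    with V have "V \<subseteq> U" by (rule ord_eq_le_trans)
    then show False using assms by auto
  qed
  ultimately show ?thesis by simp
qed

text \<open>An endomorphism of a finite-dimensional space has index zero: \<open>V\<close> splits as
  kernel plus \<open>C\<close> and as image plus \<open>F\<close>, and \<open>f\<close> carries
  \<open>C\<close> isomorphically onto the image.\<close>

lemma rank_nullity_endo:
  assumes f: "linear f" and V: "subspace V" "fdim V" "f ` V \<subseteq> V"
  shows "rdim (ker_on V f) {0} = rdim V (f ` V)" "rdim V (f ` V) < \<infinity>"
proof -
  let ?K = "ker_on V f"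
  have sK: "subspace ?K"
    using f V(1) unfolding ker_on_def subspace_def
    by (simp add: linear_add linear_scale linear_0)
  have sR: "subspace (f ` V)" using f V by (simp add: linear_subspace_image)
  have KV: "?K \<subseteq> V" unfolding ker_on_def by auto
  obtain n where n: "rel_le V {0} n" using V(2) fdim_iff_rdim rdim_finite_iff by blast
  have rel: "rel_le V W n" if "subspace W" for W
    using n subspace_0[OF that] unfolding rel_le_def
    by (meson Un_mono empty_subsetI insert_subset order_refl order_trans span_mono)
  obtain C where C: "is_compl V ?K C" using complement_exists[OF sK KV V(1) rel[OF sK]] by blast
  obtain F where F: "is_compl V (f ` V) F" using complement_exists[OF sR V(3,1) rel[OF sR]] by blast
  have V1: "V = sumset ?K C"
  proof
    show "V \<subseteq> sumset ?K C" using is_complD(5)[OF C] by blast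
    show "sumset ?K C \<subseteq> V"
      using is_complD(2)[OF C] KV V(1) by (auto intro!: subspace_add)
  qed
  have V2: "V = sumset (f ` V) F"
  proof
    show "V \<subseteq> sumset (f ` V) F" using is_complD(5)[OF F] by blast
    show "sumset (f ` V) F \<subseteq> V"
      using is_complD(2)[OF F] V by (auto intro!: subspace_add)
  qed
  have "dim (sumset ?K C) = dim ?K + dim C"
    using sK fdim_subset[OF V(2) KV] is_complD[OF C] by (intro dim_direct_sum)
  then have d1: "dim V = dim ?K + dim C" using V1 by simp
  have "dim (sumset (f ` V) F) = dim (f ` V) + dim F"
    using sR fdim_subset[OF V(2,3)] is_complD[OF F] by (intro dim_direct_sum)
  then have d2: "dim V = dim (f ` V) + dim F" using V2 by simp
  have img: "f ` V = f ` C"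
  proof
    show "f ` V \<subseteq> f ` C"
    proof
      fix y assume "y \<in> f ` V"
      then obtain x where x: "x \<in> V" "y = f x" by blast
      then obtain u g where "y = f (u + g)" "u \<in> ?K" "g \<in> C" using is_complD(5)[OF C] by blast
      then have "y = f g" using f by (simp add: linear_add ker_on_def)
      then show "y \<in> f ` C" using \<open>g \<in> C\<close> by blast
    qed
  qed (use is_complD(2)[OF C] in blast)
  have sC: "span C = C" using is_complD(1)[OF C] by simp
  have inj: "inj_on f C"
  proof (rule inj_onI)
    fix x y assume xy: "x \<in> C" "y \<in> C" "f x = f y"
    have 1: "x - y \<in> C" using xy is_complD(1)[OF C] by (simp add: subspace_diff)
    then have "x - y \<in> ?K"
      using is_complD(2)[OF C] xy f unfolding ker_on_def by (auto simp: linear_diff)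
    then have "x - y = 0" using is_complD(4)[OF C] 1 by blast
    then show "x = y" by simp
  qed
  have "dim (f ` C) = dim C"
  proof -
    obtain B where B: "finite B" "B \<subseteq> C" "independent B" "C \<subseteq> span B" "card B = dim C"
      using finite_basis[OF is_complD(3)[OF C]] by metis
    have sB: "span B = C" using B(4) span_mono[OF B(2)] sC by simp
    have "independent (f ` B)"
      using linear_independent_injective_image f B(3) inj sB
      by (metis linear_independent_injective_image)
    moreover have "span (f ` B) = f ` C" using f sB by (metis linear_span_image)
    ultimately have "dim (f ` C) = card (f ` B)" by (metis dim_span dim_eq_card_independent)
    also have "\<dots> = card B" using inj B(2) by (intro card_image) (rule inj_on_subset)
    finally show ?thesis using B by simp
  qed
  then have "dim ?K = dim F" using d1 d2 img by simp
  moreover have "fdim ?K" using V KV fdim_subset by blast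
  ultimately show "rdim ?K {0} = rdim V (f ` V)"
    using rdim_zero_eq_dim[OF _ sK] is_compl_rdim[OF F sR] by simp
  show "rdim V (f ` V) < \<infinity>" using is_compl_rdim[OF F sR] by simp
qed

section \<open>Open mapping theorem\<close>

text \<open>Solving approximately over and over halves the residual each time, so the corrections
  are dominated by a geometric series with sum \<open>2 * K * norm y\<close>; completeness and
  closedness of \<open>M\<close> give the limit. Open mapping, closed range and both Neumann-type
  perturbations below reduce to this.\<close>

lemma approx_solvable_imp_solvable:
  fixes f :: "'a::banach \<Rightarrow> 'b::real_normed_vector"
  assumes f: "bounded_linear f" and M: "subspace M" "closed M" and Y: "subspace Y" "f ` M \<subseteq> Y"
    and K: "0 \<le> K" "\<And>y. y \<in> Y \<Longrightarrow> \<exists>x\<in>M. norm x \<le> K * norm y \<and> norm (y - f x) \<le> norm y / 2"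
    and y: "y \<in> Y"
  shows "\<exists>x\<in>M. f x = y \<and> norm x \<le> 2 * K * norm y"
proof -
  interpret f: bounded_linear f by fact
  obtain s where s: "\<And>y. y \<in> Y \<Longrightarrow> s y \<in> M \<and> norm (s y) \<le> K * norm y \<and> norm (y - f (s y)) \<le> norm y / 2"
    using K(2) by metis
  define r where "r n = ((\<lambda>y. y - f (s y)) ^^ n) y" for n
  have r0: "r 0 = y" and rS: "r (Suc n) = r n - f (s (r n))" for n
    by (simp_all add: r_def)
  have rY: "r n \<in> Y" for n
  proof (induction n)
    case (Suc n)
    then have "f (s (r n)) \<in> Y" using s Y(2) by blast
    then show ?case using Suc Y(1) unfolding rS by (simp add: subspace_diff)
  qed (simp add: r0 y)
  have rn: "norm (r n) \<le> norm y * (1/2) ^ n" for n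
  proof (induction n)
    case (Suc n)
    have "norm (r (Suc n)) \<le> norm (r n) / 2" using s[OF rY] unfolding rS by blast
    then show ?case using Suc by simp
  qed (simp add: r0)
  define a where "a n = s (r n)" for n
  have aM: "a n \<in> M" for n using s[OF rY] unfolding a_def by blast
  have an: "norm (a n) \<le> K * norm y * (1/2) ^ n" for n
  proof -
    have "norm (a n) \<le> K * norm (r n)" using s[OF rY] unfolding a_def by blast
    also have "\<dots> \<le> K * (norm y * (1/2) ^ n)" using rn K(1) by (rule mult_left_mono)
    finally show ?thesis by (simp add: mult.assoc)
  qed
  have geo: "summable (\<lambda>n. K * norm y * (1/2) ^ n)" by (intro summable_mult summable_geometric) simp
  have sumn: "summable (\<lambda>n. norm (a n))"
    by (rule summable_comparison_test'[OF geo]) (use an in auto)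
  then have suma: "summable a" by (rule summable_norm_cancel)
  define x where "x = suminf a"
  have lim: "(\<lambda>n. \<Sum>i<n. a i) \<longlonglongrightarrow> x"
    using summable_LIMSEQ[OF suma] unfolding x_def .
  have part: "(\<Sum>i<n. a i) \<in> M" for n using aM M(1) by (intro subspace_sum)
  have xM: "x \<in> M"
    by (rule closed_sequentially[OF M(2) part lim])
  have fp: "f (\<Sum>i<n. a i) = y - r n" for n
    by (induction n) (simp_all add: r0 rS f.add f.zero a_def)
  have "r \<longlonglongrightarrow> 0"
  proof (rule Lim_null_comparison)
    show "\<forall>\<^sub>F n in sequentially. norm (r n) \<le> norm y * (1/2) ^ n" using rn by simp
    show "(\<lambda>n. norm y * (1/2) ^ n) \<longlonglongrightarrow> 0"
      by (intro tendsto_mult_right_zero LIMSEQ_power_zero) simp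
  qed
  then have "(\<lambda>n. y - r n) \<longlonglongrightarrow> y" using tendsto_diff[OF tendsto_const[of y]] by fastforce
  moreover have "(\<lambda>n. f (\<Sum>i<n. a i)) \<longlonglongrightarrow> f x" using lim by (rule f.tendsto)
  ultimately have fx: "f x = y" unfolding fp by (metis LIMSEQ_unique)
  have "norm x \<le> (\<Sum>n. norm (a n))" unfolding x_def by (rule summable_norm[OF sumn])
  also have "\<dots> \<le> (\<Sum>n. K * norm y * (1/2) ^ n)" by (intro suminf_le an sumn geo)
  also have "\<dots> = 2 * K * norm y"
    by (subst suminf_mult) (simp_all add: suminf_geometric summable_geometric)
  finally show ?thesis using xM fx by blast
qed

text \<open>The open mapping theorem for a map restricted to a closed subspace. Baire category is
  applied in the subspace topology of the closed image \<open>Y\<close>.\<close>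

lemma open_mapping_bound:
  fixes f :: "'a::banach \<Rightarrow> 'b::banach"
  assumes f: "bounded_linear f" and M: "subspace M" "closed M" and cl: "closed (f ` M)"
  obtains C where "C > 0" "\<And>x. x \<in> M \<Longrightarrow> \<exists>x'\<in>M. f x' = f x \<and> norm x' \<le> C * norm (f x)"
proof -
  interpret f: bounded_linear f by fact
  define Y where "Y = f ` M"
  have sY: "subspace Y" unfolding Y_def using M(1) f.linear by (rule linear_subspace_image[rotated])
  \<comment> \<open>Closures of the images of balls of radius \<open>n\<close>; they cover
    \<open>Y\<close>, so one of them has interior relative to \<open>Y\<close>.\<close>
  define T where "T n = closure (f ` (M \<inter> cball 0 (real n)))" for n :: nat
  have TY: "T n \<subseteq> Y" for n
    unfolding T_def Y_def using cl by (intro closure_minimal) auto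
  have cover: "Y \<subseteq> (\<Union>n. T n)"
  proof
    fix y assume "y \<in> Y"
    then obtain x where x: "x \<in> M" "y = f x" unfolding Y_def by blast
    obtain n :: nat where "norm x \<le> real n" using real_arch_simple by blast
    then have "y \<in> f ` (M \<inter> cball 0 (real n))" using x by auto
    then have "y \<in> T n" unfolding T_def by (rule subsetD[OF closure_subset])
    then show "y \<in> (\<Union>n. T n)" by blast
  qed
  have "\<exists>n. top_of_set Y interior_of (T n) \<noteq> {}"
  proof (rule ccontr)
    assume a: "\<not> ?thesis"
    have "top_of_set Y interior_of (\<Union>(range T)) = {}"
    proof (rule Baire_category_alt)
      show "completely_metrizable_space (top_of_set Y) \<or> locally_compact_space (top_of_set Y) \<and> regular_space (top_of_set Y)"
        using cl completely_metrizable_space_closedin[OF completely_metrizable_space_euclidean, of Y]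
        by (simp add: Y_def)
      show "countable (range T)" by simp
      show "closedin (top_of_set Y) S \<and> top_of_set Y interior_of S = {}" if "S \<in> range T" for S
        using that a TY unfolding T_def by (auto intro!: closed_subset)
    qed
    moreover have "Y \<subseteq> top_of_set Y interior_of (\<Union>(range T))"
      using cover by (intro interior_of_maximal) auto
    ultimately have "Y = {}" by blast
    then show False using subspace_0[OF sY] by blast
  qed
  then obtain n y0 where "y0 \<in> top_of_set Y interior_of (T n)" by blast
  then obtain U where U: "openin (top_of_set Y) U" "y0 \<in> U" "U \<subseteq> T n"
    unfolding interior_of_def by blast
  then obtain e where e: "e > 0" "ball y0 e \<inter> Y \<subseteq> U"
    unfolding openin_contains_ball by blast
  have y0: "y0 \<in> Y" "y0 \<in> T n" using U TY by blast+
  \<comment> \<open>\<open>y\<close> is the difference of \<open>y0 + y\<close> and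
    \<open>y0\<close>, both approximated by images of vectors of norm at most \<open>n\<close>; this
    is the origin of \<open>2 * real n\<close>.\<close>
  have near: "\<exists>x\<in>M. norm x \<le> 2 * real n \<and> norm (y - f x) \<le> d"
    if y: "y \<in> Y" "norm y < e" and d: "d > 0" for y d
  proof -
    have "y0 + y \<in> Y" using y0 y sY by (simp add: subspace_add)
    moreover have "y0 + y \<in> ball y0 e" using y by (simp add: dist_norm)
    ultimately have "y0 + y \<in> T n" using e U by blast
    then obtain a where a: "a \<in> M" "norm a \<le> real n" "dist (f a) (y0 + y) < d / 2"
      unfolding T_def closure_approachable using d by (force dest: spec[of _ "d/2"])
    obtain b where b: "b \<in> M" "norm b \<le> real n" "dist (f b) y0 < d / 2"
      using y0(2) d unfolding T_def closure_approachable by (force dest: spec[of _ "d/2"])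
    have "norm (a - b) \<le> 2 * real n" using norm_triangle_ineq4[of a b] a b by linarith
    moreover have "norm (y - f (a - b)) \<le> d"
    proof -
      have "y - f (a - b) = (f b - y0) - (f a - (y0 + y))" by (simp add: f.diff)
      then have "norm (y - f (a - b)) \<le> norm (f b - y0) + norm (f a - (y0 + y))"
        by (metis norm_triangle_ineq4)
      then show ?thesis using a b by (simp add: dist_norm)
    qed
    moreover have "a - b \<in> M" using a b M by (simp add: subspace_diff)
    ultimately show ?thesis by blast
  qed
  \<comment> \<open>A vector \<open>y\<close> is scaled to norm \<open>e / 2\<close>, solved with
    norm at most \<open>2 * real n\<close> and scaled back, which costs
    \<open>4 * real n / e\<close>. The added 1 keeps \<open>K\<close> positive when
    \<open>n = 0\<close>.\<close>
  define K where "K = 4 * real n / e + 1"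
  have K: "K > 0" unfolding K_def using e by (intro add_nonneg_pos) auto
  have app: "\<exists>x\<in>M. norm x \<le> K * norm y \<and> norm (y - f x) \<le> norm y / 2" if y: "y \<in> Y" for y
  proof (cases "y = 0")
    case True
    then show ?thesis using subspace_0[OF M(1)] by (intro bexI[of _ 0]) (auto simp: f.zero)
  next
    case False
    define t where "t = e / (2 * norm y)"
    have t: "t > 0" unfolding t_def using e False by simp
    have tn: "norm (t *\<^sub>R y) < e" unfolding t_def using e False by simp
    obtain x where x: "x \<in> M" "norm x \<le> 2 * real n" "norm (t *\<^sub>R y - f x) \<le> e / 4"
      using near[OF subspace_scale[OF sY y] tn, of "e / 4"] e by auto
    let ?x = "(1 / t) *\<^sub>R x"
    have "norm ?x \<le> (1 / t) * (2 * real n)" using t x by (simp add: divide_right_mono)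
    also have "\<dots> = 4 * real n / e * norm y" unfolding t_def using e False by (simp add: field_simps)
    also have "\<dots> \<le> K * norm y" unfolding K_def by (simp add: algebra_simps)
    finally have 1: "norm ?x \<le> K * norm y" .
    have "y - f ?x = (1 / t) *\<^sub>R (t *\<^sub>R y - f x)"
      using t by (simp add: f.scaleR scaleR_diff_right)
    then have "norm (y - f ?x) = (1 / t) * norm (t *\<^sub>R y - f x)" using t by simp
    also have "\<dots> \<le> (1 / t) * (e / 4)" using t x by (intro mult_left_mono) auto
    also have "\<dots> = norm y / 2" unfolding t_def using e False by (simp add: field_simps)
    finally have "norm (y - f ?x) \<le> norm y / 2" .
    then show ?thesis using 1 subspace_scale[OF M(1) x(1)] by blast
  qed
  show thesis
  proof (rule that[of "2 * K"])
    show "2 * K > 0" using K by simp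
    fix x assume "x \<in> M"
    then have "f x \<in> Y" unfolding Y_def by blast
    then show "\<exists>x'\<in>M. f x' = f x \<and> norm x' \<le> 2 * K * norm (f x)"
      using approx_solvable_imp_solvable[OF f M sY _ less_imp_le[OF K] app] Y_def by blast
  qed
qed

lemma closure_subspace:
  fixes S :: "'a::real_normed_vector set"
  assumes S: "subspace S"
  shows "subspace (closure S)"
  unfolding subspace_def
proof (intro conjI ballI allI)
  show "0 \<in> closure S" using subspace_0[OF S] by (rule subsetD[OF closure_subset])
next
  fix x y assume "x \<in> closure S" "y \<in> closure S"
  then obtain u v where "\<forall>n. u n \<in> S" "u \<longlonglongrightarrow> x" "\<forall>n. v n \<in> S" "v \<longlonglongrightarrow> y"
    unfolding closure_sequential by blast
  then show "x + y \<in> closure S"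
    unfolding closure_sequential
    by (intro exI[of _ "\<lambda>n. u n + v n"]) (simp add: subspace_add[OF S] tendsto_add)
next
  fix c :: real and x assume "x \<in> closure S"
  then obtain u where "\<forall>n. u n \<in> S" "u \<longlonglongrightarrow> x" unfolding closure_sequential by blast
  then show "c *\<^sub>R x \<in> closure S"
    unfolding closure_sequential
    by (intro exI[of _ "\<lambda>n. c *\<^sub>R u n"]) (simp add: subspace_scale[OF S] tendsto_scaleR)
qed

text \<open>Every point of the closure is approximable by images with controlled preimages, hence
  exactly solvable. The factor 2 in \<open>2 * C\<close> arises because an approximating value
  \<open>z\<close> within \<open>norm y / 2\<close> of \<open>y\<close> has norm at most
  \<open>2 * norm y\<close>.\<close>

lemma closed_range_if_bound:
  fixes f :: "'a::banach \<Rightarrow> 'b::real_normed_vector"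
  assumes f: "bounded_linear f" and M: "subspace M" "closed M" and C: "C \<ge> 0"
    and bd: "\<And>x. x \<in> M \<Longrightarrow> \<exists>x'\<in>M. f x' = f x \<and> norm x' \<le> C * norm (f x)"
  shows "closed (f ` M)"
proof -
  interpret f: bounded_linear f by fact
  let ?Y = "closure (f ` M)"
  have "subspace (f ` M)" using M(1) f.linear by (rule linear_subspace_image[rotated])
  then have sY: "subspace ?Y" by (rule closure_subspace)
  have app: "\<exists>x\<in>M. norm x \<le> (2 * C) * norm y \<and> norm (y - f x) \<le> norm y / 2" if y: "y \<in> ?Y" for y
  proof (cases "y = 0")
    case True
    then show ?thesis using subspace_0[OF M(1)] by (intro bexI[of _ 0]) (auto simp: f.zero)
  next
    case False
    then have "norm y / 2 > 0" by simp
    then obtain z where z: "z \<in> f ` M" "dist z y < norm y / 2"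
      using y unfolding closure_approachable by blast
    then obtain x where x: "x \<in> M" "f x = z" "norm x \<le> C * norm z" using bd by blast
    have "norm z \<le> 2 * norm y"
      using z norm_triangle_sub[of z y] norm_ge_zero[of y] unfolding dist_norm by linarith
    then have "norm x \<le> 2 * C * norm y" using x C mult_left_mono[of "norm z" "2 * norm y" C] by linarith
    moreover have "norm (y - f x) \<le> norm y / 2" using z x by (simp add: dist_norm norm_minus_commute)
    ultimately show ?thesis using x by blast
  qed
  have "?Y \<subseteq> f ` M"
  proof
    fix y assume "y \<in> ?Y"
    then show "y \<in> f ` M"
      using approx_solvable_imp_solvable[OF f M sY closure_subset _ app] C by force
  qed
  then show ?thesis by (metis closed_closure closure_subset subset_antisym)
qed

text \<open>Adding the complement as a second argument makes \<open>(x, u) \<mapsto> f x + u\<close>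
  map onto the closed space \<open>V\<close>, so preimages are bounded. For a value in the range of
  \<open>f\<close> the second component lies in the range and in \<open>F\<close>, hence is 0, and
  the bound descends to \<open>f\<close>.\<close>

lemma closed_range_finite_codim:
  fixes f :: "'a::banach \<Rightarrow> 'b::banach"
  assumes f: "bounded_linear f" and M: "subspace M" "closed M" and V: "closed V"
    and R: "f ` M \<subseteq> V" "subspace V" and F: "is_compl V (f ` M) F" "closed F"
  shows "closed (f ` M)"
proof -
  interpret f: bounded_linear f by fact
  let ?h = "\<lambda>p. f (fst p) + snd p"
  have h: "bounded_linear ?h"
    by (intro bounded_linear_add bounded_linear_compose[OF f] bounded_linear_fst bounded_linear_snd)
  have sub: "subspace (M \<times> F)" using M(1) is_complD(1)[OF F(1)] by (rule subspace_Times)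
  have img: "?h ` (M \<times> F) = V"
  proof
    show "?h ` (M \<times> F) \<subseteq> V" using R is_complD(2)[OF F(1)] by (auto intro!: subspace_add)
    show "V \<subseteq> ?h ` (M \<times> F)"
    proof
      fix v assume "v \<in> V"
      then obtain r u where "r \<in> f ` M" "u \<in> F" "v = r + u" using is_complD(5)[OF F(1)] by blast
      then show "v \<in> ?h ` (M \<times> F)" by force
    qed
  qed
  have "closed (?h ` (M \<times> F))" using V img by simp
  from open_mapping_bound[OF h sub closed_Times[OF M(2) F(2)] this]
  obtain C where C: "C > 0" "\<And>p. p \<in> M \<times> F \<Longrightarrow> \<exists>q\<in>M \<times> F. ?h q = ?h p \<and> norm q \<le> C * norm (?h p)"
    by blast
  show ?thesis
  proof (rule closed_range_if_bound[OF f M, of C])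
    fix x assume x: "x \<in> M"
    have "(x, 0) \<in> M \<times> F" using x subspace_0[OF is_complD(1)[OF F(1)]] by simp
    from C(2)[OF this] obtain a b where ab: "a \<in> M" "b \<in> F" "f a + b = f x" "norm (a, b) \<le> C * norm (f x)"
      by auto
    have "b = f (x - a)" using ab by (simp add: f.diff algebra_simps)
    moreover have "x - a \<in> M" using ab(1) x M(1) by (simp add: subspace_diff)
    ultimately have "b \<in> f ` M \<inter> F" using ab(2) by blast
    then have "b = 0" using is_complD(4)[OF F(1)] by blast
    moreover have "norm a \<le> norm (a, b)" by (rule norm_fst_le)
    ultimately show "\<exists>x'\<in>M. f x' = f x \<and> norm x' \<le> C * norm (f x)" using ab by (intro bexI[of _ a]) auto
  qed (use C in simp)
qed

text \<open>The open mapping bound for addition on \<open>M \<times> N\<close>; trivial intersection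
  forces the bounded preimage to be the given pair.\<close>

lemma direct_sum_projection_bound:
  fixes M N :: "'a::banach set"
  assumes M: "subspace M" "closed M" and N: "subspace N" "closed N" and MN: "M \<inter> N \<subseteq> {0}"
    and cl: "closed (sumset M N)"
  obtains C where "C > 0" "\<And>m n. m \<in> M \<Longrightarrow> n \<in> N \<Longrightarrow> norm m \<le> C * norm (m + n) \<and> norm n \<le> C * norm (m + n)"
proof -
  let ?h = "\<lambda>p. fst p + snd p"
  have h: "bounded_linear (?h :: 'a \<times> 'a \<Rightarrow> 'a)"
    by (intro bounded_linear_add bounded_linear_fst bounded_linear_snd)
  have "?h ` (M \<times> N) = sumset M N" by force
  with cl have "closed (?h ` (M \<times> N))" by simp
  from open_mapping_bound[OF h subspace_Times[OF M(1) N(1)] closed_Times[OF M(2) N(2)] this]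
  obtain C where C: "C > 0" "\<And>p. p \<in> M \<times> N \<Longrightarrow> \<exists>q\<in>M \<times> N. ?h q = ?h p \<and> norm q \<le> C * norm (?h p)"
    by blast
  have "norm m \<le> C * norm (m + n) \<and> norm n \<le> C * norm (m + n)" if mn: "m \<in> M" "n \<in> N" for m n
  proof -
    have "(m, n) \<in> M \<times> N" using mn by simp
    from C(2)[OF this] obtain a b where ab: "a \<in> M" "b \<in> N" "a + b = m + n" "norm (a, b) \<le> C * norm (m + n)"
      by auto
    have eq: "m - a = b - n" using ab(3) by (simp add: algebra_simps)
    have "m - a \<in> M" "b - n \<in> N" using mn ab M N by (auto intro: subspace_diff)
    then have "m - a = 0" "b - n = 0" using eq MN by auto
    then have "m = a" "n = b" by simp_all
    then show ?thesis
      using ab(4) norm_fst_le[of a b] norm_snd_le[of b a] by auto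
  qed
  then show thesis using that[OF C(1)] by blast
qed

section \<open>Stability of dimension under small gap\<close>

lemma infdist_scale_le:
  fixes x :: "'a::real_normed_vector"
  assumes "subspace W" "w \<in> W"
  shows "\<bar>t\<bar> * infdist x W \<le> norm (t *\<^sub>R x + w)"
proof (cases "t = 0")
  case False
  have "(- 1 / t) *\<^sub>R w \<in> W" using assms by (intro subspace_scale)
  then have "infdist x W \<le> dist x ((- 1 / t) *\<^sub>R w)" by (rule infdist_le)
  then have "\<bar>t\<bar> * infdist x W \<le> \<bar>t\<bar> * norm (x + (1 / t) *\<^sub>R w)"
    by (intro mult_left_mono) (simp_all add: dist_norm)
  also have "\<dots> = norm (t *\<^sub>R (x + (1 / t) *\<^sub>R w))" by simp
  also have "t *\<^sub>R (x + (1 / t) *\<^sub>R w) = t *\<^sub>R x + w" using False by (simp add: scaleR_add_right)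
  finally show ?thesis .
qed simp

text \<open>The coefficient of \<open>x\<close> is controlled by the positive distance
  \<open>d\<close> from \<open>x\<close> to \<open>W\<close>. Along a convergent sequence the
  coefficients are therefore Cauchy, and what remains converges in \<open>W\<close>.\<close>

lemma closed_span_insert:
  fixes W :: "'a::real_normed_vector set"
  assumes W: "subspace W" "closed W"
  shows "closed (span (insert x W))"
proof (cases "x \<in> W")
  case True
  then have "span (insert x W) = W" using W(1) by (simp add: insert_absorb)
  then show ?thesis using W(2) by simp
next
  case False
  have "infdist x W > 0"
    using infdist_pos_not_in_closed[OF W(2) _ False] subspace_0[OF W(1)] by blast
  define d where "d = infdist x W"
  have d: "d > 0" unfolding d_def by fact
  have sp: "y \<in> span (insert x W) \<longleftrightarrow> (\<exists>k. y - k *\<^sub>R x \<in> W)" for y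
    using W(1) by (simp add: span_insert span_eq_iff[THEN iffD2])
  show ?thesis
    unfolding closed_sequential_limits
  proof (intro allI impI, elim conjE)
    fix y l assume y: "\<forall>n. y n \<in> span (insert x W)" and l: "y \<longlonglongrightarrow> l"
    then obtain k where k: "\<And>n. y n - k n *\<^sub>R x \<in> W" unfolding sp by metis
    have kd: "\<bar>k m - k n\<bar> * d \<le> norm (y m - y n)" for m n
    proof -
      have "(y m - k m *\<^sub>R x) - (y n - k n *\<^sub>R x) \<in> W" by (rule subspace_diff[OF W(1) k k])
      from infdist_scale_le[OF W(1) this, of "k m - k n" x]
      show ?thesis unfolding d_def by (simp add: algebra_simps)
    qed
    have "Cauchy k"
    proof (rule CauchyI)
      fix e :: real assume "e > 0"
      then have "e * d > 0" using d by simp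
      moreover have "Cauchy y" using l by (rule LIMSEQ_imp_Cauchy)
      ultimately obtain N where N: "\<And>m n. m \<ge> N \<Longrightarrow> n \<ge> N \<Longrightarrow> norm (y m - y n) < e * d"
        unfolding Cauchy_iff by meson
      have "norm (k m - k n) < e" if "m \<ge> N" "n \<ge> N" for m n
      proof -
        have "\<bar>k m - k n\<bar> * d < e * d" using kd[of m n] N[OF that] by linarith
        then show ?thesis using d by simp
      qed
      then show "\<exists>M. \<forall>m\<ge>M. \<forall>n\<ge>M. norm (k m - k n) < e" by blast
    qed
    then obtain c where "k \<longlonglongrightarrow> c" using Cauchy_convergent convergent_def by blast
    then have "(\<lambda>n. y n - k n *\<^sub>R x) \<longlonglongrightarrow> l - c *\<^sub>R x"
      using l by (intro tendsto_intros)
    then have "l - c *\<^sub>R x \<in> W" using closed_sequentially[OF W(2), of "\<lambda>n. y n - k n *\<^sub>R x"] k by simp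
    then show "l \<in> span (insert x W)" unfolding sp by blast
  qed
qed

lemma closed_span_Un_finite:
  fixes W :: "'a::real_normed_vector set"
  assumes "subspace W" "closed W" "finite B"
  shows "closed (span (W \<union> B))"
  using assms(3)
proof (induction B)
  case empty
  then show ?case using assms by (simp add: span_eq_iff[THEN iffD2])
next
  case (insert b B)
  have "span (W \<union> insert b B) = span (insert b (span (W \<union> B)))"
    by (simp add: span_insert span_span)
  then show ?case using closed_span_insert[OF subspace_span insert.IH, of b] by simp
qed

lemma closed_sum_fdim:
  fixes W :: "'a::real_normed_vector set"
  assumes "subspace W" "closed W" "subspace F" "fdim F"
  shows "closed (sumset W F)"
proof -
  obtain B where B: "finite B" "B \<subseteq> F" "F \<subseteq> span B" using finite_basis[OF assms(4)] by metis
  have "span B = F" using B assms(3) by (simp add: span_minimal subset_antisym)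
  then have "span (W \<union> B) = sumset W F"
    using span_subspace_Un[OF assms(1), of B] by simp
  then show ?thesis using closed_span_Un_finite[OF assms(1,2) B(1)] by simp
qed

lemma closed_fdim:
  fixes F :: "'a::real_normed_vector set"
  assumes "subspace F" "fdim F"
  shows "closed F"
proof -
  have "sumset {0} F = F" by auto
  then show ?thesis using closed_sum_fdim[OF subspace_single_0 _ assms] by simp
qed

text \<open>Riesz's lemma with factor 1/2, phrased as a bound on the coefficient of
  \<open>z\<close>. The point \<open>w0\<close> is within twice the distance from \<open>x\<close>
  to \<open>W\<close>, and \<open>z\<close> is the normalised difference.\<close>

lemma riesz_vector:
  fixes W :: "'a::real_normed_vector set"
  assumes W: "subspace W" "closed W" "W \<subseteq> V" and V: "subspace V" "\<not> V \<subseteq> W"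
  obtains z where "z \<in> V" "z \<notin> W" "norm z \<le> 1" "\<And>t w. w \<in> W \<Longrightarrow> \<bar>t\<bar> \<le> 2 * norm (t *\<^sub>R z + w)"
proof -
  obtain x where x: "x \<in> V" "x \<notin> W" using V by blast
  have W0: "W \<noteq> {}" using subspace_0[OF W(1)] by blast
  define d where "d = infdist x W"
  have d: "d > 0" unfolding d_def using infdist_pos_not_in_closed[OF W(2) W0 x(2)] .
  have "\<exists>w\<in>W. dist x w < 2 * d"
  proof (rule ccontr)
    assume "\<not> ?thesis"
    then have "2 * d \<le> infdist x W"
      using W0 unfolding infdist_notempty[OF W0] by (intro cINF_greatest) auto
    then show False using d unfolding d_def by simp
  qed
  then obtain w0 where w0: "w0 \<in> W" "norm (x - w0) < 2 * d" by (auto simp: dist_norm)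
  define u where "u = x - w0"
  have u0: "norm u > 0" using x w0 unfolding u_def by auto
  define z where "z = (1 / norm u) *\<^sub>R u"
  show thesis
  proof (rule that)
    have "u \<in> V" unfolding u_def using x w0 W V by (intro subspace_diff) auto
    then show "z \<in> V" unfolding z_def using V by (intro subspace_scale)
    show "norm z \<le> 1" unfolding z_def using u0 by simp
    show "\<bar>t\<bar> \<le> 2 * norm (t *\<^sub>R z + w)" if "w \<in> W" for t w
    proof -
      define s where "s = t / norm u"
      have "- s *\<^sub>R w0 + w \<in> W" using that w0 W by (intro subspace_add subspace_scale)
      from infdist_scale_le[OF W(1) this, of s x]
      have "\<bar>s\<bar> * d \<le> norm (s *\<^sub>R x + (- s *\<^sub>R w0 + w))" unfolding d_def .
      also have "s *\<^sub>R x + (- s *\<^sub>R w0 + w) = t *\<^sub>R z + w"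
        unfolding z_def u_def s_def by (simp add: scaleR_diff_right)
      finally have 1: "\<bar>s\<bar> * d \<le> norm (t *\<^sub>R z + w)" .
      have "\<bar>t\<bar> = \<bar>s\<bar> * norm u" unfolding s_def using u0 by simp
      also have "\<dots> \<le> \<bar>s\<bar> * (2 * d)" using w0 unfolding u_def by (intro mult_left_mono) auto
      finally show ?thesis using 1 by linarith
    qed
    then have key: "\<And>t w. w \<in> W \<Longrightarrow> \<bar>t\<bar> \<le> 2 * norm (t *\<^sub>R z + w)" .
    show "z \<notin> W"
    proof
      assume "z \<in> W"
      then have "- z \<in> W" using W(1) by (simp add: subspace_neg)
      from key[OF this, of 1] show False by simp
    qed
  qed
qed

lemma rel_le_if_subset:
  assumes "V \<subseteq> W"
  shows "rel_le V W n"
proof -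
  have "V \<subseteq> span (W \<union> {})" using assms span_superset[of W] by auto
  then show ?thesis unfolding rel_le_def by fastforce
qed

text \<open>Riesz vectors chosen one after the other, each step enlarging \<open>W\<close> by the
  new vector \<open>z\<close>. If the remaining coefficients are bounded with constant
  \<open>K\<close>, including \<open>z\<close> turns it into \<open>3 * K + 2\<close>; starting from
  2 this recursion gives \<open>3 ^ Suc n - 1\<close>.\<close>

lemma almost_orthogonal_system:
  fixes W :: "'a::real_normed_vector set"
  assumes "subspace V" "subspace W" "closed W" "W \<subseteq> V" "\<not> rel_le V W n"
  shows "\<exists>B. finite B \<and> B \<subseteq> V \<and> card B = Suc n \<and> (\<forall>b\<in>B. norm b \<le> 1)
    \<and> (\<forall>c. \<forall>w\<in>W. (\<Sum>b\<in>B. \<bar>c b\<bar>) \<le> (3 ^ Suc n - 1) * norm ((\<Sum>b\<in>B. c b *\<^sub>R b) + w))"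
  using assms(2-5)
proof (induction n arbitrary: W)
  case 0
  have "\<not> V \<subseteq> W" using rel_le_if_subset 0(4) by blast
  then obtain z where z: "z \<in> V" "norm z \<le> 1" "\<And>t w. w \<in> W \<Longrightarrow> \<bar>t\<bar> \<le> 2 * norm (t *\<^sub>R z + w)"
    using riesz_vector[OF 0(1-3) assms(1)] by metis
  then show ?case by (intro exI[of _ "{z}"]) auto
next
  case (Suc n)
  have "\<not> V \<subseteq> W" using rel_le_if_subset Suc(5) by blast
  then obtain z where z: "z \<in> V" "z \<notin> W" "norm z \<le> 1" "\<And>t w. w \<in> W \<Longrightarrow> \<bar>t\<bar> \<le> 2 * norm (t *\<^sub>R z + w)"
    using riesz_vector[OF Suc(2-4) assms(1)] by metis
  define W1 where "W1 = span (insert z W)"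
  have W1: "subspace W1" "closed W1" "W1 \<subseteq> V"
    unfolding W1_def using closed_span_insert[OF Suc(2,3)] z(1) Suc(4) assms(1)
    by (simp_all add: span_minimal)
  have "\<not> rel_le V W1 n"
  proof
    assume "rel_le V W1 n"
    then obtain C where C: "finite C" "card C \<le> n" "V \<subseteq> span (W1 \<union> C)" unfolding rel_le_def by blast
    have "span (W1 \<union> C) \<subseteq> span (W \<union> insert z C)"
    proof (rule span_minimal)
      have "W1 \<subseteq> span (W \<union> insert z C)" unfolding W1_def by (rule span_mono) blast
      moreover have "C \<subseteq> span (W \<union> insert z C)" by (auto intro: span_base)
      ultimately show "W1 \<union> C \<subseteq> span (W \<union> insert z C)" by blast
    qed simp
    moreover have "card (insert z C) \<le> Suc n" using C by (simp add: card_insert_le_m1 card_insert_if)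
    ultimately show False using Suc(5) C unfolding rel_le_def by (meson finite_insert order_trans)
  qed
  from Suc.IH[OF W1 this] obtain B where B: "finite B" "B \<subseteq> V" "card B = Suc n" "\<And>b. b \<in> B \<Longrightarrow> norm b \<le> 1"
    "\<And>c w. w \<in> W1 \<Longrightarrow> (\<Sum>b\<in>B. \<bar>c b\<bar>) \<le> (3 ^ Suc n - 1) * norm ((\<Sum>b\<in>B. c b *\<^sub>R b) + w)"
    by blast
  define K :: real where "K = 3 ^ Suc n - 1"
  have "(1::real) \<le> 3 ^ Suc n" by (rule one_le_power) simp
  then have K: "K \<ge> 0" unfolding K_def by simp
  have zW1: "z \<in> W1" unfolding W1_def by (simp add: span_base)
  \<comment> \<open>Needed for the cardinality. Otherwise coefficient 1 at \<open>z\<close> together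
    with \<open>w = - z\<close> would make the bound read 1 <= 0.\<close>
  have "z \<notin> B"
  proof
    assume zB: "z \<in> B"
    have "- z \<in> W1" using zW1 W1(1) by (simp add: subspace_neg)
    from B(5)[OF this, of "\<lambda>b. if b = z then 1 else 0"]
    have "(\<Sum>b\<in>B. \<bar>if b = z then 1 else (0::real)\<bar>) \<le> K * norm ((\<Sum>b\<in>B. (if b = z then 1 else 0) *\<^sub>R b) + - z)"
      unfolding K_def .
    moreover have "(\<Sum>b\<in>B. \<bar>if b = z then 1 else (0::real)\<bar>) = 1"
      using B(1) zB by (subst sum.remove[OF B(1) zB]) (auto intro: sum.neutral)
    moreover have "(\<Sum>b\<in>B. (if b = z then 1 else (0::real)) *\<^sub>R b) = z"
      using B(1) zB by (subst sum.remove[OF B(1) zB]) (auto intro: sum.neutral)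
    ultimately show False by simp
  qed
  show ?case
  proof (intro exI[of _ "insert z B"] conjI allI ballI)
    show "finite (insert z B)" "insert z B \<subseteq> V" "card (insert z B) = Suc (Suc n)"
      using B z \<open>z \<notin> B\<close> by auto
    show "norm b \<le> 1" if "b \<in> insert z B" for b using that z(3) B(4) by auto
    fix c w assume w: "w \<in> W"
    let ?s = "\<Sum>b\<in>B. c b *\<^sub>R b"
    define a where "a = (\<Sum>b\<in>B. \<bar>c b\<bar>)"
    define D where "D = norm (?s + (c z *\<^sub>R z + w))"
    have "w \<in> W1" unfolding W1_def using w by (simp add: span_base)
    then have "c z *\<^sub>R z + w \<in> W1" using zW1 W1(1) by (simp add: subspace_add subspace_scale)
    from B(5)[OF this] have aK: "a \<le> K * D" unfolding K_def D_def a_def .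
    have "norm ?s \<le> (\<Sum>b\<in>B. norm (c b *\<^sub>R b))" by (rule norm_sum)
    also have "\<dots> \<le> a" unfolding a_def using B(4) by (intro sum_mono) (simp add: mult_left_le)
    finally have s: "norm ?s \<le> a" .
    have "norm (c z *\<^sub>R z + w) \<le> D + norm ?s"
      unfolding D_def using norm_triangle_ineq4[of "?s + (c z *\<^sub>R z + w)" ?s] by simp
    then have "norm (c z *\<^sub>R z + w) \<le> D + a" using s by (meson add_left_mono order_trans)
    then have "2 * norm (c z *\<^sub>R z + w) \<le> 2 * (D + a)" by (intro mult_left_mono) auto
    then have "\<bar>c z\<bar> \<le> 2 * (D + a)" using z(4)[OF w, of "c z"] by (rule order_trans[rotated])
    then have "\<bar>c z\<bar> + a \<le> 2 * (D + a) + a" by (rule add_right_mono)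
    also have "\<dots> = 2 * D + 3 * a" by simp
    also have "\<dots> \<le> 2 * D + 3 * (K * D)" using aK by (intro add_left_mono mult_left_mono) auto
    also have "\<dots> = (3 ^ Suc (Suc n) - 1) * D" unfolding K_def by (simp add: algebra_simps)
    finally have "\<bar>c z\<bar> + a \<le> (3 ^ Suc (Suc n) - 1) * D" .
    moreover have "(\<Sum>b\<in>insert z B. c b *\<^sub>R b) + w = ?s + (c z *\<^sub>R z + w)"
      using B(1) \<open>z \<notin> B\<close> by simp
    ultimately show "(\<Sum>b\<in>insert z B. \<bar>c b\<bar>) \<le> (3 ^ Suc (Suc n) - 1) * norm ((\<Sum>b\<in>insert z B. c b *\<^sub>R b) + w)"
      using B(1) \<open>z \<notin> B\<close> unfolding D_def a_def by (simp add: add_ac)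
  qed
qed

text \<open>Take \<open>n + 1\<close> almost orthogonal vectors in \<open>V\<close>. Their
  approximations in \<open>U\<close> satisfy a nontrivial relation, so the same combination of the
  vectors themselves is small, against the lower bound on its norm.\<close>

lemma gap_rel_le_zero:
  fixes U V :: "'a::real_normed_vector set"
  assumes U: "rel_le U {0} n" and V: "subspace V"
    and gap: "\<And>v. v \<in> V \<Longrightarrow> \<exists>u\<in>U. norm (v - u) \<le> e * norm v" and e: "0 \<le> e" "e * 3 ^ Suc n \<le> 1"
  shows "rel_le V {0} n"
proof (rule ccontr)
  assume no: "\<not> rel_le V {0} n"
  have "{0} \<subseteq> V" using subspace_0[OF V] by simp
  from almost_orthogonal_system[OF V subspace_single_0 closed_singleton this no]
  obtain B where B: "finite B" "B \<subseteq> V" "card B = Suc n" "\<And>b. b \<in> B \<Longrightarrow> norm b \<le> 1"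
    "\<And>c. (\<Sum>b\<in>B. \<bar>c b\<bar>) \<le> (3 ^ Suc n - 1) * norm (\<Sum>b\<in>B. c b *\<^sub>R b)"
    by auto
  obtain C where C: "finite C" "card C \<le> n" "U \<subseteq> span ({0} \<union> C)" using U unfolding rel_le_def by blast
  obtain q where q: "\<And>b. b \<in> B \<Longrightarrow> q b \<in> U \<and> norm (b - q b) \<le> e * norm b"
    using gap B(2) by (metis subsetD)
  have "q ` B \<subseteq> span C" using q C(3) by auto
  from exists_nontrivial_relation[OF B(1) C(1) this]
  obtain c where c: "\<exists>b\<in>B. c b \<noteq> 0" "(\<Sum>b\<in>B. c b *\<^sub>R q b) = 0" using B(3) C(2) by auto
  define s where "s = (\<Sum>b\<in>B. \<bar>c b\<bar>)"
  have s: "s > 0" unfolding s_def using c(1) B(1) by (auto intro: sum_pos2)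
  have "(\<Sum>b\<in>B. c b *\<^sub>R b) = (\<Sum>b\<in>B. c b *\<^sub>R (b - q b))"
    using c(2) by (simp add: scaleR_diff_right sum_subtractf)
  also have "norm \<dots> \<le> (\<Sum>b\<in>B. norm (c b *\<^sub>R (b - q b)))" by (rule norm_sum)
  also have "\<dots> \<le> (\<Sum>b\<in>B. \<bar>c b\<bar> * e)"
  proof (rule sum_mono)
    fix b assume b: "b \<in> B"
    have "norm (b - q b) \<le> e"
      using q[OF b] mult_left_mono[OF B(4)[OF b] e(1)] by linarith
    then show "norm (c b *\<^sub>R (b - q b)) \<le> \<bar>c b\<bar> * e" by (simp add: mult_left_mono)
  qed
  finally have "norm (\<Sum>b\<in>B. c b *\<^sub>R b) \<le> s * e" unfolding s_def by (simp add: sum_distrib_right)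
  moreover have "(1::real) \<le> 3 ^ Suc n" by (rule one_le_power) simp
  ultimately have "(3 ^ Suc n - 1) * norm (\<Sum>b\<in>B. c b *\<^sub>R b) \<le> (3 ^ Suc n - 1) * (s * e)"
    by (intro mult_left_mono) auto
  then have "s \<le> (3 ^ Suc n - 1) * (s * e)"
    using B(5)[of c] unfolding s_def by (rule order_trans[rotated])
  also have "\<dots> = s * (e * 3 ^ Suc n - e)" by (simp add: algebra_simps)
  \<comment> \<open>With \<open>e * 3 ^ Suc n \<le> 1\<close> this forces \<open>e = 0\<close>, and
    then the same inequality fails.\<close>
  finally have "1 \<le> e * 3 ^ Suc n - e" using s by simp
  then have "e = 0" using e by linarith
  with \<open>1 \<le> e * 3 ^ Suc n - e\<close> show False by simp
qed

text \<open>The dual estimate, with almost orthogonality taken modulo \<open>R'\<close>. A relation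
  modulo \<open>R\<close> puts a combination \<open>x\<close> into \<open>R\<close>, where it is
  close to \<open>R'\<close>. The gap is measured from \<open>R\<close> to \<open>R'\<close>,
  opposite to the direction used for kernels.\<close>

lemma gap_rel_le_codim:
  fixes R R' :: "'a::real_normed_vector set"
  assumes R: "rel_le M R n" "subspace R" and R': "subspace R'" "closed R'" "R' \<subseteq> M" and M: "subspace M"
    and gap: "\<And>r. r \<in> R \<Longrightarrow> \<exists>r'\<in>R'. norm (r - r') \<le> e * norm r" and e: "0 \<le> e" "e * 3 ^ Suc n \<le> 1"
  shows "rel_le M R' n"
proof (rule ccontr)
  assume no: "\<not> rel_le M R' n"
  from almost_orthogonal_system[OF M R' no]
  obtain B where B: "finite B" "B \<subseteq> M" "card B = Suc n" "\<And>b. b \<in> B \<Longrightarrow> norm b \<le> 1"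
    "\<And>c w. w \<in> R' \<Longrightarrow> (\<Sum>b\<in>B. \<bar>c b\<bar>) \<le> (3 ^ Suc n - 1) * norm ((\<Sum>b\<in>B. c b *\<^sub>R b) + w)"
    by blast
  obtain C where C: "finite C" "card C \<le> n" "M \<subseteq> span (R \<union> C)" using R unfolding rel_le_def by blast
  have "\<exists>q. \<forall>b\<in>B. q b \<in> span C \<and> b - q b \<in> R"
  proof (intro bchoice ballI)
    fix b assume "b \<in> B"
    then have "b \<in> span (R \<union> C)" using B C by blast
    then obtain w c where "b = w + c" "w \<in> R" "c \<in> span C"
      unfolding span_subspace_Un[OF R(2)] by blast
    then show "\<exists>y. y \<in> span C \<and> b - y \<in> R" by (intro exI[of _ c]) simp
  qed
  then obtain q where q: "\<And>b. b \<in> B \<Longrightarrow> q b \<in> span C \<and> b - q b \<in> R" by blast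
  have "q ` B \<subseteq> span C" using q by auto
  from exists_nontrivial_relation[OF B(1) C(1) this]
  obtain c where c: "\<exists>b\<in>B. c b \<noteq> 0" "(\<Sum>b\<in>B. c b *\<^sub>R q b) = 0" using B(3) C(2) by auto
  define s where "s = (\<Sum>b\<in>B. \<bar>c b\<bar>)"
  have s: "s > 0" unfolding s_def using c(1) B(1) by (auto intro: sum_pos2)
  define x where "x = (\<Sum>b\<in>B. c b *\<^sub>R b)"
  have "x = (\<Sum>b\<in>B. c b *\<^sub>R (b - q b))"
    unfolding x_def using c(2) by (simp add: scaleR_diff_right sum_subtractf)
  then have "x \<in> R" using q R(2) by (simp add: subspace_sum subspace_scale)
  then obtain r' where r': "r' \<in> R'" "norm (x - r') \<le> e * norm x" using gap by blast
  have "norm x \<le> (\<Sum>b\<in>B. norm (c b *\<^sub>R b))" unfolding x_def by (rule norm_sum)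
  also have "\<dots> \<le> s" unfolding s_def using B(4) by (intro sum_mono) (simp add: mult_left_le)
  finally have "norm (x - r') \<le> e * s" using r'(2) e(1) mult_left_mono[of "norm x" s e] by linarith
  moreover have "s \<le> (3 ^ Suc n - 1) * norm (x - r')"
    using B(5)[of "- r'" c] r'(1) R'(1) unfolding s_def x_def by (simp add: subspace_neg)
  moreover have "(1::real) \<le> 3 ^ Suc n" by (rule one_le_power) simp
  then have "(3 ^ Suc n - 1) * norm (x - r') \<le> (3 ^ Suc n - 1) * (e * s)"
    using \<open>norm (x - r') \<le> e * s\<close> by (intro mult_left_mono) auto
  ultimately have "s \<le> (3 ^ Suc n - 1) * (e * s)" by (metis order_trans)
  also have "\<dots> = s * (e * 3 ^ Suc n - e)" by (simp add: algebra_simps)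
  finally have "1 \<le> e * 3 ^ Suc n - e" using s by simp
  then have "e = 0" using e by linarith
  with \<open>1 \<le> e * 3 ^ Suc n - e\<close> show False by simp
qed

section \<open>Stability of Kato operators\<close>

lemma cscale_zero_left [simp]: "cscale 0 x = 0"
  using cscale_of_real[of 0 x] by simp

lemma cscale_minus_one: "cscale (- 1) x = - x"
  using cscale_of_real[of "- 1" x] by simp

lemma cscale_minus_left: "cscale (- c) x = - cscale c x"
  using cscale_cscale[of "- 1" c x] by (simp add: cscale_minus_one)

lemma cscale_diff_left: "cscale (a - b) x = cscale a x - cscale b x"
  using cscale_add_left[of a "- b" x] by (simp add: cscale_minus_left)

lemma bounded_linear_cscale: "bounded_linear (cscale c :: 'a::complex_banach \<Rightarrow> 'a)"
proof (rule bounded_linear_intro[where K = "cmod c"])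
  fix r and x :: 'a
  show "cscale c (r *\<^sub>R x) = r *\<^sub>R cscale c x"
    by (simp only: cscale_of_real[symmetric] cscale_cscale mult.commute)
qed (simp_all add: cscale_add_right norm_cscale mult.commute)

lemmas linear_cscale = bounded_linear.linear[OF bounded_linear_cscale]

lemma cscale_zero_right [simp]: "cscale c (0 :: 'a::complex_banach) = 0"
  by (rule linear_0[OF linear_cscale])

lemma cscale_diff_right: "cscale c (x - y) = cscale c x - cscale c (y :: 'a::complex_banach)"
  by (rule linear_diff[OF linear_cscale])

lemma csubspaceI:
  assumes "0 \<in> M" "\<And>x y. x \<in> M \<Longrightarrow> y \<in> M \<Longrightarrow> x + y \<in> M" "\<And>c x. x \<in> M \<Longrightarrow> cscale c x \<in> M"
  shows "csubspace M"
  unfolding csubspace_def subspace_def using assms by (metis cscale_of_real)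

lemma csubspace_imp_subspace: "csubspace M \<Longrightarrow> subspace M"
  unfolding csubspace_def by simp

lemma csubspace_cscale: "csubspace M \<Longrightarrow> x \<in> M \<Longrightarrow> cscale c x \<in> M"
  unfolding csubspace_def by simp

lemma bop_bounded_linear: "bop S \<Longrightarrow> bounded_linear S"
  unfolding bop_def by simp

lemma bop_linear: "bop S \<Longrightarrow> linear S"
  unfolding bop_def by (simp add: bounded_linear.linear)

lemma bop_cscale: "bop S \<Longrightarrow> S (cscale c x) = cscale c (S x)"
  unfolding bop_def by simp

lemma bop_shift: "bop S \<Longrightarrow> bop (shift S l)"
  unfolding bop_def shift_def
  by (auto intro: bounded_linear_sub bounded_linear_cscale simp: cscale_diff_right cscale_cscale mult.commute)

lemma shift_shift: "shift (shift S a) b = shift S (a + b)"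
  unfolding shift_def by (auto simp: cscale_add_left algebra_simps)

lemma shift_zero: "shift S 0 = S"
  unfolding shift_def by simp

lemma bop_power: "bop S \<Longrightarrow> bop (S ^^ n)"
proof (induction n)
  case 0
  then show ?case unfolding bop_def by (simp add: id_def)
next
  case (Suc n)
  then show ?case
    unfolding bop_def by (auto simp: o_def intro: bounded_linear_compose)
qed

section \<open>Operators on closed invariant subspaces\<close>

definition op_on :: "'a::complex_banach set \<Rightarrow> ('a \<Rightarrow> 'a) \<Rightarrow> bool" where
  "op_on M S \<longleftrightarrow> bop S \<and> csubspace M \<and> closed M \<and> S ` M \<subseteq> M"

lemma op_onD:
  assumes "op_on M S"
  shows "bop S" "csubspace M" "closed M" "\<And>x. x \<in> M \<Longrightarrow> S x \<in> M" "subspace M" "linear S"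
    "bounded_linear S"
  using assms unfolding op_on_def
  by (auto simp: csubspace_imp_subspace bop_linear bop_bounded_linear)

lemma op_on_shift:
  assumes "op_on M S"
  shows "op_on M (shift S l)"
proof -
  have "shift S l x \<in> M" if "x \<in> M" for x
    unfolding shift_def using op_onD[OF assms] csubspace_cscale[OF op_onD(2)[OF assms] that] that
    by (intro subspace_diff) auto
  then show ?thesis
    using op_onD[OF assms] unfolding op_on_def by (auto simp: bop_shift)
qed

lemma op_on_power_mem: "op_on M S \<Longrightarrow> x \<in> M \<Longrightarrow> (S ^^ n) x \<in> M"
  by (induction n) (auto dest: op_onD(4))

lemma subspace_ker_on: "linear S \<Longrightarrow> subspace M \<Longrightarrow> subspace (ker_on M S)"
  unfolding ker_on_def subspace_def by (simp add: linear_add linear_scale linear_0)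

lemma subspace_image: "linear S \<Longrightarrow> subspace M \<Longrightarrow> subspace (S ` M)"
  by (rule linear_subspace_image)

text \<open>A quantitative closed range condition: for positive \<open>C\<close> it bounds the
  reduced minimum modulus of \<open>S\<close> on \<open>M\<close> below by \<open>1 / C\<close>. The
  explicit constant is what the perturbation estimates run on.\<close>

definition bounded_preimages :: "real \<Rightarrow> ('a::real_normed_vector \<Rightarrow> 'b::real_normed_vector) \<Rightarrow> 'a set \<Rightarrow> bool" where
  "bounded_preimages C S M \<longleftrightarrow> (\<forall>x\<in>M. \<exists>x'\<in>M. S x' = S x \<and> norm x' \<le> C * norm (S x))"

lemma closed_range_iff_bounded_preimages:
  assumes "op_on M S"
  shows "closed (S ` M) \<longleftrightarrow> (\<exists>C>0. bounded_preimages C S M)"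
proof
  assume "closed (S ` M)"
  from open_mapping_bound[OF op_onD(7,5,3)[OF assms] this]
  show "\<exists>C>0. bounded_preimages C S M" unfolding bounded_preimages_def by metis
next
  assume "\<exists>C>0. bounded_preimages C S M"
  then obtain C where "C > 0" "bounded_preimages C S M" by blast
  then show "closed (S ` M)"
    using closed_range_if_bound[OF op_onD(7,5,3)[OF assms], of C]
    unfolding bounded_preimages_def by auto
qed

definition nullity :: "'a::complex_banach set \<Rightarrow> ('a \<Rightarrow> 'a) \<Rightarrow> enat" where
  "nullity M S = rdim (ker_on M S) {0}"

definition defect :: "'a::complex_banach set \<Rightarrow> ('a \<Rightarrow> 'a) \<Rightarrow> enat" where
  "defect M S = rdim M (S ` M)"

definition hyperrange :: "'a set \<Rightarrow> ('a \<Rightarrow> 'a) \<Rightarrow> 'a set" where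
  "hyperrange M S = (\<Inter>n. (S ^^ n) ` M)"

lemma kato_closed_power_range:
  assumes op: "op_on M S" and ker: "\<And>n. ker_on M S \<subseteq> (S ^^ n) ` M" and C: "0 < C" "bounded_preimages C S M"
  shows "closed ((S ^^ n) ` M)"
proof (induction n)
  case 0
  then show ?case using op_onD(3)[OF op] by simp
next
  case (Suc n)
  let ?L = "(S ^^ n) ` M"
  have sL: "subspace ?L"
    using bop_linear[OF bop_power[OF op_onD(1)[OF op]]] op_onD(5)[OF op] by (rule subspace_image)
  have "closed (S ` ?L)"
  proof (rule closed_range_if_bound[OF op_onD(7)[OF op] sL Suc, of C])
    fix x assume x: "x \<in> ?L"
    then have "x \<in> M" using op_on_power_mem[OF op] by blast
    then obtain x' where x': "x' \<in> M" "S x' = S x" "norm x' \<le> C * norm (S x)"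
      using C unfolding bounded_preimages_def by blast
    have "x' - x \<in> ker_on M S"
      using x' \<open>x \<in> M\<close> op_onD(5,6)[OF op] unfolding ker_on_def by (simp add: linear_diff subspace_diff)
    then have "x' - x \<in> ?L" using ker by blast
    then have "x' \<in> ?L" using subspace_add[OF sL _ x, of "x' - x"] by simp
    then show "\<exists>x'\<in>?L. S x' = S x \<and> norm x' \<le> C * norm (S x)" using x' by blast
  qed (use C in simp)
  then show ?case by (simp add: image_comp)
qed

lemma subspace_hyperrange:
  assumes "op_on M S"
  shows "subspace (hyperrange M S)"
proof -
  have "subspace ((S ^^ n) ` M)" for n
    using bop_linear[OF bop_power[OF op_onD(1)[OF assms]]] op_onD(5)[OF assms]
    by (rule subspace_image)
  then show ?thesis unfolding hyperrange_def by (intro subspace_Inter) blast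
qed

lemma hyperrange_subset: "hyperrange M S \<subseteq> M"
proof
  fix x assume "x \<in> hyperrange M S"
  then have "x \<in> (S ^^ 0) ` M" unfolding hyperrange_def by blast
  then show "x \<in> M" by simp
qed

text \<open>Consequently bounded preimages of hyperrange vectors stay in the hyperrange, and
  \<open>S\<close> maps it onto itself with the constant \<open>C\<close>.\<close>

lemma kato_hyperrange_preimage:
  assumes op: "op_on M S" and ker: "\<And>n. ker_on M S \<subseteq> (S ^^ n) ` M" and x: "x \<in> M" "S x \<in> hyperrange M S"
  shows "x \<in> hyperrange M S"
  unfolding hyperrange_def
proof
  fix n
  have sL: "subspace ((S ^^ n) ` M)"
    using bop_linear[OF bop_power[OF op_onD(1)[OF op]]] op_onD(5)[OF op] by (rule subspace_image)
  have "S x \<in> (S ^^ Suc n) ` M" using x(2) unfolding hyperrange_def by blast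
  then obtain z where z: "z \<in> M" "S x = S ((S ^^ n) z)" by auto
  then have "x - (S ^^ n) z \<in> ker_on M S"
    using x(1) op_on_power_mem[OF op z(1)] op_onD(5,6)[OF op]
    unfolding ker_on_def by (simp add: linear_diff subspace_diff)
  then have "x - (S ^^ n) z \<in> (S ^^ n) ` M" using ker by blast
  from subspace_add[OF sL this, of "(S ^^ n) z"] show "x \<in> (S ^^ n) ` M" using z by simp
qed

text \<open>For nonzero \<open>l\<close> an eigenvector is \<open>S ^^ n\<close> of a multiple of
  itself; for \<open>l = 0\<close> this is the Kato condition. It moves all kernel estimates to the
  subspace where \<open>S\<close> is onto.\<close>

lemma eigenvector_in_hyperrange:
  assumes op: "op_on M S" and ker: "\<And>n. ker_on M S \<subseteq> (S ^^ n) ` M"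
  shows "ker_on M (shift S l) \<subseteq> hyperrange M S"
proof
  fix x assume x: "x \<in> ker_on M (shift S l)"
  then have xM: "x \<in> M" and Sx: "S x = cscale l x" unfolding ker_on_def shift_def by auto
  show "x \<in> hyperrange M S"
  proof (cases "l = 0")
    case True
    then show ?thesis using ker xM Sx unfolding hyperrange_def ker_on_def by auto
  next
    case False
    have "(S ^^ n) (cscale (1 / l ^ n) x) = x" for n
    proof -
      have "(S ^^ n) y = cscale (l ^ n) y" if "S y = cscale l y" for y
        by (induction n) (simp_all add: bop_cscale[OF op_onD(1)[OF op]] that cscale_one cscale_cscale mult.commute)
      then show ?thesis
        using False Sx bop_cscale[OF bop_power[OF op_onD(1)[OF op]], of n "1 / l ^ n" x]
        by (simp add: cscale_cscale cscale_one)
    qed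
    then show ?thesis
      unfolding hyperrange_def using csubspace_cscale[OF op_onD(2)[OF op] xM] by (metis INT_I image_eqI)
  qed
qed

text \<open>An \<open>S\<close>-preimage of norm at most \<open>C * norm y\<close> solves the
  shifted equation up to \<open>cmod l * C * norm y\<close>, at most half of \<open>norm y\<close>,
  so the residual iteration applies inside the hyperrange.\<close>

lemma kato_shift_onto_hyperrange:
  assumes op: "op_on M S" and ker: "\<And>n. ker_on M S \<subseteq> (S ^^ n) ` M"
    and C: "0 < C" "bounded_preimages C S M" and l: "cmod l * C \<le> 1 / 2" and y: "y \<in> hyperrange M S"
  shows "\<exists>x\<in>hyperrange M S. shift S l x = y \<and> norm x \<le> 2 * C * norm y"
proof -
  let ?K = "hyperrange M S"
  have cl: "closed ?K"
    unfolding hyperrange_def using kato_closed_power_range[OF op ker C] by (intro closed_INT) auto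
  have cK: "cscale c x \<in> ?K" if "x \<in> ?K" for c x
  proof -
    have "\<exists>z\<in>M. cscale c x = (S ^^ n) z" for n
    proof -
      have "x \<in> (S ^^ n) ` M" using that unfolding hyperrange_def by blast
      then obtain z where "z \<in> M" "x = (S ^^ n) z" by blast
      then show ?thesis
        using csubspace_cscale[OF op_onD(2)[OF op]] bop_cscale[OF bop_power[OF op_onD(1)[OF op]]] by metis
    qed
    then show ?thesis unfolding hyperrange_def by blast
  qed
  have SK: "S x \<in> ?K" if "x \<in> ?K" for x
    unfolding hyperrange_def
  proof
    fix n
    have "x \<in> (S ^^ n) ` M" using that unfolding hyperrange_def by blast
    then obtain z where "z \<in> M" "x = (S ^^ n) z" by blast
    then show "S x \<in> (S ^^ n) ` M"
      using op_onD(4)[OF op] by (metis (no_types) funpow_swap1 image_eqI)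
  qed
  have img: "shift S l ` ?K \<subseteq> ?K"
    unfolding shift_def using SK cK subspace_hyperrange[OF op] by (auto intro: subspace_diff)
  show ?thesis
  proof (rule approx_solvable_imp_solvable[OF bop_bounded_linear[OF bop_shift[OF op_onD(1)[OF op]]]
        subspace_hyperrange[OF op] cl subspace_hyperrange[OF op] img _ _ y])
    show "0 \<le> C" using C by simp
    fix y assume y: "y \<in> ?K"
    have "y \<in> (S ^^ Suc 0) ` M" using y unfolding hyperrange_def by blast
    then obtain z where "z \<in> M" "y = S z" by auto
    then obtain x where x: "x \<in> M" "S x = y" "norm x \<le> C * norm y"
      using C(2) unfolding bounded_preimages_def by blast
    have "x \<in> ?K" using kato_hyperrange_preimage[OF op ker x(1)] x(2) y by simp
    moreover have "norm (y - shift S l x) \<le> norm y / 2"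
    proof -
      have "norm (y - shift S l x) = cmod l * norm x" unfolding shift_def using x by (simp add: norm_cscale)
      also have "\<dots> \<le> cmod l * (C * norm y)" using x by (intro mult_left_mono) auto
      also have "\<dots> = (cmod l * C) * norm y" by simp
      also have "\<dots> \<le> (1 / 2) * norm y" using l by (intro mult_right_mono) auto
      finally show ?thesis by simp
    qed
    ultimately show "\<exists>x\<in>?K. norm x \<le> C * norm y \<and> norm (y - shift S l x) \<le> norm y / 2" using x by blast
  qed
qed

text \<open>For \<open>x\<close> in the kernel of \<open>S - l\<close>, the vector
  \<open>(S - l') x = (l - l') x\<close> is again in that kernel, hence in the hyperrange, where
  \<open>S - l'\<close> can be inverted with control. Only \<open>l'\<close> has to be small, which
  makes the estimate uniform over the disc.\<close>

lemma kato_kernel_gap: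
  assumes op: "op_on M S" and ker: "\<And>n. ker_on M S \<subseteq> (S ^^ n) ` M"
    and C: "0 < C" "bounded_preimages C S M" and l': "cmod l' * C \<le> 1 / 2"
    and x: "x \<in> ker_on M (shift S l)"
  shows "\<exists>u\<in>ker_on M (shift S l'). norm (x - u) \<le> 2 * C * cmod (l - l') * norm x"
proof -
  let ?K = "hyperrange M S"
  have xM: "x \<in> M" and Sx: "S x = cscale l x" using x unfolding ker_on_def shift_def by auto
  have eq: "shift S l' x = cscale (l - l') x" unfolding shift_def Sx by (simp add: cscale_diff_left)
  have cM: "cscale (l - l') x \<in> M" using csubspace_cscale[OF op_onD(2)[OF op] xM] .
  have "shift S l (cscale (l - l') x) = 0"
    unfolding shift_def bop_cscale[OF op_onD(1)[OF op]] Sx by (simp add: cscale_cscale mult.commute)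
  then have "cscale (l - l') x \<in> ker_on M (shift S l)" using cM unfolding ker_on_def by simp
  then have "shift S l' x \<in> ?K" unfolding eq using eigenvector_in_hyperrange[OF op ker] by blast
  from kato_shift_onto_hyperrange[OF op ker C l' this]
  obtain w where w: "w \<in> ?K" "shift S l' w = shift S l' x" "norm w \<le> 2 * C * norm (shift S l' x)" by blast
  have "linear (shift S l')" using op_onD(6)[OF op_on_shift[OF op]] .
  then have "shift S l' (x - w) = 0" using w(2) by (simp add: linear_diff)
  moreover have "x - w \<in> M" using xM subsetD[OF hyperrange_subset w(1)] op_onD(5)[OF op] by (intro subspace_diff)
  ultimately have "x - w \<in> ker_on M (shift S l')" unfolding ker_on_def by simp
  moreover have "norm (x - (x - w)) \<le> 2 * C * cmod (l - l') * norm x"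
    using w(3) unfolding eq norm_cscale by (simp add: mult.assoc)
  ultimately show ?thesis by blast
qed

text \<open>Subtracting a kernel vector of \<open>S - l\<close> replaces a preimage \<open>x\<close>
  of \<open>y\<close> by one of norm at most \<open>2 * C * norm y + norm x / 2\<close>. Iteration
  drives the norm towards the fixed point \<open>4 * C * norm y\<close>; the fifth \<open>C\<close>
  absorbs what is left after finitely many rounds.\<close>

lemma kato_shift_bounded_preimages:
  assumes op: "op_on M S" and ker: "\<And>n. ker_on M S \<subseteq> (S ^^ n) ` M"
    and C: "0 < C" "bounded_preimages C S M" and l: "cmod l * C \<le> 1 / 8"
  shows "bounded_preimages (5 * C) (shift S l) M"
  unfolding bounded_preimages_def
proof
  let ?A = "shift S l"
  have lin: "linear ?A" using op_onD(6)[OF op_on_shift[OF op]] .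
  fix x0 assume x0: "x0 \<in> M"
  define y where "y = ?A x0"
  \<comment> \<open>\<open>x\<close> is compared with a short \<open>S\<close>-preimage
    \<open>x1\<close> of \<open>S x\<close>; \<open>x - x1\<close> is in the kernel of
    \<open>S\<close>, so it is close to some \<open>u\<close> in the kernel of \<open>S - l\<close>,
    and \<open>x - u\<close> is close to \<open>x1\<close>. With \<open>cmod l * C\<close> at most
    1/8 the factor of \<open>norm x\<close> comes to 13/32.\<close>
  have step: "\<exists>x'\<in>M. ?A x' = y \<and> norm x' \<le> 2 * C * norm y + norm x / 2" if x: "x \<in> M" "?A x = y" for x
  proof -
    obtain x1 where x1: "x1 \<in> M" "S x1 = S x" "norm x1 \<le> C * norm (S x)"
      using C(2) x(1) unfolding bounded_preimages_def by blast
    have Sx: "S x = y + cscale l x" using x(2) unfolding shift_def by (simp add: algebra_simps)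
    have "norm (S x) \<le> norm y + cmod l * norm x"
      unfolding Sx using norm_triangle_ineq[of y "cscale l x"] by (simp add: norm_cscale)
    then have "C * norm (S x) \<le> C * (norm y + cmod l * norm x)" using C(1) by (intro mult_left_mono) auto
    then have n1: "norm x1 \<le> C * norm y + (cmod l * C) * norm x" using x1(3) by (simp add: algebra_simps)
    have "x - x1 \<in> ker_on M (shift S 0)"
      unfolding shift_zero ker_on_def
      using x(1) x1 op_onD(5,6)[OF op] by (simp add: linear_diff subspace_diff)
    from kato_kernel_gap[OF op ker C _ this, of l] l
    obtain u where u: "u \<in> ker_on M ?A" "norm (x - x1 - u) \<le> 2 * C * cmod l * norm (x - x1)" by auto
    have "x - u \<in> M" using x(1) u(1) op_onD(5)[OF op] unfolding ker_on_def by (simp add: subspace_diff)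
    moreover have "?A (x - u) = y" using u(1) x(2) lin unfolding ker_on_def by (simp add: linear_diff)
    moreover have "norm (x - u) \<le> 2 * C * norm y + norm x / 2"
    proof -
      have a: "norm (x - u) \<le> norm x1 + norm (x - x1 - u)"
        using norm_triangle_ineq[of x1 "x - x1 - u"] by simp
      have "norm (x - x1 - u) \<le> (cmod l * C) * (2 * norm (x - x1))" using u(2) by (simp add: algebra_simps)
      also have "\<dots> \<le> (1 / 8) * (2 * norm (x - x1))" using l by (intro mult_right_mono) auto
      finally have b: "norm (x - x1 - u) \<le> norm (x - x1) / 4" by simp
      have c: "norm (x - x1) \<le> norm x + norm x1" by (rule norm_triangle_ineq4)
      have d: "(cmod l * C) * norm x \<le> (1 / 8) * norm x" using l by (intro mult_right_mono) auto
      have "0 \<le> C * norm y" using C by simp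
      then show ?thesis using a b c d n1 norm_ge_zero[of x] by linarith
    qed
    ultimately show ?thesis by blast
  qed
  have iter: "\<exists>x'\<in>M. ?A x' = y \<and> norm x' \<le> 4 * C * norm y + norm x0 / 2 ^ n" for n
  proof (induction n)
    case 0
    have "0 \<le> 4 * C * norm y" using C by simp
    then show ?case using x0 y_def by (intro bexI[of _ x0]) auto
  next
    case (Suc n)
    then obtain x' where x': "x' \<in> M" "?A x' = y" "norm x' \<le> 4 * C * norm y + norm x0 / 2 ^ n" by blast
    obtain x'' where x'': "x'' \<in> M" "?A x'' = y" "norm x'' \<le> 2 * C * norm y + norm x' / 2"
      using step[OF x'(1,2)] by blast
    have "norm x'' \<le> 2 * C * norm y + (4 * C * norm y + norm x0 / 2 ^ n) / 2" 
      by (rule order_trans[OF x''(3) add_left_mono[OF divide_right_mono[OF x'(3)]]]) simp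
    also have "\<dots> = 4 * C * norm y + norm x0 / 2 ^ Suc n" by (simp add: field_simps)
    finally have "norm x'' \<le> 4 * C * norm y + norm x0 / 2 ^ Suc n" .
    then show ?case using x'' by blast
  qed
  show "\<exists>x'\<in>M. ?A x' = ?A x0 \<and> norm x' \<le> 5 * C * norm (?A x0)"
  \<comment> \<open>For \<open>y = 0\<close> the leftover \<open>norm x0 / 2 ^ n\<close> need not
    drop below \<open>C * norm y\<close>; the preimage 0 is taken instead.\<close>
  proof (cases "y = 0")
    case True
    then show ?thesis
      using subspace_0[OF op_onD(5)[OF op]] linear_0[OF lin] unfolding y_def[symmetric]
      by (intro bexI[of _ 0]) auto
  next
    case False
    have "(\<lambda>n. norm x0 * (1/2) ^ n) \<longlonglongrightarrow> 0" by (intro tendsto_mult_right_zero LIMSEQ_power_zero) simp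
    moreover have "C * norm y > 0" using C False by simp
    ultimately have "\<forall>\<^sub>F n in sequentially. norm x0 * (1/2) ^ n < C * norm y" by (rule order_tendstoD)
    then obtain n where "norm x0 * (1/2) ^ n < C * norm y" by (meson eventually_happens' sequentially_bot)
    then have n: "norm x0 / 2 ^ n < C * norm y" by (simp add: power_one_over)
    obtain x' where "x' \<in> M" "?A x' = y" "norm x' \<le> 4 * C * norm y + norm x0 / 2 ^ n" using iter by blast
    then show ?thesis using n unfolding y_def[symmetric] by (intro bexI[of _ x']) auto
  qed
qed

text \<open>The segment from 0 to \<open>l\<close> is walked in steps of length at most
  \<open>d\<close>, using the implication in both directions. Since \<open>d\<close> is unrelated to
  \<open>e\<close>, it may depend on the property \<open>P\<close>.\<close>

lemma constant_on_ball_if_uniformly_locally_constant: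
  fixes P :: "complex \<Rightarrow> bool"
  assumes d: "d > 0"
    and P: "\<And>a b. cmod a < e \<Longrightarrow> cmod b < e \<Longrightarrow> cmod (a - b) \<le> d \<Longrightarrow> P a \<Longrightarrow> P b"
    and l: "cmod l < e"
  shows "P l \<longleftrightarrow> P 0"
proof -
  obtain m :: nat where "cmod l / d < real m" using reals_Archimedean2 by blast
  then have m: "m > 0" "cmod l \<le> d * real m"
    using d norm_ge_zero[of l] by (auto simp: field_simps intro: gr0I)
  define s where "s k = (of_nat k / of_nat m) * l" for k
  have s: "cmod (s k) < e" if "k \<le> m" for k
  proof -
    have "cmod (s k) = (real k / real m) * cmod l" unfolding s_def by (simp add: norm_mult norm_divide)
    also have "\<dots> \<le> 1 * cmod l" using that m by (intro mult_right_mono) auto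
    finally show ?thesis using l by simp
  qed
  have st: "cmod (s (Suc k) - s k) \<le> d" "cmod (s k - s (Suc k)) \<le> d" for k
  proof -
    have "s (Suc k) - s k = l / of_nat m" unfolding s_def using m by (simp add: field_simps)
    then have "cmod (s (Suc k) - s k) = cmod l / real m" by (simp add: norm_divide)
    also have "\<dots> \<le> d" using m by (simp add: field_simps)
    finally show "cmod (s (Suc k) - s k) \<le> d" .
    then show "cmod (s k - s (Suc k)) \<le> d" by (simp add: norm_minus_commute)
  qed
  have "P (s k) \<longleftrightarrow> P 0" if "k \<le> m" for k
    using that
  proof (induction k)
    case (Suc k)
    then have "P (s k) \<longleftrightarrow> P 0" by simp
    moreover have "P (s k) \<longleftrightarrow> P (s (Suc k))"
      using P[OF s s st(1)] P[OF s s st(2)] Suc(2) by (metis Suc_leD)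
    ultimately show ?case by simp
  qed (simp add: s_def)
  from this[of m] show ?thesis unfolding s_def using m by simp
qed

text \<open>For each \<open>n\<close> separately, the gap lemmas transport "at most
  \<open>n\<close>" along the disc: kernels move at rate \<open>2 * C\<close>, ranges at rate
  \<open>5 * C\<close>. Agreement for all \<open>n\<close> is equality in
  \<open>enat\<close>.\<close>

theorem kato_stability:
  assumes op: "op_on M S" and kato: "kato_on M S"
  obtains e where "e > 0" "\<And>l. cmod l < e \<Longrightarrow> kato_on M (shift S l)"
    "\<And>l. cmod l < e \<Longrightarrow> nullity M (shift S l) = nullity M S"
    "\<And>l. cmod l < e \<Longrightarrow> defect M (shift S l) = defect M S"
proof -
  have ker: "ker_on M S \<subseteq> (S ^^ n) ` M" for n using kato unfolding kato_on_def by blast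
  have "closed (S ` M)" using kato unfolding kato_on_def by blast
  then obtain C where C: "0 < C" "bounded_preimages C S M"
    using closed_range_iff_bounded_preimages[OF op] by blast
  define e where "e = 1 / (8 * C)"
  have e: "e > 0" unfolding e_def using C by simp
  have small: "cmod l * C \<le> 1 / 8" "cmod l * C \<le> 1 / 2" if "cmod l < e" for l
  proof -
    have "cmod l * C \<le> e * C" using that C by (intro mult_right_mono) auto
    then show "cmod l * C \<le> 1 / 8" "cmod l * C \<le> 1 / 2" unfolding e_def using C by auto
  qed
  have bd: "bounded_preimages (5 * C) (shift S l) M" if "cmod l < e" for l
    using kato_shift_bounded_preimages[OF op ker C small(1)[OF that]] .
  have cl: "closed (shift S l ` M)" if "cmod l < e" for l
    using closed_range_iff_bounded_preimages[OF op_on_shift[OF op]] bd[OF that] C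
    by (metis mult_pos_pos zero_less_numeral)
  have 1: "kato_on M (shift S l)" if l: "cmod l < e" for l
  proof -
    \<comment> \<open>\<open>S - l\<close> covers the hyperrange of \<open>S\<close> from within, so
      all its powers do; the kernel of \<open>S - l\<close> lies in that hyperrange, which gives the
      Kato condition.\<close>
    have "hyperrange M S \<subseteq> (shift S l ^^ n) ` M" for n
    proof -
      have "hyperrange M S \<subseteq> (shift S l ^^ n) ` hyperrange M S"
      proof (induction n)
        case (Suc n)
        have "hyperrange M S \<subseteq> shift S l ` hyperrange M S"
          using kato_shift_onto_hyperrange[OF op ker C small(2)[OF l]] by blast
        also have "\<dots> \<subseteq> shift S l ` (shift S l ^^ n) ` hyperrange M S" using Suc by blast
        finally show ?case by (simp add: image_comp)
      qed simp
      then show ?thesis using hyperrange_subset by (metis image_mono order_trans)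
    qed
    then show ?thesis
      unfolding kato_on_def using cl[OF l] eigenvector_in_hyperrange[OF op ker, of l] by blast
  qed
  have 2: "nullity M (shift S l) = nullity M S" if l: "cmod l < e" for l
    unfolding nullity_def
  proof (rule rdim_eqI)
    fix n
    \<comment> \<open>Makes the kernel gap \<open>2 * C * d\<close> just small enough for dimension
      \<open>n\<close>; the defect case below has 5 in place of 2.\<close>
    define d where "d = 1 / (2 * C * 3 ^ Suc n)"
    have d: "d > 0" unfolding d_def using C by simp
    have "rel_le (ker_on M (shift S l)) {0} n \<longleftrightarrow> rel_le (ker_on M (shift S 0)) {0} n"
    proof (rule constant_on_ball_if_uniformly_locally_constant[OF d _ l])
      fix a b assume a: "cmod a < e" and b: "cmod b < e" and ab: "cmod (a - b) \<le> d"
        and r: "rel_le (ker_on M (shift S a)) {0} n"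
      show "rel_le (ker_on M (shift S b)) {0} n"
      proof (rule gap_rel_le_zero[OF r, where e = "2 * C * d"])
        show "subspace (ker_on M (shift S b))"
          using op_onD(5,6)[OF op_on_shift[OF op]] by (intro subspace_ker_on)
        show "0 \<le> 2 * C * d" "2 * C * d * 3 ^ Suc n \<le> 1" using C d unfolding d_def by auto
        fix v assume v: "v \<in> ker_on M (shift S b)"
        obtain u where u: "u \<in> ker_on M (shift S a)" "norm (v - u) \<le> 2 * C * cmod (b - a) * norm v"
          using kato_kernel_gap[OF op ker C small(2)[OF a] v] by blast
        have "2 * C * cmod (b - a) * norm v \<le> 2 * C * d * norm v"
          using ab C by (intro mult_right_mono mult_left_mono) (auto simp: norm_minus_commute)
        then show "\<exists>u\<in>ker_on M (shift S a). norm (v - u) \<le> 2 * C * d * norm v" using u by force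
      qed
    qed
    then show "rel_le (ker_on M (shift S l)) {0} n \<longleftrightarrow> rel_le (ker_on M S) {0} n"
      by (simp add: shift_zero)
  qed
  have 3: "defect M (shift S l) = defect M S" if l: "cmod l < e" for l
    unfolding defect_def
  proof (rule rdim_eqI)
    fix n
    define d where "d = 1 / (5 * C * 3 ^ Suc n)"
    have d: "d > 0" unfolding d_def using C by simp
    have "rel_le M (shift S l ` M) n \<longleftrightarrow> rel_le M (shift S 0 ` M) n"
    proof (rule constant_on_ball_if_uniformly_locally_constant[OF d _ l])
      fix a b assume a: "cmod a < e" and b: "cmod b < e" and ab: "cmod (a - b) \<le> d"
        and r: "rel_le M (shift S a ` M) n"
      have sub: "subspace (shift S c ` M)" for c
        using op_onD(5,6)[OF op_on_shift[OF op]] by (intro subspace_image)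
      show "rel_le M (shift S b ` M) n"
      proof (rule gap_rel_le_codim[OF r sub sub cl[OF b] _ op_onD(5)[OF op], where e = "5 * C * d"])
        show "shift S b ` M \<subseteq> M" using op_onD(4)[OF op_on_shift[OF op]] by blast
        show "0 \<le> 5 * C * d" "5 * C * d * 3 ^ Suc n \<le> 1" using C d unfolding d_def by auto
        fix v assume "v \<in> shift S a ` M"
        then obtain x where x: "x \<in> M" "v = shift S a x" "norm x \<le> 5 * C * norm v"
          using bd[OF a] unfolding bounded_preimages_def by (metis imageE)
        have "v - shift S b x = cscale (b - a) x" unfolding x(2) shift_def by (simp add: cscale_diff_left)
        then have "norm (v - shift S b x) = cmod (b - a) * norm x" by (simp add: norm_cscale)
        also have "\<dots> \<le> d * (5 * C * norm v)"
          using ab x(3) d by (intro mult_mono) (auto simp: norm_minus_commute)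
        finally have "norm (v - shift S b x) \<le> 5 * C * d * norm v" by (simp add: mult_ac)
        then show "\<exists>r'\<in>shift S b ` M. norm (v - r') \<le> 5 * C * d * norm v" using x by blast
      qed
    qed
    then show "rel_le M (shift S l ` M) n \<longleftrightarrow> rel_le M (S ` M) n" by (simp add: shift_zero)
  qed
  show thesis using that[OF e 1 2 3] .
qed

section \<open>Direct sums of operators\<close>

text \<open>Stated inside a carrier \<open>L\<close> and not in the whole space, since summands
  obtained earlier are split again.\<close>

definition reduces :: "'a::complex_banach set \<Rightarrow> 'a set \<Rightarrow> 'a set \<Rightarrow> ('a \<Rightarrow> 'a) \<Rightarrow> bool" where
  "reduces L M N S \<longleftrightarrow> op_on L S \<and> op_on M S \<and> op_on N S \<and> M \<inter> N \<subseteq> {0}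
     \<and> L = sumset M N"

lemma reducesD:
  assumes "reduces L M N S"
  shows "op_on L S" "op_on M S" "op_on N S" "M \<inter> N \<subseteq> {0}" "L = sumset M N"
    "M \<subseteq> L" "N \<subseteq> L" "\<And>x. x \<in> L \<Longrightarrow> \<exists>m\<in>M. \<exists>n\<in>N. x = m + n"
proof -
  show "op_on L S" "op_on M S" "op_on N S" "M \<inter> N \<subseteq> {0}" and L: "L = sumset M N"
    using assms unfolding reduces_def by blast+
  have z: "0 \<in> M" "0 \<in> N"
    using assms unfolding reduces_def by (auto dest: op_onD(5) subspace_0)
  show "M \<subseteq> L" unfolding L
  proof
    fix x assume "x \<in> M"
    then show "x \<in> sumset M N"
      using z by (intro CollectI exI[of _ x] exI[of _ 0]) simp
  qed
  show "N \<subseteq> L" unfolding L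
  proof
    fix x assume "x \<in> N"
    then show "x \<in> sumset M N"
      using z by (intro CollectI exI[of _ 0] exI[of _ x]) simp
  qed
  show "\<And>x. x \<in> L \<Longrightarrow> \<exists>m\<in>M. \<exists>n\<in>N. x = m + n" unfolding L by blast
qed

lemma reduces_unique:
  assumes "reduces L M N S" "a \<in> M" "c \<in> M" "b \<in> N" "d \<in> N" "a + b = c + d"
  shows "a = c" "b = d"
proof -
  have "a - c = d - b" using assms(6) by (simp add: algebra_simps)
  moreover have "a - c \<in> M" "d - b \<in> N"
    using assms reducesD(2,3)[OF assms(1)] by (auto intro!: subspace_diff dest: op_onD(5))
  ultimately have "a - c = 0" "d - b = 0" using reducesD(4)[OF assms(1)] by auto
  then show "a = c" "b = d" by simp_all
qed

lemma reducesI: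
  assumes "op_on L S" "op_on M S" "op_on N S" "M \<inter> N \<subseteq> {0}" "L = sumset M N"
  shows "reduces L M N S"
  unfolding reduces_def by (intro conjI assms)

lemma reduces_commute:
  assumes "reduces L M N S"
  shows "reduces L N M S"
proof (rule reducesI[OF reducesD(1,3,2)[OF assms]])
  show "N \<inter> M \<subseteq> {0}" using reducesD(4)[OF assms] by (simp only: Int_commute)
  show "L = sumset N M"
    by (rule trans[OF reducesD(5)[OF assms] sums_commute])
qed

lemma reduces_shift: "reduces L M N S \<Longrightarrow> reduces L M N (shift S l)"
  by (intro reducesI op_on_shift; rule reducesD)

lemma op_on_power: "op_on M S \<Longrightarrow> op_on M (S ^^ n)"
  using op_on_power_mem[of M S] unfolding op_on_def by (auto simp: bop_power)

lemma reduces_power: "reduces L M N S \<Longrightarrow> reduces L M N (S ^^ n)"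
  by (intro reducesI op_on_power; rule reducesD)

lemma reduces_ker:
  assumes r: "reduces L M N S"
  shows "ker_on L S = sumset (ker_on M S) (ker_on N S)"
proof
  note op = op_onD[OF reducesD(2)[OF r]] and op' = op_onD[OF reducesD(3)[OF r]]
  show "ker_on L S \<subseteq> sumset (ker_on M S) (ker_on N S)"
  proof
    fix x assume "x \<in> ker_on L S"
    then have "x \<in> L" "S x = 0" unfolding ker_on_def by auto
    then obtain m n where mn: "m \<in> M" "n \<in> N" "x = m + n" using reducesD(8)[OF r] by blast
    have "S m + S n = 0 + 0" using \<open>S x = 0\<close> mn(3) op(6) by (simp add: linear_add)
    then have "S m = 0" "S n = 0"
      using reduces_unique[OF r op(4)[OF mn(1)] subspace_0[OF op(5)] op'(4)[OF mn(2)] subspace_0[OF op'(5)]]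
      by auto
    then show "x \<in> sumset (ker_on M S) (ker_on N S)"
      using mn unfolding ker_on_def by blast
  qed
  show "sumset (ker_on M S) (ker_on N S) \<subseteq> ker_on L S"
  proof
    fix x assume "x \<in> sumset (ker_on M S) (ker_on N S)"
    then obtain a b where x: "x = a + b" "a \<in> M" "b \<in> N" "S a = 0" "S b = 0"
      unfolding ker_on_def by blast
    then have "x \<in> L" using reducesD(5)[OF r] by blast
    then show "x \<in> ker_on L S" using x op(6) unfolding ker_on_def by (simp add: linear_add)
  qed
qed

lemma reduces_image:
  assumes r: "reduces L M N S"
  shows "S ` L = sumset (S ` M) (S ` N)"
proof
  note lin = op_onD(6)[OF reducesD(1)[OF r]]
  show "S ` L \<subseteq> sumset (S ` M) (S ` N)"
  proof
    fix y assume "y \<in> S ` L"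
    then obtain x where "x \<in> L" "y = S x" by blast
    moreover from this obtain m n where "m \<in> M" "n \<in> N" "x = m + n" using reducesD(8)[OF r] by blast
    ultimately show "y \<in> sumset (S ` M) (S ` N)" using lin by (auto simp: linear_add)
  qed
  show "sumset (S ` M) (S ` N) \<subseteq> S ` L"
  proof
    fix y assume "y \<in> sumset (S ` M) (S ` N)"
    then obtain m n where "m \<in> M" "n \<in> N" "y = S m + S n" by blast
    then have "y = S (m + n)" "m + n \<in> L" using lin reducesD(5)[OF r] by (auto simp: linear_add)
    then show "y \<in> S ` L" by blast
  qed
qed

lemma reduces_nullity:
  assumes r: "reduces L M N S"
  shows "nullity L S = nullity M S + nullity N S"
proof -
  have 1: "{0} = sumset {0} {0::'a}" by auto
  show ?thesis
    unfolding nullity_def reduces_ker[OF r]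
  proof (subst 1, rule rdim_direct_sum)
    show "subspace (ker_on M S)" "subspace (ker_on N S)"
      using op_onD(5,6)[OF reducesD(2)[OF r]] op_onD(5,6)[OF reducesD(3)[OF r]]
      by (simp_all add: subspace_ker_on)
    then show "{0} \<subseteq> ker_on M S" "{0} \<subseteq> ker_on N S" by (simp_all add: subspace_0)
    show "ker_on M S \<inter> ker_on N S \<subseteq> {0}" using reducesD(4)[OF r] unfolding ker_on_def by blast
  qed simp_all
qed

lemma reduces_defect:
  assumes r: "reduces L M N S"
  shows "defect L S = defect M S + defect N S"
proof -
  note op = op_onD[OF reducesD(2)[OF r]] and op' = op_onD[OF reducesD(3)[OF r]]
  have "rdim (sumset M N) (sumset (S ` M) (S ` N))
    = rdim M (S ` M) + rdim N (S ` N)"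
    by (rule rdim_direct_sum)
      (use op op' reducesD(4)[OF r] in \<open>auto simp: subspace_image\<close>)
  then show ?thesis
    unfolding defect_def reduces_image[OF r] using reducesD(5)[OF r] by simp
qed

lemma reduces_ker_restrict: "reduces L M N S \<Longrightarrow> ker_on M S = ker_on L S \<inter> M"
  using reducesD(6)[of L M N S] unfolding ker_on_def by auto

lemma reduces_image_restrict:
  assumes r: "reduces L M N S"
  shows "S ` M = S ` L \<inter> M"
proof
  note op = op_onD[OF reducesD(2)[OF r]] and op' = op_onD[OF reducesD(3)[OF r]]
  show "S ` M \<subseteq> S ` L \<inter> M" using reducesD(6)[OF r] op(4) by auto
  show "S ` L \<inter> M \<subseteq> S ` M"
  proof
    fix y assume y: "y \<in> S ` L \<inter> M"
    then obtain m n where mn: "m \<in> M" "n \<in> N" "y = S m + S n"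
      unfolding reduces_image[OF r] by blast
    have "S m + S n = y + 0" using mn by simp
    from reduces_unique(1)[OF r op(4)[OF mn(1)] _ op'(4)[OF mn(2)] subspace_0[OF op'(5)] this] y
    show "y \<in> S ` M" using mn(1) by blast
  qed
qed

text \<open>One direction is \<open>S\<close> M = S \<open>L \<inter> M\<close>. For the other,
  bounded preimages in the summands are added, and the projection bound \<open>D\<close> converts
  the norms of the components into that of the sum.\<close>

lemma reduces_closed_image_iff:
  assumes r: "reduces L M N S"
  shows "closed (S ` L) \<longleftrightarrow> closed (S ` M) \<and> closed (S ` N)"
proof
  assume "closed (S ` L)"
  then show "closed (S ` M) \<and> closed (S ` N)"
    using reduces_image_restrict[OF r] reduces_image_restrict[OF reduces_commute[OF r]]
      op_onD(3)[OF reducesD(2)[OF r]] op_onD(3)[OF reducesD(3)[OF r]]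
    by (simp add: closed_Int)
next
  note op = op_onD[OF reducesD(2)[OF r]] and op' = op_onD[OF reducesD(3)[OF r]]
  assume a: "closed (S ` M) \<and> closed (S ` N)"
  obtain C where C: "C > 0" "bounded_preimages C S M"
    using a closed_range_iff_bounded_preimages[OF reducesD(2)[OF r]] by blast
  obtain C' where C': "C' > 0" "bounded_preimages C' S N"
    using a closed_range_iff_bounded_preimages[OF reducesD(3)[OF r]] by blast
  have "closed (sumset M N)"
    using op_onD(3)[OF reducesD(1)[OF r]] reducesD(5)[OF r] by simp
  from direct_sum_projection_bound[OF op(5,3) op'(5,3) reducesD(4)[OF r] this]
  obtain D where D: "D > 0" "\<And>m n. m \<in> M \<Longrightarrow> n \<in> N \<Longrightarrow> norm m \<le> D * norm (m + n) \<and> norm n \<le> D * norm (m + n)"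
    by metis
  have "bounded_preimages ((C + C') * D) S L"
    unfolding bounded_preimages_def
  proof
    fix x assume "x \<in> L"
    then obtain m n where mn: "m \<in> M" "n \<in> N" "x = m + n" using reducesD(8)[OF r] by blast
    obtain m' where m': "m' \<in> M" "S m' = S m" "norm m' \<le> C * norm (S m)"
      using C(2) mn(1) unfolding bounded_preimages_def by blast
    obtain n' where n': "n' \<in> N" "S n' = S n" "norm n' \<le> C' * norm (S n)"
      using C'(2) mn(2) unfolding bounded_preimages_def by blast
    have Sx: "S x = S m + S n" using mn op(6) by (simp add: linear_add)
    have b: "norm (S m) \<le> D * norm (S x)" "norm (S n) \<le> D * norm (S x)"
      using D(2)[OF op(4)[OF mn(1)] op'(4)[OF mn(2)]] unfolding Sx by auto
    have "norm (m' + n') \<le> C * norm (S m) + C' * norm (S n)"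
      using norm_triangle_ineq[of m' n'] m'(3) n'(3) by linarith
    also have "\<dots> \<le> C * (D * norm (S x)) + C' * (D * norm (S x))"
      using b C(1) C'(1) by (intro add_mono mult_left_mono) auto
    also have "\<dots> = (C + C') * D * norm (S x)" by (simp add: algebra_simps)
    finally have "norm (m' + n') \<le> (C + C') * D * norm (S x)" .
    moreover have "m' + n' \<in> L" using m' n' reducesD(5)[OF r] by blast
    moreover have "S (m' + n') = S x" using m' n' op(6) Sx by (simp add: linear_add)
    ultimately show "\<exists>x'\<in>L. S x' = S x \<and> norm x' \<le> (C + C') * D * norm (S x)" by blast
  qed
  moreover have "(C + C') * D > 0" using C C' D by simp
  ultimately show "closed (S ` L)"
    using closed_range_iff_bounded_preimages[OF reducesD(1)[OF r]] by blast
qed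

lemma ker_power_stable:
  assumes "S ` M \<subseteq> M" "ker_on M (S ^^ n) = ker_on M (S ^^ Suc n)" "n \<le> m"
  shows "ker_on M (S ^^ m) = ker_on M (S ^^ Suc m)"
  using assms(3)
proof (induction m rule: dec_induct)
  case (step m)
  have "x \<in> ker_on M (S ^^ Suc m) \<longleftrightarrow> x \<in> ker_on M (S ^^ Suc (Suc m))" if x: "x \<in> M" for x
  proof -
    have "S x \<in> M" using x assms(1) by blast
    then have "(S ^^ m) (S x) = 0 \<longleftrightarrow> (S ^^ Suc m) (S x) = 0"
      using step(3) unfolding ker_on_def by blast
    then show ?thesis using x unfolding ker_on_def by (simp add: funpow_swap1)
  qed
  then show ?case unfolding ker_on_def by blast
qed (rule assms(2))

lemma image_power_stable:
  fixes S :: "'a \<Rightarrow> 'a"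
  assumes "(S ^^ n) ` M = (S ^^ Suc n) ` M" "n \<le> m"
  shows "(S ^^ m) ` M = (S ^^ Suc m) ` M"
  using assms(2)
proof (induction m rule: dec_induct)
  case (step m)
  have eq: "(S ^^ Suc k) ` M = S ` (S ^^ k) ` M" for k by (simp add: image_comp)
  show ?case by (rule trans[OF eq trans[OF arg_cong[OF step(3), of "image S"] eq[symmetric]]])
qed (rule assms(1))

lemma reduces_finite_ascent_iff:
  assumes r: "reduces L M N S"
  shows "finite_ascent_on L S \<longleftrightarrow> finite_ascent_on M S \<and> finite_ascent_on N S"
proof
  assume "finite_ascent_on L S"
  then obtain n where n: "ker_on L (S ^^ n) = ker_on L (S ^^ Suc n)" unfolding finite_ascent_on_def by blast
  have "ker_on M (S ^^ n) = ker_on M (S ^^ Suc n)"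
    unfolding reduces_ker_restrict[OF reduces_power[OF r]] n ..
  moreover have "ker_on N (S ^^ n) = ker_on N (S ^^ Suc n)"
    unfolding reduces_ker_restrict[OF reduces_commute[OF reduces_power[OF r]]] n ..
  ultimately show "finite_ascent_on M S \<and> finite_ascent_on N S" unfolding finite_ascent_on_def by blast
next
  assume "finite_ascent_on M S \<and> finite_ascent_on N S"
  then obtain m n where mn: "ker_on M (S ^^ m) = ker_on M (S ^^ Suc m)" "ker_on N (S ^^ n) = ker_on N (S ^^ Suc n)"
    unfolding finite_ascent_on_def by blast
  have inv: "S ` M \<subseteq> M" "S ` N \<subseteq> N" using reducesD(2,3)[OF r] unfolding op_on_def by auto
  have "ker_on M (S ^^ max m n) = ker_on M (S ^^ Suc (max m n))"
    "ker_on N (S ^^ max m n) = ker_on N (S ^^ Suc (max m n))"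
    by (rule ker_power_stable[OF inv(1) mn(1)], simp) (rule ker_power_stable[OF inv(2) mn(2)], simp)
  then have "ker_on L (S ^^ max m n) = ker_on L (S ^^ Suc (max m n))"
    unfolding reduces_ker[OF reduces_power[OF r]] by simp
  then show "finite_ascent_on L S" unfolding finite_ascent_on_def by blast
qed

lemma reduces_finite_descent_iff:
  assumes r: "reduces L M N S"
  shows "finite_descent_on L S \<longleftrightarrow> finite_descent_on M S \<and> finite_descent_on N S"
proof
  assume "finite_descent_on L S"
  then obtain n where n: "(S ^^ n) ` L = (S ^^ Suc n) ` L" unfolding finite_descent_on_def by blast
  have "(S ^^ n) ` M = (S ^^ Suc n) ` M"
    unfolding reduces_image_restrict[OF reduces_power[OF r]] n ..
  moreover have "(S ^^ n) ` N = (S ^^ Suc n) ` N"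
    unfolding reduces_image_restrict[OF reduces_commute[OF reduces_power[OF r]]] n ..
  ultimately show "finite_descent_on M S \<and> finite_descent_on N S" unfolding finite_descent_on_def by blast
next
  assume "finite_descent_on M S \<and> finite_descent_on N S"
  then obtain m n where mn: "(S ^^ m) ` M = (S ^^ Suc m) ` M" "(S ^^ n) ` N = (S ^^ Suc n) ` N"
    unfolding finite_descent_on_def by blast
  have "(S ^^ max m n) ` M = (S ^^ Suc (max m n)) ` M" "(S ^^ max m n) ` N = (S ^^ Suc (max m n)) ` N"
    by (rule image_power_stable[OF mn(1)], simp) (rule image_power_stable[OF mn(2)], simp)
  then have "(S ^^ max m n) ` L = (S ^^ Suc (max m n)) ` L"
    unfolding reduces_image[OF reduces_power[OF r]] by simp
  then show "finite_descent_on L S" unfolding finite_descent_on_def by blast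
qed

lemma csubspace_sums:
  assumes "csubspace M" "csubspace N"
  shows "csubspace (sumset M N)"
proof -
  have "cscale c x \<in> sumset M N" if "x \<in> sumset M N" for c x
  proof -
    from that obtain m n where "x = m + n" "m \<in> M" "n \<in> N" by blast
    then have "cscale c x = cscale c m + cscale c n" "cscale c m \<in> M" "cscale c n \<in> N"
      using assms by (simp_all add: cscale_add_right csubspace_cscale)
    then show ?thesis by blast
  qed
  then show ?thesis
    using assms unfolding csubspace_def by (auto intro!: subspace_sums)
qed

text \<open>Regroups \<open>(M' + F) + N\<close> as \<open>M' + (F + N)\<close>. Finite dimension of
  \<open>F\<close> ensures that \<open>F + N\<close> is closed.\<close>

lemma reduces_assoc:
  assumes r: "reduces L M N S" and r': "reduces M M' F S" and F: "fdim F"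
  defines "N' \<equiv> sumset F N"
  shows "reduces L M' N' S" "reduces N' F N S"
proof -
  note opF = reducesD(3)[OF r'] and opN = reducesD(3)[OF r] and opM' = reducesD(2)[OF r']
  have "N' = sumset N F" unfolding N'_def by (rule sums_commute)
  then have "closed N'"
    using closed_sum_fdim[OF op_onD(5,3)[OF opN] op_onD(5)[OF opF] F] by simp
  moreover have "csubspace N'"
    unfolding N'_def using op_onD(2)[OF opF] op_onD(2)[OF opN] by (rule csubspace_sums)
  moreover have "S ` N' \<subseteq> N'"
  proof
    fix y assume "y \<in> S ` N'"
    then obtain f n where "f \<in> F" "n \<in> N" "y = S (f + n)" unfolding N'_def by blast
    then have "y = S f + S n" "S f \<in> F" "S n \<in> N"
      using op_onD(4,6)[OF opF] op_onD(4)[OF opN] by (simp_all add: linear_add)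
    then show "y \<in> N'" unfolding N'_def by blast
  qed
  ultimately have opN': "op_on N' S" using op_onD(1)[OF opF] unfolding op_on_def by blast
  have "F \<inter> N \<subseteq> {0}" using reducesD(7)[OF r'] reducesD(4)[OF r] by blast
  then show "reduces N' F N S" by (rule reducesI[OF opN' opF opN]) (simp only: N'_def)
  have "M' \<inter> N' \<subseteq> {0}"
  proof
    fix x assume x: "x \<in> M' \<inter> N'"
    then obtain f n where fn: "f \<in> F" "n \<in> N" "x = f + n" unfolding N'_def by blast
    have "x \<in> M" "f \<in> M" using x fn reducesD(6,7)[OF r'] by blast+
    have "x + 0 = f + n" using fn by simp
    from reduces_unique[OF r \<open>x \<in> M\<close> \<open>f \<in> M\<close> subspace_0[OF op_onD(5)[OF opN]] fn(2) this]
    have "x = f" by simp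
    then show "x \<in> {0}" using x fn reducesD(4)[OF r'] by blast
  qed
  moreover have "L = sumset M' N'"
  proof
    show "L \<subseteq> sumset M' N'"
    proof
      fix x assume "x \<in> L"
      then obtain m n where mn: "m \<in> M" "n \<in> N" "x = m + n" using reducesD(8)[OF r] by blast
      then obtain m' f where "m' \<in> M'" "f \<in> F" "m = m' + f" using reducesD(8)[OF r'] by blast
      then have "x = m' + (f + n)" "m' \<in> M'" "f + n \<in> N'" using mn unfolding N'_def by (auto simp: add.assoc)
      then show "x \<in> sumset M' N'" by blast
    qed
    show "sumset M' N' \<subseteq> L"
    proof
      fix x assume "x \<in> sumset M' N'"
      then obtain m f n where "x = m + (f + n)" "m \<in> M'" "f \<in> F" "n \<in> N" unfolding N'_def by blast
      then have "x = (m + f) + n" "m + f \<in> M" "n \<in> N" using reducesD(5)[OF r'] by (auto simp: add.assoc)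
      then show "x \<in> L" using reducesD(5)[OF r] by blast
    qed
  qed
  ultimately show "reduces L M' N' S" by (rule reducesI[OF reducesD(1)[OF r] opM' opN'])
qed

section \<open>Separating functionals\<close>

text \<open>Geometric Hahn-Banach: \<open>H\<close> is a maximal subspace among those containing
  \<open>W\<close> and missing a ball around \<open>x\<close>. If some line in direction
  \<open>x\<close> missed \<open>H\<close>, it would be split by two disjoint open cones, against
  connectedness.\<close>

lemma closed_hyperplane_exists:
  fixes W :: "'a::real_normed_vector set"
  assumes W: "subspace W" "closed W" and x: "x \<notin> W"
  obtains H where "subspace H" "closed H" "W \<subseteq> H" "x \<notin> H" "\<And>y. \<exists>t. y - t *\<^sub>R x \<in> H"
proof -
  obtain d where d: "d > 0" "ball x d \<inter> W = {}"
  proof -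
    have "open (- W)" "x \<in> - W" using W x by auto
    then obtain d where "d > 0" "ball x d \<subseteq> - W" unfolding open_contains_ball by blast
    then show thesis using that[of d] by blast
  qed
  define A where "A = {H. subspace H \<and> W \<subseteq> H \<and> ball x d \<inter> H = {}}"
  have "\<exists>H\<in>A. \<forall>X\<in>A. H \<subseteq> X \<longrightarrow> X = H"
  proof (rule subset_Zorn_nonempty)
    show "A \<noteq> {}" using W d unfolding A_def by blast
    fix c assume c: "c \<noteq> {}" "subset.chain A c"
    have "subspace (\<Union>c)"
      unfolding subspace_def
    proof (intro conjI ballI allI)
      have sub: "subspace H" if "H \<in> c" for H using that c(2) unfolding subset.chain_def A_def by blast
      show "0 \<in> \<Union>c" using c(1) sub subspace_0 by blast
      show "r *\<^sub>R u \<in> \<Union>c" if "u \<in> \<Union>c" for r u using that sub subspace_scale by blast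
      show "u + v \<in> \<Union>c" if uv: "u \<in> \<Union>c" "v \<in> \<Union>c" for u v
      proof -
        obtain H H' where H: "H \<in> c" "H' \<in> c" "u \<in> H" "v \<in> H'" using uv by blast
        then have "H \<subseteq> H' \<or> H' \<subseteq> H" using c(2) unfolding subset.chain_def by blast
        then show ?thesis using H sub[OF H(1)] sub[OF H(2)] subspace_add by blast
      qed
    qed
    moreover have "W \<subseteq> \<Union>c" "ball x d \<inter> \<Union>c = {}" using c unfolding subset.chain_def A_def by blast+
    ultimately show "\<Union>c \<in> A" unfolding A_def by blast
  qed
  then obtain H where "H \<in> A" and max: "\<And>X. X \<in> A \<Longrightarrow> H \<subseteq> X \<Longrightarrow> X = H" by blast
  then have H: "subspace H" "W \<subseteq> H" "ball x d \<inter> H = {}" unfolding A_def by auto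
  \<comment> \<open>The ball is open, so the closure of \<open>H\<close> still misses it, and
    maximality makes \<open>H\<close> closed.\<close>
  have "ball x d \<inter> closure H = {}" using H(3) open_Int_closure_eq_empty[OF open_ball] by blast
  then have "closure H \<in> A"
    unfolding A_def using closure_subspace[OF H(1)] H(2) closure_subset[of H] by blast
  then have "closure H = H" by (rule max) (rule closure_subset)
  then have cl: "closed H" by (metis closed_closure)
  \<comment> \<open>The open cone of all positive multiples of ball points, translated by
    \<open>H\<close>: one side of the hyperplane, with \<open>- P\<close> the other.\<close>
  define P where "P = (\<Union>h\<in>H. \<Union>t\<in>{0<..}. (\<lambda>b. h + t *\<^sub>R b) ` ball x d)"
  have PI: "h + t *\<^sub>R b \<in> P" if "h \<in> H" "t > 0" "b \<in> ball x d" for h t b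
    using that unfolding P_def by blast
  have PE: "\<exists>h t b. y = h + t *\<^sub>R b \<and> h \<in> H \<and> t > 0 \<and> b \<in> ball x d" if "y \<in> P" for y
    using that unfolding P_def by blast
  have "open P"
    unfolding P_def
  proof (intro open_UN ballI)
    fix h and t :: real assume "t \<in> {0<..}"
    then have "open ((\<lambda>b. t *\<^sub>R b) ` ball x d)" by (intro open_scaling) auto
    then have "open ((\<lambda>b. h + b) ` (\<lambda>b. t *\<^sub>R b) ` ball x d)" by (rule open_translation)
    then show "open ((\<lambda>b. h + t *\<^sub>R b) ` ball x d)" by (simp add: image_image)
  qed
  \<comment> \<open>A point of both cones would, by adding the two representations, place a convex
    combination of ball points in \<open>H\<close>.\<close>
  have disj: "\<not> (y \<in> P \<and> - y \<in> P)" for y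
  proof
    assume "y \<in> P \<and> - y \<in> P"
    then obtain h t b h' t' b' where y: "y = h + t *\<^sub>R b" "h \<in> H" "t > 0" "b \<in> ball x d"
      "- y = h' + t' *\<^sub>R b'" "h' \<in> H" "t' > 0" "b' \<in> ball x d"
      using PE by metis
    let ?b = "(t / (t + t')) *\<^sub>R b + (t' / (t + t')) *\<^sub>R b'"
    have "?b \<in> ball x d"
      using y by (intro convexD[OF convex_ball]) (auto simp: add_divide_distrib[symmetric])
    moreover have "t *\<^sub>R b + t' *\<^sub>R b' = - (h + h')"
    proof -
      have "(h + t *\<^sub>R b) + (h' + t' *\<^sub>R b') = 0" using y(1,5) by (metis add.right_inverse)
      then show ?thesis by (simp add: algebra_simps eq_neg_iff_add_eq_0)
    qed
    then have "?b = (1 / (t + t')) *\<^sub>R (- (h + h'))"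
      by (metis (no_types, lifting) add_divide_distrib divide_inverse inverse_eq_divide mult.commute
          scaleR_add_right scaleR_scaleR)
    moreover have "(1 / (t + t')) *\<^sub>R (- (h + h')) \<in> H"
      using y H(1) by (intro subspace_scale subspace_neg subspace_add)
    ultimately show False using H(3) by auto
  qed
  \<comment> \<open>By maximality, adjoining \<open>y\<close> outside \<open>H\<close> must hit the
    ball; the sign of the coefficient of \<open>y\<close> decides in which cone \<open>y\<close>
    lies.\<close>
  have cover: "y \<in> H \<or> y \<in> P \<or> - y \<in> P" for y
  proof (rule ccontr)
    assume no: "\<not> ?thesis"
    let ?X = "span (insert y H)"
    have "ball x d \<inter> ?X = {}"
    proof (rule ccontr)
      assume "ball x d \<inter> ?X \<noteq> {}"
      then obtain b where b: "b \<in> ball x d" "b \<in> ?X" by blast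
      have "span H = H" using H(1) by (rule span_eq_iff[THEN iffD2])
      moreover have "\<exists>k. b - k *\<^sub>R y \<in> span H" using b(2) by (simp only: span_insert mem_Collect_eq)
      ultimately obtain k where k: "b - k *\<^sub>R y \<in> H" by metis
      consider "k = 0" | "k > 0" | "k < 0" by linarith
      then show False
      proof cases
        case 1
        then show False using k b H(3) by auto
      next
        case 2
        have "- (1 / k) *\<^sub>R (b - k *\<^sub>R y) + (1 / k) *\<^sub>R b \<in> P"
          using 2 by (intro PI[OF subspace_scale[OF H(1) k] _ b(1)]) simp
        then show False using no 2 by (simp add: scaleR_diff_right)
      next
        case 3
        have "(1 / k) *\<^sub>R (b - k *\<^sub>R y) + (- (1 / k)) *\<^sub>R b \<in> P"
          using 3 by (intro PI[OF subspace_scale[OF H(1) k] _ b(1)]) simp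
        then show False using no 3 by (simp add: scaleR_diff_right)
      qed
    qed
    moreover have "H \<subseteq> ?X" by (auto intro: span_base)
    ultimately have "?X \<in> A" unfolding A_def using H(2) by auto
    from max[OF this \<open>H \<subseteq> ?X\<close>] have "y \<in> H" using span_base[of y "insert y H"] by auto
    then show False using no by blast
  qed
  have PH: "y \<notin> H" if "y \<in> P" for y
  proof
    assume "y \<in> H"
    from PE[OF that] obtain h t b where y: "y = h + t *\<^sub>R b" "h \<in> H" "t > 0" "b \<in> ball x d" by blast
    then have "b = (1 / t) *\<^sub>R (y - h)" by simp
    moreover have "(1 / t) *\<^sub>R (y - h) \<in> H" using H(1) \<open>y \<in> H\<close> y(2) by (intro subspace_scale subspace_diff)
    ultimately show False using y(4) H(3) by auto
  qed
  have "\<exists>t. y - t *\<^sub>R x \<in> H" for y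
  proof (rule ccontr)
    assume no: "\<not> ?thesis"
    define g where "g s = y - s *\<^sub>R x" for s :: real
    have cg: "continuous_on UNIV g" unfolding g_def by (intro continuous_intros)
    have o1: "open {s. g s \<in> P}" using open_vimage[OF \<open>open P\<close> cg] by (simp add: vimage_def)
    have o2: "open {s. - g s \<in> P}"
      using open_vimage[OF \<open>open P\<close> continuous_on_minus[OF cg]] by (simp add: vimage_def)
    have "norm y / d + 1 > 0" using d by (intro add_nonneg_pos) auto
    \<comment> \<open>Large enough for \<open>x\<close> plus or minus \<open>y / s\<close> to stay
      in the ball, so the line meets \<open>- P\<close> at parameter \<open>s\<close> and
      \<open>P\<close> at \<open>- s\<close>.\<close>
    define s where "s = norm y / d + 1"
    have s: "s > 0" "norm ((1 / s) *\<^sub>R y) < d"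
    proof -
      show "s > 0" unfolding s_def by fact
      have "norm y < s * d" unfolding s_def using d by (simp add: field_simps)
      then show "norm ((1 / s) *\<^sub>R y) < d" using \<open>s > 0\<close> by (simp add: field_simps)
    qed
    have "0 + s *\<^sub>R (x - (1 / s) *\<^sub>R y) \<in> P"
      using s subspace_0[OF H(1)] by (intro PI) (auto simp: dist_norm)
    then have g1: "- g s \<in> P" unfolding g_def using s by (simp add: scaleR_diff_right)
    have "0 + s *\<^sub>R (x + (1 / s) *\<^sub>R y) \<in> P"
      using s subspace_0[OF H(1)] by (intro PI) (auto simp: dist_norm)
    then have g2: "g (- s) \<in> P" unfolding g_def using s by (simp add: scaleR_add_right add.commute)
    have "{s. g s \<in> P} \<inter> {s. - g s \<in> P} \<inter> (UNIV::real set) = {}" using disj by blast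
    moreover have "(UNIV::real set) \<subseteq> {s. g s \<in> P} \<union> {s. - g s \<in> P}"
      using no cover unfolding g_def by blast
    ultimately show False
      using connectedD[OF connected_UNIV o1 o2] g1 g2 by blast
  qed
  moreover have "x \<in> ball x d" using d(1) by simp
  then have "x \<notin> H" using H(3) by blast
  ultimately show thesis using that[OF H(1) cl H(2)] by blast
qed

text \<open>The coordinate \<open>f\<close> along \<open>x\<close> modulo a real hyperplane is a
  bounded real functional; \<open>f y - \<i> * f (\<i> y)\<close> is its complexification
  \<open>h\<close>. It vanishes on \<open>W\<close> because \<open>W\<close> is complex, and
  \<open>h x\<close> has real part 1, so dividing by it is legitimate.\<close>

lemma complex_separating_functional:
  fixes W :: "'a::complex_banach set"
  assumes W: "csubspace W" "closed W" and x: "x \<notin> W"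
  obtains g :: "'a \<Rightarrow> complex" where "\<And>y z. g (y + z) = g y + g z" "\<And>c y. g (cscale c y) = c * g y"
    "continuous_on UNIV g" "\<And>w. w \<in> W \<Longrightarrow> g w = 0" "g x = 1"
proof -
  obtain H where H: "subspace H" "closed H" "W \<subseteq> H" "x \<notin> H" "\<And>y. \<exists>t. y - t *\<^sub>R x \<in> H"
    using closed_hyperplane_exists[OF csubspace_imp_subspace[OF W(1)] W(2) x] by metis
  have uniq: "s = t" if "y - s *\<^sub>R x \<in> H" "y - t *\<^sub>R x \<in> H" for y s t
  proof (rule ccontr)
    assume "s \<noteq> t"
    have "(y - t *\<^sub>R x) - (y - s *\<^sub>R x) \<in> H" by (rule subspace_diff[OF H(1) that(2,1)])
    then have "(s - t) *\<^sub>R x \<in> H" by (simp add: algebra_simps)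
    from subspace_scale[OF H(1) this, of "1 / (s - t)"] show False using H(4) \<open>s \<noteq> t\<close> by simp
  qed
  obtain f where f: "\<And>y. y - f y *\<^sub>R x \<in> H" using H(5) by metis
  have f_eq: "f y = t" if "y - t *\<^sub>R x \<in> H" for y t using uniq[OF f that] .
  have f_add: "f (y + z) = f y + f z" for y z
    using subspace_add[OF H(1) f[of y] f[of z]] by (intro f_eq) (simp add: algebra_simps)
  have f_scale: "f (r *\<^sub>R y) = r * f y" for r y
    using subspace_scale[OF H(1) f[of y], of r] by (intro f_eq) (simp add: algebra_simps)
  have fx: "f x = 1" using subspace_0[OF H(1)] by (intro f_eq) simp
  have fW: "f w = 0" if "w \<in> W" for w using that H(3) by (intro f_eq) auto
  define d where "d = infdist x H"
  have d: "d > 0" unfolding d_def using infdist_pos_not_in_closed[OF H(2) _ H(4)] subspace_0[OF H(1)] by blast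
  have bl: "bounded_linear f"
  proof (rule bounded_linear_intro[where K = "1 / d"])
    fix y
    have "\<bar>f y\<bar> * d \<le> norm (f y *\<^sub>R x + (y - f y *\<^sub>R x))"
      unfolding d_def by (rule infdist_scale_le[OF H(1) f])
    then show "norm (f y) \<le> norm y * (1 / d)" using d by (simp add: field_simps)
  qed (simp_all add: f_add f_scale)
  define h where "h y = Complex (f y) (- f (cscale \<i> y))" for y
  have h_add: "h (y + z) = h y + h z" for y z
    unfolding h_def by (simp add: f_add cscale_add_right complex_eq_iff)
  have f_minus: "f (- y) = - f y" for y using f_scale[of "- 1" y] by simp
  have h_scale: "h (cscale c y) = c * h y" for c y
  proof -
    have c: "c = complex_of_real (Re c) + complex_of_real (Im c) * \<i>" by (simp add: complex_eq_iff)
    have 1: "cscale c y = Re c *\<^sub>R y + Im c *\<^sub>R cscale \<i> y"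
      by (subst c) (simp only: cscale_add_left cscale_cscale[symmetric] cscale_of_real)
    have ii: "cscale \<i> (cscale \<i> y) = - y" by (simp add: cscale_cscale cscale_minus_one)
    have 2: "cscale \<i> (cscale c y) = Re c *\<^sub>R cscale \<i> y + Im c *\<^sub>R (- y)"
      unfolding 1 cscale_add_right linear_scale[OF linear_cscale] ii ..
    show ?thesis
      unfolding h_def 2 unfolding 1
      by (simp only: f_add f_scale f_minus) (simp add: complex_eq_iff)
  qed
  have hc: "continuous_on UNIV h"
  proof -
    have "h = (\<lambda>y. complex_of_real (f y) + \<i> * complex_of_real (- f (cscale \<i> y)))"
      unfolding h_def by (auto simp: complex_eq_iff)
    moreover have "continuous_on UNIV (\<lambda>y. f (cscale \<i> y))"
      by (intro linear_continuous_on bounded_linear_compose[OF bl bounded_linear_cscale])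
    moreover have "continuous_on UNIV f" by (intro linear_continuous_on bl)
    ultimately show ?thesis by (simp only:) (intro continuous_intros)
  qed
  have hW: "h w = 0" if "w \<in> W" for w
    unfolding h_def using fW that csubspace_cscale[OF W(1) that] by (simp add: complex_eq_iff)
  have hx: "h x \<noteq> 0" unfolding h_def using fx by (simp add: complex_eq_iff)
  show thesis
  proof (rule that[of "\<lambda>y. h y / h x"])
    show "h (y + z) / h x = h y / h x + h z / h x" for y z by (simp add: h_add add_divide_distrib)
    show "h (cscale c y) / h x = c * (h y / h x)" for c y by (simp add: h_scale)
    show "continuous_on UNIV (\<lambda>y. h y / h x)" using hc hx by (intro continuous_intros) auto
    show "h w / h x = 0" if "w \<in> W" for w using hW[OF that] by simp
    show "h x / h x = 1" using hx by simp
  qed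
qed

section \<open>Kato decomposition of semi-Fredholm operators\<close>

lemma op_on_restrict:
  "op_on M S \<Longrightarrow> csubspace L \<Longrightarrow> closed L \<Longrightarrow> S ` L \<subseteq> L \<Longrightarrow> op_on L S"
  unfolding op_on_def by simp

section \<open>Closed ranges of semi-Fredholm operators and their powers\<close>

lemma lower_semi_fredholm_iff:
  assumes "op_on M S"
  shows "lower_semi_fredholm_on M S \<longleftrightarrow> defect M S < \<infinity>"
  unfolding lower_semi_fredholm_on_def defect_def
  using op_onD(4,5,6)[OF assms] by (intro fin_codim_iff subspace_image) auto

lemma upper_semi_fredholm_iff:
  "upper_semi_fredholm_on M S \<longleftrightarrow> nullity M S < \<infinity> \<and> closed (S ` M)"
  unfolding upper_semi_fredholm_on_def nullity_def fdim_iff_rdim ..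

lemma defect_finite_closed_range:
  assumes op: "op_on M S" and d: "defect M S < \<infinity>"
  shows "closed (S ` M)"
proof -
  obtain F where F: "is_compl M (S ` M) F"
    using d lower_semi_fredholm_iff[OF op] unfolding lower_semi_fredholm_on_def fin_codim_def by blast
  have "S ` M \<subseteq> M" using op_onD(4)[OF op] by blast
  then show ?thesis
    using closed_range_finite_codim[OF op_onD(7,5,3)[OF op] op_onD(3)[OF op] _ op_onD(5)[OF op] F]
      closed_fdim[OF is_complD(1,3)[OF F]] by blast
qed

text \<open>Adding the finite-dimensional kernel to \<open>L\<close> keeps it closed and does not
  change the image, while bounded preimages taken in \<open>M\<close> now automatically lie in the
  enlarged subspace.\<close>

lemma closed_image_of_closed_subspace:
  assumes op: "op_on M S" and u: "nullity M S < \<infinity>" "closed (S ` M)"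
    and L: "subspace L" "closed L" "L \<subseteq> M"
  shows "closed (S ` L)"
proof -
  note lin = op_onD(6)[OF op]
  have sK: "subspace (ker_on M S)" using lin op_onD(5)[OF op] by (rule subspace_ker_on)
  have fK: "fdim (ker_on M S)" using u(1) unfolding nullity_def fdim_iff_rdim .
  define L' where "L' = sumset L (ker_on M S)"
  have L': "subspace L'" "closed L'"
    unfolding L'_def using subspace_sums[OF L(1) sK] closed_sum_fdim[OF L(1,2) sK fK] by auto
  have L'M: "L' \<subseteq> M"
    unfolding L'_def using L(3) op_onD(5)[OF op] by (auto simp: ker_on_def intro!: subspace_add)
  obtain C where C: "C > 0" "bounded_preimages C S M"
    using u(2) closed_range_iff_bounded_preimages[OF op] by blast
  have "closed (S ` L')"
  proof (rule closed_range_if_bound[OF op_onD(7)[OF op] L', of C])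
    fix x assume x: "x \<in> L'"
    then have "x \<in> M" using L'M by blast
    then obtain x' where x': "x' \<in> M" "S x' = S x" "norm x' \<le> C * norm (S x)"
      using C(2) unfolding bounded_preimages_def by blast
    have k: "x' - x \<in> ker_on M S"
      using x' \<open>x \<in> M\<close> lin op_onD(5)[OF op] unfolding ker_on_def by (simp add: linear_diff subspace_diff)
    have "0 + (x' - x) \<in> L'"
      unfolding L'_def using k subspace_0[OF L(1)] by blast
    then have "x' \<in> L'" using subspace_add[OF L'(1) _ x, of "x' - x"] by simp
    then show "\<exists>x'\<in>L'. S x' = S x \<and> norm x' \<le> C * norm (S x)" using x' by blast
  qed (use C in simp)
  moreover have "S ` L' = S ` L"
  proof
    show "S ` L' \<subseteq> S ` L"
    proof
      fix y assume "y \<in> S ` L'"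
      then obtain l k where "l \<in> L" "k \<in> ker_on M S" "y = S (l + k)" unfolding L'_def by blast
      then have "y = S l" using lin unfolding ker_on_def by (simp add: linear_add)
      then show "y \<in> S ` L" using \<open>l \<in> L\<close> by blast
    qed
    show "S ` L \<subseteq> S ` L'"
    proof
      fix y assume "y \<in> S ` L"
      then obtain l where l: "l \<in> L" "y = S (l + 0)" by auto
      have "l + 0 \<in> L'" unfolding L'_def using l(1) subspace_0[OF sK] by blast
      then show "y \<in> S ` L'" using l by blast
    qed
  qed
  ultimately show ?thesis by simp
qed

lemma defect_power_finite:
  assumes op: "op_on M S" and d: "defect M S < \<infinity>"
  shows "defect M (S ^^ n) < \<infinity>"
proof -
  note lin = op_onD(6)[OF op]
  obtain C where C: "finite C" "M \<subseteq> span (S ` M \<union> C)"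
    using d unfolding defect_def rdim_finite_iff rel_le_def by blast
  have "\<exists>D. finite D \<and> M \<subseteq> span ((S ^^ n) ` M \<union> D)"
  proof (induction n)
    case 0
    show ?case by (intro exI[of _ "{}"]) (auto intro: span_base)
  next
    case (Suc n)
    then obtain D where D: "finite D" "M \<subseteq> span ((S ^^ n) ` M \<union> D)" by blast
    let ?E = "(S ^^ Suc n) ` M \<union> (S ` D \<union> C)"
    have "S ` M \<subseteq> S ` span ((S ^^ n) ` M \<union> D)" using D(2) by (rule image_mono)
    also have "\<dots> = span (S ` ((S ^^ n) ` M \<union> D))" by (rule linear_span_image[OF lin, symmetric])
    also have "\<dots> = span ((S ^^ Suc n) ` M \<union> S ` D)" by (simp add: image_Un image_comp)
    also have "\<dots> \<subseteq> span ?E" by (rule span_mono) blast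
    finally have "S ` M \<union> C \<subseteq> span ?E" using span_superset[of ?E] by blast
    then have "span (S ` M \<union> C) \<subseteq> span ?E" by (rule span_minimal) simp
    then have "M \<subseteq> span ?E" using C(2) by blast
    moreover have "finite (S ` D \<union> C)" using C(1) D(1) by simp
    ultimately show ?case by blast
  qed
  then show ?thesis unfolding defect_def rdim_finite_iff rel_le_def by blast
qed

lemma semi_fredholm_closed_power_range:
  assumes op: "op_on M S" and s: "(nullity M S < \<infinity> \<and> closed (S ` M)) \<or> defect M S < \<infinity>"
  shows "closed ((S ^^ n) ` M)"
  using s
proof
  assume "defect M S < \<infinity>"
  then show ?thesis
    using defect_finite_closed_range[OF op_on_power[OF op] defect_power_finite[OF op]] by blast
next
  assume u: "nullity M S < \<infinity> \<and> closed (S ` M)"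
  show ?thesis
  proof (induction n)
    case 0
    then show ?case using op_onD(3)[OF op] by simp
  next
    case (Suc n)
    have "closed (S ` (S ^^ n) ` M)"
    proof (rule closed_image_of_closed_subspace[OF op])
      show "subspace ((S ^^ n) ` M)"
        using op_onD(5,6)[OF op_on_power[OF op]] by (intro subspace_image)
      show "(S ^^ n) ` M \<subseteq> M" using op_on_power_mem[OF op] by blast
    qed (use u Suc in auto)
    then show ?case by (simp add: image_comp)
  qed
qed

lemma bop_power_zero: "bop S \<Longrightarrow> (S ^^ n) 0 = 0"
  using bop_linear[OF bop_power] by (rule linear_0)

text \<open>Splits off one Jordan block: \<open>N\<close> is spanned by a chain \<open>S\<^sup>i v\<close> that prevents \<open>S\<close> from being
  Kato, and the complement is cut out by a functional vanishing on the range of \<open>S\<^sup>n\<close>.\<close>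
lemma split_nilpotent_chain:
  assumes op: "op_on M S" and clp: "\<And>n. closed ((S ^^ n) ` M)" and nk: "\<not> kato_on M S"
  shows "\<exists>Y N. reduces M Y N S \<and> fdim N \<and> nilpotent_on N S \<and> ker_on Y S \<subset> ker_on M S \<and> S ` N \<noteq> N"
proof -
  note bop = op_onD(1)[OF op] and lin = op_onD(6)[OF op] and cM = op_onD(2)[OF op]
  have linp: "linear (S ^^ n)" for n using op_onD(6)[OF op_on_power[OF op]] .
  have "closed (S ` M)" using clp[of 1] by simp
  then have "\<exists>n. \<not> ker_on M S \<subseteq> (S ^^ n) ` M" using nk unfolding kato_on_def by blast
  \<comment> \<open>With the least such \<open>n\<close>, a kernel vector \<open>u\<close> outside
    the range of \<open>S ^^ n\<close> still lies in the range of \<open>S ^^ (n - 1)\<close>; so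
    \<open>u\<close> is the last vector of a chain of length \<open>n\<close> starting at some
    \<open>v\<close>.\<close>
  then obtain n where n: "\<not> ker_on M S \<subseteq> (S ^^ n) ` M" "\<And>k. k < n \<Longrightarrow> ker_on M S \<subseteq> (S ^^ k) ` M"
    using exists_least_iff[of "\<lambda>n. \<not> ker_on M S \<subseteq> (S ^^ n) ` M"] by auto
  have n0: "n > 0"
  proof (rule ccontr)
    assume "\<not> n > 0"
    then show False using n(1) unfolding ker_on_def by auto
  qed
  obtain u where u: "u \<in> ker_on M S" "u \<notin> (S ^^ n) ` M" using n(1) by blast
  then obtain v where v: "v \<in> M" "u = (S ^^ (n - 1)) v" using n(2)[of "n - 1"] n0 by auto
  have Snv: "(S ^^ k) v = 0" if "k \<ge> n" for k
  proof -
    have "(S ^^ n) v = S ((S ^^ (n - 1)) v)" using n0 by (metis Suc_diff_1 comp_apply funpow.simps(2))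
    also have "\<dots> = 0" using u(1) unfolding v(2) ker_on_def by simp
    finally have "(S ^^ n) v = 0" .
    moreover have "(S ^^ k) v = (S ^^ (k - n)) ((S ^^ n) v)" using that by (simp flip: funpow_add comp_apply[of "S ^^ (k - n)"])
    ultimately show ?thesis by (simp add: bop_power_zero[OF bop])
  qed
  have "csubspace ((S ^^ n) ` M)"
  proof (rule csubspaceI)
    have s: "subspace ((S ^^ n) ` M)" using linp op_onD(5)[OF op] by (rule subspace_image)
    show "0 \<in> (S ^^ n) ` M" "\<And>x y. x \<in> (S ^^ n) ` M \<Longrightarrow> y \<in> (S ^^ n) ` M \<Longrightarrow> x + y \<in> (S ^^ n) ` M"
      using subspace_0[OF s] subspace_add[OF s] by blast+
    fix c x assume "x \<in> (S ^^ n) ` M"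
    then obtain z where "z \<in> M" "x = (S ^^ n) z" by blast
    then have "cscale c x = (S ^^ n) (cscale c z)" "cscale c z \<in> M"
      using bop_cscale[OF bop_power[OF bop]] csubspace_cscale[OF cM] by metis+
    then show "cscale c x \<in> (S ^^ n) ` M" by blast
  qed
  from complex_separating_functional[OF this clp u(2)]
  obtain g :: "'a \<Rightarrow> complex" where g: "\<And>y z. g (y + z) = g y + g z" "\<And>c y. g (cscale c y) = c * g y"
    "continuous_on UNIV g" "\<And>w. w \<in> (S ^^ n) ` M \<Longrightarrow> g w = 0" "g u = 1"
    by metis
  have g0: "g 0 = 0" using g(2)[of 0 0] by simp
  have gsum: "g (\<Sum>j\<in>J. f j) = (\<Sum>j\<in>J. g (f j))" if "finite J" for J :: "nat set" and f
    using that by (induction J rule: finite_induct) (simp_all add: g0 g(1))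
  have gd: "g (y - z) = g y - g z" for y z using g(1)[of "y - z" z] by (simp add: algebra_simps)
  \<comment> \<open>The common zeros of \<open>g\<close>, \<open>g \<circ> S\<close>, up to
    \<open>g \<circ> S ^^ (n - 1)\<close>. \<open>S\<close> shifts these conditions by one, and the
    condition falling off the end holds because \<open>g\<close> kills the range of
    \<open>S ^^ n\<close>.\<close>
  define Y where "Y = {x \<in> M. \<forall>i<n. g ((S ^^ i) x) = 0}"
  define comb where "comb c = (\<Sum>j<n. cscale (c j) ((S ^^ j) v))" for c
  define N where "N = range comb"
  have Sj: "(S ^^ i) (comb c) = (\<Sum>j<n. cscale (c j) ((S ^^ (i + j)) v))" for i c
    unfolding comb_def by (simp add: linear_sum[OF linp] bop_cscale[OF bop_power[OF bop]] funpow_add)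
  have NM: "N \<subseteq> M"
    unfolding N_def comb_def using v(1)
    by (auto intro!: subspace_sum op_onD(5)[OF op] csubspace_cscale[OF cM] op_on_power_mem[OF op])
  have cN: "csubspace N"
  proof (rule csubspaceI)
    have "comb (\<lambda>_. 0) = 0" unfolding comb_def by simp
    then show "0 \<in> N" unfolding N_def by (metis rangeI)
    show "x + y \<in> N" if "x \<in> N" "y \<in> N" for x y
    proof -
      from that obtain c d where "x = comb c" "y = comb d" unfolding N_def by blast
      then have "x + y = comb (\<lambda>j. c j + d j)"
        unfolding comb_def by (simp add: cscale_add_left sum.distrib)
      then show ?thesis unfolding N_def by blast
    qed
    show "cscale a x \<in> N" if "x \<in> N" for a x
    proof -
      from that obtain c where "x = comb c" unfolding N_def by blast
      then have "cscale a x = comb (\<lambda>j. a * c j)"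
        unfolding comb_def by (simp add: linear_sum[OF linear_cscale] cscale_cscale)
      then show ?thesis unfolding N_def by blast
    qed
  qed
  have SvN: "(S ^^ k) v \<in> N" for k
  proof (cases "k < n")
    case True
    have "comb (\<lambda>j. if j = k then 1 else 0) = (\<Sum>j<n. if j = k then (S ^^ j) v else 0)"
      unfolding comb_def by (intro sum.cong) (auto simp: cscale_one)
    also have "\<dots> = (S ^^ k) v" using True by simp
    finally show ?thesis unfolding N_def by (metis rangeI)
  next
    case False
    then show ?thesis using Snv subspace_0[OF csubspace_imp_subspace[OF cN]] by simp
  qed
  have SN: "S ` N \<subseteq> N"
  proof
    fix y assume "y \<in> S ` N"
    then obtain c where "y = (S ^^ 1) (comb c)" unfolding N_def by auto
    then have "y = (\<Sum>j<n. cscale (c j) ((S ^^ (1 + j)) v))" unfolding Sj .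
    then show "y \<in> N"
      using SvN by (auto intro!: subspace_sum csubspace_imp_subspace[OF cN] csubspace_cscale[OF cN] simp del: funpow.simps)
  qed
  have fN: "fdim N"
  proof -
    \<comment> \<open>\<open>fdim\<close> refers to real spans, so each chain vector enters together
      with its multiple by the imaginary unit.\<close>
    let ?B = "(\<lambda>j. (S ^^ j) v) ` {..<n} \<union> (\<lambda>j. cscale \<i> ((S ^^ j) v)) ` {..<n}"
    have "comb c \<in> span ?B" for c
      unfolding comb_def
    proof (rule span_sum)
      fix j assume j: "j \<in> {..<n}"
      have c: "c j = complex_of_real (Re (c j)) + complex_of_real (Im (c j)) * \<i>" by (simp add: complex_eq_iff)
      have "cscale (c j) ((S ^^ j) v) = Re (c j) *\<^sub>R (S ^^ j) v + Im (c j) *\<^sub>R cscale \<i> ((S ^^ j) v)"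
        by (subst c) (simp only: cscale_add_left cscale_cscale[symmetric] cscale_of_real)
      also have "\<dots> \<in> span ?B" using j by (intro span_add span_scale; intro span_base) auto
      finally show "cscale (c j) ((S ^^ j) v) \<in> span ?B" .
    qed
    then have "N \<subseteq> span ?B" unfolding N_def by blast
    moreover have "finite ?B" by simp
    ultimately show ?thesis unfolding fdim_def by blast
  qed
  have nilN: "(S ^^ n) x = 0" if "x \<in> N" for x
  proof -
    from that obtain c where "x = comb c" unfolding N_def by blast
    then have "(S ^^ n) x = (\<Sum>j<n. cscale (c j) ((S ^^ (n + j)) v))" by (simp only: Sj)
    also have "\<dots> = 0" by (intro sum.neutral) (simp add: Snv)
    finally show ?thesis .
  qed
  have opN: "op_on N S"
    using op_on_restrict[OF op cN closed_fdim[OF csubspace_imp_subspace[OF cN] fN] SN] .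
  have cY: "csubspace Y"
  proof (rule csubspaceI)
    show "0 \<in> Y" unfolding Y_def using subspace_0[OF op_onD(5)[OF op]] by (simp add: bop_power_zero[OF bop] g0)
    show "x + y \<in> Y" if "x \<in> Y" "y \<in> Y" for x y
      using that op_onD(5)[OF op] unfolding Y_def by (simp add: subspace_add linear_add[OF linp] g(1))
    show "cscale c x \<in> Y" if "x \<in> Y" for c x
      using that csubspace_cscale[OF cM] unfolding Y_def by (simp add: bop_cscale[OF bop_power[OF bop]] g(2))
  qed
  have "closed Y"
  proof -
    have "closed {x. g ((S ^^ i) x) = 0}" for i
    proof -
      have "continuous_on UNIV (\<lambda>x. g ((S ^^ i) x))"
        using op_onD(7)[OF op_on_power[OF op]]
        by (intro continuous_on_compose2[OF g(3)] linear_continuous_on) auto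
      then show ?thesis by (intro closed_Collect_eq continuous_on_const)
    qed
    then have "closed (M \<inter> (\<Inter>i\<in>{..<n}. {x. g ((S ^^ i) x) = 0}))"
      using op_onD(3)[OF op] by (intro closed_Int closed_INT) auto
    moreover have "Y = M \<inter> (\<Inter>i\<in>{..<n}. {x. g ((S ^^ i) x) = 0})" unfolding Y_def by auto
    ultimately show ?thesis by simp
  qed
  have "S ` Y \<subseteq> Y"
  proof
    fix y assume "y \<in> S ` Y"
    then obtain x where x: "x \<in> Y" "y = S x" by blast
    have "g ((S ^^ i) (S x)) = 0" if "i < n" for i
    proof (cases "Suc i = n")
      case True
      then have "(S ^^ i) (S x) \<in> (S ^^ n) ` M"
        using x(1) unfolding Y_def by (auto simp: funpow_swap1)
      then show ?thesis by (rule g(4))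
    next
      case False
      then have "Suc i < n" using that by simp
      then have "g ((S ^^ Suc i) x) = 0" using x(1) unfolding Y_def by blast
      then show ?thesis by (simp add: funpow_swap1)
    qed
    then show "y \<in> Y" using x op_onD(4)[OF op] unfolding Y_def by simp
  qed
  with op_on_restrict[OF op cY \<open>closed Y\<close>] have opY: "op_on Y S" by blast
  \<comment> \<open>The pairing of the functionals \<open>g \<circ> S ^^ i\<close> with the chain
    vectors \<open>(S ^^ j) v\<close> is 1 for \<open>i + j = n - 1\<close> and 0 beyond: a
    triangular matrix. Its invertibility gives both the trivial intersection and the
    decomposition.\<close>
  have gSv: "g ((S ^^ k) v) = (if k = n - 1 then 1 else 0)" if "k \<ge> n - 1" for k
    using that v(2) g(5) Snv[of k] n0 g0 by auto
  have YN: "Y \<inter> N \<subseteq> {0}"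
  proof
    fix x assume x: "x \<in> Y \<inter> N"
    then obtain c where c: "x = comb c" unfolding N_def by blast
    have "c k = 0" if "k < n" for k
      using that
    proof (induction k rule: less_induct)
      case (less k)
      have "0 = g ((S ^^ (n - 1 - k)) x)" using x less(2) unfolding Y_def by simp
      also have "\<dots> = (\<Sum>j<n. c j * g ((S ^^ (n - 1 - k + j)) v))"
        unfolding c Sj by (simp add: gsum g(2))
      also have "\<dots> = (\<Sum>j<n. if j = k then c j else 0)"
      proof (rule sum.cong)
        fix j assume "j \<in> {..<n}"
        show "c j * g ((S ^^ (n - 1 - k + j)) v) = (if j = k then c j else 0)"
        proof (cases "j < k")
          case True
          then show ?thesis using less by simp
        next
          case False
          then show ?thesis using less(2) gSv[of "n - 1 - k + j"] by auto
        qed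
      qed simp
      also have "\<dots> = c k" using less(2) by simp
      finally show ?case by simp
    qed
    then have "x = 0" unfolding c comb_def by (intro sum.neutral) simp
    then show "x \<in> {0}" by simp
  qed
  \<comment> \<open>Back substitution from the highest index down: a multiple of
    \<open>(S ^^ k) v\<close> corrects index \<open>n - Suc k\<close> and leaves the larger ones
    alone, since there \<open>i + k\<close> is at least \<open>n\<close>.\<close>
  have "\<exists>w\<in>N. \<forall>i<n. n - k \<le> i \<longrightarrow> g ((S ^^ i) (x - w)) = 0" if "k \<le> n" for k x
    using that
  proof (induction k)
    case 0
    then show ?case using subspace_0[OF csubspace_imp_subspace[OF cN]] by auto
  next
    case (Suc k)
    then obtain w where w: "w \<in> N" "\<And>i. i < n \<Longrightarrow> n - k \<le> i \<Longrightarrow> g ((S ^^ i) (x - w)) = 0" by auto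
    define i0 where "i0 = n - Suc k"
    define w' where "w' = w + cscale (g ((S ^^ i0) (x - w))) ((S ^^ k) v)"
    have "w' \<in> N"
      unfolding w'_def using w(1) SvN cN by (intro subspace_add csubspace_imp_subspace csubspace_cscale)
    moreover have "g ((S ^^ i) (x - w')) = 0" if i: "i < n" "n - Suc k \<le> i" for i
    proof -
      define a where "a = g ((S ^^ i0) (x - w))"
      have "x - w' = (x - w) - cscale a ((S ^^ k) v)" unfolding w'_def a_def by simp
      then have "g ((S ^^ i) (x - w')) = g ((S ^^ i) ((x - w) - cscale a ((S ^^ k) v)))" by (simp only:)
      also have "\<dots> = g ((S ^^ i) (x - w)) - a * g ((S ^^ (i + k)) v)"
        by (simp only: linear_diff[OF linp] gd bop_cscale[OF bop_power[OF bop]] g(2) funpow_add comp_apply)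
      finally have "g ((S ^^ i) (x - w')) = g ((S ^^ i) (x - w)) - g ((S ^^ i0) (x - w)) * g ((S ^^ (i + k)) v)"
        unfolding a_def .
      then show ?thesis
        using i Suc(2) w(2)[OF i(1)] gSv[of "i + k"] unfolding i0_def by (cases "i = n - Suc k") auto
    qed
    ultimately show ?case by blast
  qed
  from this[of n] have proj: "\<exists>w\<in>N. \<forall>i<n. g ((S ^^ i) (x - w)) = 0" for x by simp
  have "M = sumset Y N"
  proof
    show "M \<subseteq> sumset Y N"
    proof
      fix x assume x: "x \<in> M"
      obtain w where w: "w \<in> N" "\<And>i. i < n \<Longrightarrow> g ((S ^^ i) (x - w)) = 0" using proj by blast
      then have "x - w \<in> Y" unfolding Y_def using x NM op_onD(5)[OF op] by (auto intro: subspace_diff)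
      moreover have "x = (x - w) + w" by simp
      ultimately show "x \<in> sumset Y N" using w(1) by blast
    qed
    show "sumset Y N \<subseteq> M"
      using NM op_onD(5)[OF op] unfolding Y_def by (auto intro!: subspace_add)
  qed
  then have "reduces M Y N S" by (rule reducesI[OF op opY opN YN])
  moreover have "ker_on Y S \<subset> ker_on M S"
  proof -
    have "u \<notin> Y" unfolding Y_def using g(5) n0 by (auto dest: spec[of _ 0])
    then have "u \<notin> ker_on Y S" unfolding ker_on_def by simp
    moreover have "ker_on Y S \<subseteq> ker_on M S" unfolding ker_on_def Y_def by blast
    ultimately show ?thesis using u(1) by blast
  qed
  \<comment> \<open>This makes the defect drop when the chain is removed, as the smaller kernel does
    for the nullity.\<close>
  moreover have "S ` N \<noteq> N"
  proof
    assume SN: "S ` N = N"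
    have "(S ^^ k) ` N = N" for k
    proof (induction k)
      case (Suc k)
      have "(S ^^ Suc k) ` N = S ` (S ^^ k) ` N" by (simp add: image_comp)
      then show ?case using Suc SN by simp
    qed simp
    then have "u \<in> (S ^^ n) ` N" using SvN[of "n - 1"] v(2) by simp
    then have "u = 0" using nilN by auto
    then show False using g(5) g0 by simp
  qed
  ultimately show ?thesis using fN nilN unfolding nilpotent_on_def by blast
qed

lemma reduces_trivial:
  assumes "op_on M S"
  shows "reduces M M {0} S"
proof (rule reducesI[OF assms assms])
  have "csubspace {0::'a}" by (rule csubspaceI) simp_all
  then show "op_on {0} S"
    using op_onD(1,6)[OF assms] unfolding op_on_def by (simp add: linear_0)
qed auto

lemma fdim_zero: "fdim {0}"
  unfolding fdim_def by (intro exI[of _ "{}"]) simp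

lemma nilpotent_on_zero: "nilpotent_on {0} S"
  unfolding nilpotent_on_def by (intro exI[of _ 0]) simp

text \<open>Induction on a bound for the nullity or for the defect, whichever is finite; every chain
  split off lowers it strictly. The disjunction lets a single induction serve both kinds of
  semi-Fredholm operators.\<close>

theorem kato_decomposition:
  assumes "op_on M S" "(nullity M S \<le> enat n \<and> closed (S ` M)) \<or> defect M S \<le> enat n"
  shows "\<exists>Y N. reduces M Y N S \<and> fdim N \<and> nilpotent_on N S \<and> kato_on Y S"
  using assms
proof (induction n arbitrary: M rule: less_induct)
  case (less n)
  show ?case
  proof (cases "kato_on M S")
    case True
    then show ?thesis using reduces_trivial[OF less(2)] fdim_zero nilpotent_on_zero by blast
  next
    case False
    have fin: "(nullity M S < \<infinity> \<and> closed (S ` M)) \<or> defect M S < \<infinity>"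
      using less(3) by (auto intro: le_less_trans)
    obtain Y N where YN: "reduces M Y N S" "fdim N" "nilpotent_on N S" "ker_on Y S \<subset> ker_on M S" "S ` N \<noteq> N"
      using split_nilpotent_chain[OF less(2) semi_fredholm_closed_power_range[OF less(2) fin] False] by blast
    note opY = reducesD(2)[OF YN(1)] and opN = reducesD(3)[OF YN(1)]
    have "\<exists>m<n. (nullity Y S \<le> enat m \<and> closed (S ` Y)) \<or> defect Y S \<le> enat m"
      using less(3)
    proof
      assume u: "nullity M S \<le> enat n \<and> closed (S ` M)"
      have "fdim (ker_on M S)" unfolding fdim_iff_rdim 
        using u le_less_trans[of "nullity M S" "enat n" \<infinity>] unfolding nullity_def by simp
      moreover have sM: "subspace (ker_on M S)" and sY: "subspace (ker_on Y S)"
        using op_onD(5,6)[OF less(2)] op_onD(5,6)[OF opY] by (simp_all add: subspace_ker_on)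
      ultimately have "dim (ker_on Y S) < dim (ker_on M S)" "fdim (ker_on Y S)"
        using dim_strict_mono YN(4) fdim_subset by blast+
      then have "nullity Y S \<le> enat (dim (ker_on Y S))" "dim (ker_on Y S) < n"
        using u sM sY \<open>fdim (ker_on M S)\<close> unfolding nullity_def by (auto simp: rdim_zero_eq_dim)
      moreover have "closed (S ` Y)" using u reduces_closed_image_iff[OF YN(1)] by blast
      ultimately show ?thesis by blast
    next
      assume d: "defect M S \<le> enat n"
      have "defect N S \<noteq> 0"
        unfolding defect_def
        using YN(5) rdim_eq_0_iff[of "S ` N" N] op_onD(4,5,6)[OF opN] subspace_image by blast
      moreover have "defect M S = defect Y S + defect N S" by (rule reduces_defect[OF YN(1)])
      ultimately obtain m where "defect Y S = enat m" "m < n"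
        using d by (cases "defect Y S"; cases "defect N S") (auto simp: zero_enat_def)
      then show ?thesis by (metis order_refl)
    qed
    then obtain m where "m < n" "(nullity Y S \<le> enat m \<and> closed (S ` Y)) \<or> defect Y S \<le> enat m" by blast
    from less(1)[OF this(1) opY this(2)] obtain Y' F where
      Y': "reduces Y Y' F S" "fdim F" "nilpotent_on F S" "kato_on Y' S" by blast
    let ?N = "sumset F N"
    have r: "reduces M Y' ?N S" "reduces ?N F N S" by (rule reduces_assoc[OF YN(1) Y'(1,2)])+
    have "fdim ?N" using Y'(2) YN(2) by (rule fdim_sums)
    moreover have "nilpotent_on ?N S"
    proof -
      obtain a where a: "\<And>x. x \<in> F \<Longrightarrow> (S ^^ a) x = 0" using Y'(3) unfolding nilpotent_on_def by blast
      obtain b where b: "\<And>x. x \<in> N \<Longrightarrow> (S ^^ b) x = 0" using YN(3) unfolding nilpotent_on_def by blast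
      have "(S ^^ (a + b)) x = 0" if "x \<in> ?N" for x
      proof -
        from that obtain f n where x: "x = f + n" "f \<in> F" "n \<in> N" by blast
        have "(S ^^ (a + b)) f = (S ^^ (b + a)) f" by (simp add: add.commute)
        then have "(S ^^ (a + b)) f = 0" "(S ^^ (a + b)) n = 0"
          using a[OF x(2)] b[OF x(3)] by (simp_all add: funpow_add bop_power_zero[OF op_onD(1)[OF less(2)]])
        then show ?thesis
          unfolding x(1) using op_onD(6)[OF op_on_power[OF less(2)]] by (simp add: linear_add)
      qed
      then show ?thesis unfolding nilpotent_on_def by blast
    qed
    ultimately show ?thesis using r(1) Y'(4) by blast
  qed
qed

section \<open>Browder and Riesz operators\<close>

lemma fredholm_iff:
  assumes "op_on M S"
  shows "fredholm_on M S \<longleftrightarrow> nullity M S < \<infinity> \<and> defect M S < \<infinity>"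
  unfolding fredholm_on_def lower_semi_fredholm_iff[OF assms] upper_semi_fredholm_iff
  using defect_finite_closed_range[OF assms] by blast

lemma nullity_0_iff:
  assumes "op_on M S"
  shows "nullity M S = 0 \<longleftrightarrow> (\<forall>x\<in>M. S x = 0 \<longrightarrow> x = 0)"
proof -
  have s: "subspace (ker_on M S)" using op_onD(5,6)[OF assms] by (simp add: subspace_ker_on)
  have "nullity M S = 0 \<longleftrightarrow> ker_on M S = {0}"
    unfolding nullity_def using rdim_eq_0_iff[OF subspace_single_0, of "ker_on M S"] subspace_0[OF s] by simp
  also have "\<dots> \<longleftrightarrow> (\<forall>x\<in>M. S x = 0 \<longrightarrow> x = 0)"
    using subspace_0[OF s] unfolding ker_on_def by blast
  finally show ?thesis .
qed

lemma defect_0_iff: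
  assumes "op_on M S"
  shows "defect M S = 0 \<longleftrightarrow> S ` M = M"
proof -
  have "subspace (S ` M)" "S ` M \<subseteq> M" using op_onD(4,5,6)[OF assms] by (auto intro: subspace_image)
  then show ?thesis unfolding defect_def using rdim_eq_0_iff by metis
qed

lemma nullity_0_finite_ascent:
  assumes "op_on M S" "nullity M S = 0"
  shows "finite_ascent_on M S"
  unfolding finite_ascent_on_def
proof (intro exI[of _ 0])
  show "ker_on M (S ^^ 0) = ker_on M (S ^^ Suc 0)"
    using assms(2) linear_0[OF op_onD(6)[OF assms(1)]]
    unfolding nullity_0_iff[OF assms(1)] ker_on_def by auto
qed

lemma defect_0_finite_descent:
  assumes "op_on M S" "defect M S = 0"
  shows "finite_descent_on M S"
  unfolding finite_descent_on_def
  using assms(2) unfolding defect_0_iff[OF assms(1)] by (intro exI[of _ 0]) simp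

text \<open>A kernel vector is \<open>x = (S ^^ n) z\<close> by the Kato condition. Then
  \<open>z\<close> lies in the kernel of \<open>S ^^ Suc n\<close>, and if the kernels have
  stabilised, in that of \<open>S ^^ n\<close>, so \<open>x = 0\<close>.\<close>

lemma kato_finite_ascent_iff:
  assumes op: "op_on M S" and k: "kato_on M S"
  shows "finite_ascent_on M S \<longleftrightarrow> nullity M S = 0"
proof
  assume "finite_ascent_on M S"
  then obtain n where n: "ker_on M (S ^^ n) = ker_on M (S ^^ Suc n)" unfolding finite_ascent_on_def by blast
  show "nullity M S = 0"
    unfolding nullity_0_iff[OF op]
  proof (intro ballI impI)
    fix x assume x: "x \<in> M" "S x = 0"
    then have "x \<in> ker_on M S" unfolding ker_on_def by simp
    then have "x \<in> (S ^^ n) ` M" using k unfolding kato_on_def by blast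
    then obtain z where z: "z \<in> M" "x = (S ^^ n) z" by blast
    then have "z \<in> ker_on M (S ^^ Suc n)" using x(2) unfolding ker_on_def by simp
    then have "z \<in> ker_on M (S ^^ n)" unfolding n .
    then show "x = 0" using z(2) unfolding ker_on_def by simp
  qed
qed (rule nullity_0_finite_ascent[OF op])

lemma kato_ker_power_subset:
  assumes op: "op_on M S" and k: "kato_on M S"
  shows "ker_on M (S ^^ n) \<subseteq> (S ^^ m) ` M"
proof (induction n arbitrary: m)
  case 0
  have "(0::'a) = (S ^^ m) 0" by (simp add: bop_power_zero[OF op_onD(1)[OF op]])
  then show ?case using subspace_0[OF op_onD(5)[OF op]] unfolding ker_on_def by auto
next
  case (Suc n)
  have sub: "subspace ((S ^^ m) ` M)" using op_onD(5,6)[OF op_on_power[OF op]] by (intro subspace_image)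
  show ?case
  proof
    fix x assume "x \<in> ker_on M (S ^^ Suc n)"
    then have x: "x \<in> M" "(S ^^ n) (S x) = 0" unfolding ker_on_def by (auto simp: funpow_swap1)
    then have "S x \<in> ker_on M (S ^^ n)" using op_onD(4)[OF op] unfolding ker_on_def by blast
    then have "S x \<in> (S ^^ Suc m) ` M" using Suc by blast
    then obtain z where z: "z \<in> M" "S x = S ((S ^^ m) z)" by auto
    then have "x - (S ^^ m) z \<in> ker_on M S"
      using x(1) op_on_power_mem[OF op z(1)] op_onD(5,6)[OF op]
      unfolding ker_on_def by (simp add: linear_diff subspace_diff)
    then have "x - (S ^^ m) z \<in> (S ^^ m) ` M" using k unfolding kato_on_def by blast
    from subspace_add[OF sub this, of "(S ^^ m) z"] show "x \<in> (S ^^ m) ` M" using z(1) by simp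
  qed
qed

text \<open>If \<open>(S ^^ n) x = (S ^^ Suc n) z\<close>, then \<open>x - S z\<close> lies in the
  kernel of \<open>S ^^ n\<close>, hence in the range of \<open>S\<close> by the preceding
  inclusion, and so does \<open>x\<close>.\<close>

lemma kato_finite_descent_iff:
  assumes op: "op_on M S" and k: "kato_on M S"
  shows "finite_descent_on M S \<longleftrightarrow> defect M S = 0"
proof
  assume "finite_descent_on M S"
  then obtain n where n: "(S ^^ n) ` M = (S ^^ Suc n) ` M" unfolding finite_descent_on_def by blast
  have "x \<in> S ` M" if x: "x \<in> M" for x
  proof -
    have "(S ^^ n) x \<in> (S ^^ Suc n) ` M" using x n by blast
    then obtain z where z: "z \<in> M" "(S ^^ n) x = (S ^^ Suc n) z" by blast
    have "(S ^^ n) (x - S z) = 0"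
      using z(2) op_onD(6)[OF op_on_power[OF op]] by (simp add: linear_diff funpow_swap1)
    then have "x - S z \<in> ker_on M (S ^^ n)"
      using x z(1) op_onD(4,5)[OF op] unfolding ker_on_def by (simp add: subspace_diff)
    then have "x - S z \<in> S ` M" using kato_ker_power_subset[OF op k, of n 1] by auto
    from subspace_add[OF subspace_image[OF op_onD(6,5)[OF op]] this, of "S z"] z(1)
    show "x \<in> S ` M" by simp
  qed
  then show "defect M S = 0" unfolding defect_0_iff[OF op] using op_onD(4)[OF op] by blast
qed (rule defect_0_finite_descent[OF op])

lemma power_eigenvector:
  assumes "bop S" "S x = cscale l x"
  shows "(S ^^ n) x = cscale (l ^ n) x"
  by (induction n) (simp_all add: bop_cscale[OF assms(1)] assms(2) cscale_one cscale_cscale mult.commute)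

lemma cscale_eq_0_iff: "cscale c x = 0 \<longleftrightarrow> c = 0 \<or> x = (0::'a::complex_banach)"
  using norm_cscale[of c x] by (metis mult_eq_0_iff norm_eq_zero)

text \<open>Index zero travels together with finite ascent and descent: all three pass to direct
  sums, and all are consumed later, where such a summand must affect neither the index comparisons
  nor ascent and descent.\<close>

definition index_zero_browder_on :: "'a::complex_banach set \<Rightarrow> ('a \<Rightarrow> 'a) \<Rightarrow> bool" where
  "index_zero_browder_on M S \<longleftrightarrow> nullity M S = defect M S \<and> defect M S < \<infinity>
     \<and> finite_ascent_on M S \<and> finite_descent_on M S"

lemma index_zero_browder_bijective:
  assumes "op_on M S" "nullity M S = 0" "defect M S = 0"
  shows "index_zero_browder_on M S"
  unfolding index_zero_browder_on_def
  using assms nullity_0_finite_ascent defect_0_finite_descent by auto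

lemma index_zero_browder_direct_sum:
  assumes "reduces L M N S" "index_zero_browder_on M S" "index_zero_browder_on N S"
  shows "index_zero_browder_on L S"
  using assms(2,3) reduces_finite_ascent_iff[OF assms(1)] reduces_finite_descent_iff[OF assms(1)]
  unfolding index_zero_browder_on_def reduces_nullity[OF assms(1)] reduces_defect[OF assms(1)] by auto

lemma index_zero_browder_fdim_nilpotent:
  assumes op: "op_on N S" and fd: "fdim N" and nil: "nilpotent_on N S"
  shows "index_zero_browder_on N (shift S l)"
proof -
  have opl: "op_on N (shift S l)" using op by (rule op_on_shift)
  have "shift S l ` N \<subseteq> N" using op_onD(4)[OF opl] by blast
  from rank_nullity_endo[OF op_onD(6,5)[OF opl] fd this]
  have nd: "nullity N (shift S l) = defect N (shift S l)" "defect N (shift S l) < \<infinity>"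
    unfolding nullity_def defect_def by auto
  obtain n where n: "\<And>x. x \<in> N \<Longrightarrow> (S ^^ n) x = 0" using nil unfolding nilpotent_on_def by blast
  show ?thesis
  proof (cases "l = 0")
    case True
    have "(S ^^ Suc n) x = 0" if "x \<in> N" for x
      using n[OF that] linear_0[OF op_onD(6)[OF op]] by simp
    then have "ker_on N (S ^^ n) = ker_on N (S ^^ Suc n)" "(S ^^ n) ` N = (S ^^ Suc n) ` N"
      using n unfolding ker_on_def by (auto intro!: image_cong)
    then show ?thesis
      using nd unfolding True shift_zero index_zero_browder_on_def finite_ascent_on_def finite_descent_on_def
      by blast
  next
    case False
    have "x = 0" if x: "x \<in> N" "shift S l x = 0" for x
    proof -
      have "S x = cscale l x" using x(2) unfolding shift_def by simp
      then have "cscale (l ^ n) x = 0" using power_eigenvector[OF op_onD(1)[OF op]] n[OF x(1)] by metis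
      then show ?thesis using False by (simp add: cscale_eq_0_iff)
    qed
    then have "nullity N (shift S l) = 0" unfolding nullity_0_iff[OF opl] by blast
    then show ?thesis using index_zero_browder_bijective[OF opl] nd by simp
  qed
qed

text \<open>In the Kato decomposition at \<open>l\<close> the finite-dimensional nilpotent part
  always has the property. The Kato part with finite ascent and descent is bijective, and
  bijectivity is constant on the disc of stability, its centre included.\<close>

lemma index_zero_browder_locally_constant:
  assumes op: "op_on N S" and fr: "fredholm_on N (shift S l)"
  obtains e where "e > 0" "\<And>a b. cmod (a - l) < e \<Longrightarrow> cmod (b - l) < e \<Longrightarrow>
    index_zero_browder_on N (shift S a) \<Longrightarrow> index_zero_browder_on N (shift S b)"
proof -
  let ?A = "shift S l"
  have opA: "op_on N ?A" using op by (rule op_on_shift)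
  obtain n where "defect N ?A = enat n" using fr unfolding fredholm_iff[OF opA] by auto
  then obtain Y F where YF: "reduces N Y F ?A" "fdim F" "nilpotent_on F ?A" "kato_on Y ?A"
    using kato_decomposition[OF opA, of n] by auto
  obtain e where e: "e > 0" "\<And>m. cmod m < e \<Longrightarrow> kato_on Y (shift ?A m)"
    "\<And>m. cmod m < e \<Longrightarrow> nullity Y (shift ?A m) = nullity Y ?A"
    "\<And>m. cmod m < e \<Longrightarrow> defect Y (shift ?A m) = defect Y ?A"
    using kato_stability[OF reducesD(2)[OF YF(1)] YF(4)] by metis
  have sh: "shift ?A (a - l) = shift S a" for a by (simp add: shift_shift)
  show thesis
  proof (rule that[OF e(1)])
    fix a b assume a: "cmod (a - l) < e" and b: "cmod (b - l) < e" and br: "index_zero_browder_on N (shift S a)"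
    note ra = reduces_shift[OF YF(1), of "a - l", unfolded sh]
    note rb = reduces_shift[OF YF(1), of "b - l", unfolded sh]
    have "finite_ascent_on Y (shift S a)" "finite_descent_on Y (shift S a)"
      using br unfolding index_zero_browder_on_def reduces_finite_ascent_iff[OF ra] reduces_finite_descent_iff[OF ra]
      by auto
    moreover have "kato_on Y (shift S a)" using e(2)[OF a] unfolding sh .
    ultimately have "nullity Y (shift S a) = 0" "defect Y (shift S a) = 0"
      using kato_finite_ascent_iff[OF reducesD(2)[OF ra]] kato_finite_descent_iff[OF reducesD(2)[OF ra]] by auto
    then have "nullity Y (shift S b) = 0" "defect Y (shift S b) = 0"
      using e(3,4)[OF a] e(3,4)[OF b] unfolding sh by simp_all
    then have "index_zero_browder_on Y (shift S b)" by (rule index_zero_browder_bijective[OF reducesD(2)[OF rb]])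
    moreover have "index_zero_browder_on F (shift S b)"
      using index_zero_browder_fdim_nilpotent[OF reducesD(3)[OF YF(1)] YF(2,3), of "b - l"] unfolding sh .
    ultimately show "index_zero_browder_on N (shift S b)" by (rule index_zero_browder_direct_sum[OF rb])
  qed
qed

text \<open>The bound on \<open>S\<^sup>k\<close> makes the truncated Neumann series an approximate inverse of \<open>S - l\<close>.\<close>
lemma shift_bijective_if_power_small:
  assumes op: "op_on N S" and l: "l \<noteq> 0" and k: "\<And>x. x \<in> N \<Longrightarrow> norm ((S ^^ k) x) \<le> cmod l ^ k * norm x / 2"
  shows "nullity N (shift S l) = 0 \<and> defect N (shift S l) = 0"
proof
  note opl = op_on_shift[OF op, of l] and bop = op_onD(1)[OF op] and cN = op_onD(2)[OF op]
  have lk: "cmod l ^ j > 0" for j using l by simp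
  show "nullity N (shift S l) = 0"
    unfolding nullity_0_iff[OF opl]
  proof (intro ballI impI)
    fix x assume x: "x \<in> N" "shift S l x = 0"
    then have "S x = cscale l x" unfolding shift_def by simp
    then have "(S ^^ k) x = cscale (l ^ k) x" by (rule power_eigenvector[OF bop])
    then have "cmod l ^ k * norm x \<le> cmod l ^ k * norm x / 2"
      using k[OF x(1)] by (simp add: norm_cscale norm_power)
    then have "norm x \<le> norm x / 2" using lk[of k] by (metis mult_le_cancel_left_pos times_divide_eq_right)
    then show "x = 0" by simp
  qed
  \<comment> \<open>Minus the sum of \<open>S ^^ i / l ^ Suc i\<close>; applying
    \<open>S - l\<close> telescopes to the identity minus \<open>S ^^ m / l ^ m\<close>.\<close>
  define P where "P m y = (\<Sum>i<m. - cscale (1 / l ^ Suc i) ((S ^^ i) y))" for m y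
  have P: "shift S l (P m y) = y - cscale (1 / l ^ m) ((S ^^ m) y)" for m y
  proof (induction m)
    case 0
    show ?case unfolding P_def using linear_0[OF op_onD(6)[OF opl]] by (simp add: cscale_one)
  next
    case (Suc m)
    let ?u = "cscale (1 / l ^ Suc m) ((S ^^ m) y)"
    have "shift S l (P (Suc m) y) = shift S l (P m y) - shift S l ?u"
      unfolding P_def by (simp add: linear_diff[OF op_onD(6)[OF opl]] del: power_Suc)
    also have "shift S l ?u = cscale (1 / l ^ Suc m) ((S ^^ Suc m) y) - cscale (1 / l ^ m) ((S ^^ m) y)"
      unfolding shift_def using l by (simp add: bop_cscale[OF bop] cscale_cscale)
    finally show ?case using Suc by simp
  qed
  have blP: "bounded_linear (P m)" for m
    unfolding P_def using op_onD(7)[OF op_on_power[OF op]]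
    by (intro bounded_linear_sum bounded_linear_minus bounded_linear_compose[OF bounded_linear_cscale])
  have PN: "P m y \<in> N" if "y \<in> N" for m y
    unfolding P_def using op_on_power_mem[OF op that] cN op_onD(5)[OF op]
    by (intro subspace_sum subspace_neg csubspace_cscale)
  obtain K where K: "\<And>y. norm (P k y) \<le> norm y * K" "0 \<le> K"
    using bounded_linear.nonneg_bounded[OF blP] by blast
  show "defect N (shift S l) = 0"
    unfolding defect_0_iff[OF opl]
  proof
    show img: "shift S l ` N \<subseteq> N" using op_onD(4)[OF opl] by blast
    show "N \<subseteq> shift S l ` N"
    proof
      fix y assume "y \<in> N"
      have "\<exists>x\<in>N. shift S l x = y \<and> norm x \<le> 2 * K * norm y"
      proof (rule approx_solvable_imp_solvable[OF op_onD(7,5,3)[OF opl] op_onD(5)[OF op] img K(2) _ \<open>y \<in> N\<close>])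
        fix z assume z: "z \<in> N"
        have "norm (z - shift S l (P k z)) = norm ((S ^^ k) z) / cmod l ^ k"
          unfolding P by (simp add: norm_cscale norm_divide norm_power)
        also have "\<dots> \<le> norm z / 2" using k[OF z] lk[of k] by (simp add: field_simps)
        finally show "\<exists>x\<in>N. norm x \<le> K * norm z \<and> norm (z - shift S l x) \<le> norm z / 2"
          using PN[OF z] K(1)[of z] by (intro bexI[of _ "P k z"]) (auto simp: mult.commute)
      qed
      then show "y \<in> shift S l ` N" by blast
    qed
  qed
qed

text \<open>Off 0 the Riesz condition supplies Fredholm operators, so the property is locally
  constant there; connectedness of the punctured plane spreads it from a single point of large
  modulus.\<close>

lemma riesz_shift_browder:
  assumes op: "op_on N S" and riesz: "riesz_on N S" and l: "l \<noteq> 0"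
  shows "index_zero_browder_on N (shift S l)"
proof -
  define U where "U = {z. z \<noteq> 0 \<and> index_zero_browder_on N (shift S z)}"
  define V where "V = {z. z \<noteq> 0 \<and> \<not> index_zero_browder_on N (shift S z)}"
  have loc: "\<exists>e>0. \<forall>a. dist a z < e \<longrightarrow>
      a \<noteq> 0 \<and> (index_zero_browder_on N (shift S a) \<longleftrightarrow> index_zero_browder_on N (shift S z))" if z: "z \<noteq> 0" for z
  proof -
    have "fredholm_on N (shift S z)" using riesz z unfolding riesz_on_def by blast
    from index_zero_browder_locally_constant[OF op this] obtain e where e: "e > 0"
      "\<And>a b. cmod (a - z) < e \<Longrightarrow> cmod (b - z) < e \<Longrightarrow>
        index_zero_browder_on N (shift S a) \<Longrightarrow> index_zero_browder_on N (shift S b)" by metis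
    have "a \<noteq> 0 \<and> (index_zero_browder_on N (shift S a) \<longleftrightarrow> index_zero_browder_on N (shift S z))"
      if a: "dist a z < min e (cmod z)" for a
    proof -
      have "cmod (a - z) < e" "cmod (z - z) < e" "a \<noteq> 0" using a e(1) by (auto simp: dist_norm)
      then show ?thesis using e(2)[of a z] e(2)[of z a] by blast
    qed
    moreover have "min e (cmod z) > 0" using e(1) z by simp
    ultimately show ?thesis by blast
  qed
  have "open {z. z \<noteq> 0 \<and> index_zero_browder_on N (shift S z) = c}" (is "open ?A") for c
    unfolding open_dist
  proof
    fix z assume "z \<in> ?A"
    then have z: "z \<noteq> 0" "index_zero_browder_on N (shift S z) = c" by simp_all
    obtain e where "e > 0" "\<forall>a. dist a z < e \<longrightarrow>
        a \<noteq> 0 \<and> (index_zero_browder_on N (shift S a) \<longleftrightarrow> index_zero_browder_on N (shift S z))"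
      using loc[OF z(1)] by blast
    then show "\<exists>e>0. \<forall>y. dist y z < e \<longrightarrow> y \<in> ?A" using z(2) by (intro exI[of _ e]) simp
  qed
  from this[of True] this[of False] have "open U" "open V" unfolding U_def V_def by simp_all
  moreover have "connected (- {0::complex})" by (rule connected_punctured_universe) simp
  moreover have "- {0} \<subseteq> U \<union> V" "U \<inter> V \<inter> - {0} = {}" unfolding U_def V_def by auto
  moreover have "U \<inter> - {0} \<noteq> {}"
  proof -
    obtain B where B: "\<And>x. norm (S x) \<le> norm x * B" "0 \<le> B"
      using bounded_linear.nonneg_bounded[OF op_onD(7)[OF op]] by blast
    \<comment> \<open>More than twice the bound on \<open>S\<close>, so that already the first power
      satisfies the smallness condition; the added 1 keeps \<open>z\<close> nonzero.\<close>
    define z where "z = complex_of_real (2 * B + 1)"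
    have cz: "cmod z = 2 * B + 1" unfolding z_def using B(2) by (simp only: norm_of_real)
    then have z: "z \<noteq> 0" using B(2) by auto
    have "norm ((S ^^ 1) x) \<le> cmod z ^ 1 * norm x / 2" for x
    proof -
      have "(2 * B + 1) ^ 1 * norm x / 2 = norm x * B + norm x / 2" by (simp add: field_simps)
      then show ?thesis using B(1)[of x] unfolding cz by (simp add: add_increasing2)
    qed
    then have "index_zero_browder_on N (shift S z)"
      using shift_bijective_if_power_small[OF op z] index_zero_browder_bijective[OF op_on_shift[OF op]] by blast
    then show ?thesis using z unfolding U_def by blast
  qed
  ultimately have "V \<inter> - {0} = {}" using connectedD[of "- {0}" U V] by blast
  then show ?thesis using l unfolding V_def by blast
qed

lemma quasinilpotent_imp_riesz:
  assumes op: "op_on N S" and q: "quasinilpotent_on N S"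
  shows "riesz_on N S"
  unfolding riesz_on_def
proof (intro allI impI)
  fix l :: complex assume l: "l \<noteq> 0"
  have "cmod l / 2 > 0" using l by simp
  then obtain k0 where k0: "\<And>n x. n \<ge> k0 \<Longrightarrow> x \<in> N \<Longrightarrow> norm ((S ^^ n) x) \<le> (cmod l / 2) ^ n * norm x"
    using q unfolding quasinilpotent_on_def by blast
  \<comment> \<open>The exponent is \<open>Suc k0\<close> because at least one factor 1/2 is
    required, even when \<open>k0 = 0\<close>.\<close>
  have "norm ((S ^^ Suc k0) x) \<le> cmod l ^ Suc k0 * norm x / 2" if x: "x \<in> N" for x
  proof -
    have 1: "norm ((S ^^ Suc k0) x) \<le> (cmod l / 2) ^ Suc k0 * norm x" by (rule k0[OF _ x]) simp
    have "(cmod l / 2) ^ Suc k0 = cmod l ^ Suc k0 / (2 * 2 ^ k0)" by (simp add: power_divide)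
    also have "\<dots> \<le> cmod l ^ Suc k0 / 2"
    proof (rule divide_left_mono)
      have "(1::real) \<le> 2 ^ k0" by (rule one_le_power) simp
      then show "2 \<le> 2 * (2::real) ^ k0" by simp
    qed simp_all
    finally have "(cmod l / 2) ^ Suc k0 * norm x \<le> cmod l ^ Suc k0 / 2 * norm x"
      by (intro mult_right_mono) auto
    with 1 have "norm ((S ^^ Suc k0) x) \<le> cmod l ^ Suc k0 / 2 * norm x" by (rule order_trans)
    then show ?thesis by simp
  qed
  from shift_bijective_if_power_small[OF op l this]
  show "fredholm_on N (shift S l)" unfolding fredholm_iff[OF op_on_shift[OF op]] by simp
qed

lemma nilpotent_imp_quasinilpotent:
  assumes op: "op_on N S" and n: "nilpotent_on N S"
  shows "quasinilpotent_on N S"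
proof -
  obtain k where k: "\<And>x. x \<in> N \<Longrightarrow> (S ^^ k) x = 0" using n unfolding nilpotent_on_def by blast
  have z: "(S ^^ m) x = 0" if "m \<ge> k" "x \<in> N" for m x
  proof -
    have "S ^^ m = S ^^ (m - k) \<circ> S ^^ k" using that(1) by (simp flip: funpow_add)
    then show ?thesis using k[OF that(2)] by (simp add: bop_power_zero[OF op_onD(1)[OF op]])
  qed
  show ?thesis
    unfolding quasinilpotent_on_def
  proof (intro allI impI)
    fix e :: real assume "e > 0"
    then show "\<exists>k. \<forall>n\<ge>k. \<forall>x\<in>N. norm ((S ^^ n) x) \<le> e ^ n * norm x"
      using z by (intro exI[of _ k]) auto
  qed
qed

section \<open>Spectra\<close>

lemma decomp_iff:
  assumes "bop S"
  shows "decomp P Q S \<longleftrightarrow> (\<exists>M N. reduces UNIV M N S \<and> P M S \<and> Q N S)"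
proof
  assume "decomp P Q S"
  then obtain M N where d: "csubspace M" "csubspace N" "closed M" "closed N" "M \<inter> N = {0}"
    "\<And>x. \<exists>m\<in>M. \<exists>n\<in>N. x = m + n" "S ` M \<subseteq> M" "S ` N \<subseteq> N" and PQ: "P M S" "Q N S"
    unfolding decomp_def by metis
  have "op_on (UNIV :: 'a set) S"
    using assms unfolding op_on_def by (simp add: csubspaceI)
  then have "reduces UNIV M N S"
  proof (rule reducesI)
    show "op_on M S" "op_on N S" using assms d unfolding op_on_def by auto
    show "M \<inter> N \<subseteq> {0}" using d(5) by simp
    show "UNIV = sumset M N" using d(6) by blast
  qed
  then show "\<exists>M N. reduces UNIV M N S \<and> P M S \<and> Q N S" using PQ by blast
next
  assume "\<exists>M N. reduces UNIV M N S \<and> P M S \<and> Q N S"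
  then obtain M N where r: "reduces UNIV M N S" and PQ: "P M S" "Q N S" by blast
  note opM = reducesD(2)[OF r] and opN = reducesD(3)[OF r]
  have "0 \<in> M \<inter> N" using subspace_0 op_onD(5)[OF opM] op_onD(5)[OF opN] by blast
  then have "M \<inter> N = {0}" using reducesD(4)[OF r] by blast
  then show "decomp P Q S"
    unfolding decomp_def using op_onD(2-4)[OF opM] op_onD(2-4)[OF opN] PQ reducesD(8)[OF r]
    by (intro exI[of _ M] exI[of _ N]) auto
qed

lemma op_on_UNIV: "bop S \<Longrightarrow> op_on UNIV S"
  unfolding op_on_def by (simp add: csubspaceI)

lemma decomp_mono:
  assumes "bop S" "decomp P Q S"
    and "\<And>M N. reduces UNIV M N S \<Longrightarrow> P M S \<Longrightarrow> Q N S \<Longrightarrow> P' M S \<and> Q' N S"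
  shows "decomp P' Q' S"
  using assms unfolding decomp_iff[OF assms(1)] by blast

lemma decomp_trivial:
  assumes "bop S" "P UNIV S" "Q {0} S"
  shows "decomp P Q S"
  unfolding decomp_iff[OF assms(1)] using reduces_trivial[OF op_on_UNIV[OF assms(1)]] assms(2,3) by blast

lemma riesz_on_zero:
  assumes "bop S"
  shows "riesz_on {0} S"
  unfolding riesz_on_def
proof (intro allI impI)
  fix l
  have "op_on {0} (shift S l)" using reducesD(3)[OF reduces_trivial[OF op_on_UNIV[OF assms]]] by (rule op_on_shift)
  moreover from this have "nullity {0} (shift S l) = 0" "defect {0} (shift S l) = 0"
    by (auto simp: nullity_0_iff defect_0_iff linear_0[OF op_onD(6)])
  ultimately show "fredholm_on {0} (shift S l)" by (simp add: fredholm_iff)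
qed

definition semi_fredholm_on :: "'a::complex_banach set \<Rightarrow> ('a \<Rightarrow> 'a) \<Rightarrow> bool" where
  "semi_fredholm_on M S \<longleftrightarrow> upper_semi_fredholm_on M S \<or> lower_semi_fredholm_on M S"

lemma semi_fredholm_kato_decomposition:
  assumes op: "op_on M S" and s: "semi_fredholm_on M S"
  shows "\<exists>Y N. reduces M Y N S \<and> kato_on Y S \<and> fd_nilpotent_on N S"
proof -
  have "\<exists>n. (nullity M S \<le> enat n \<and> closed (S ` M)) \<or> defect M S \<le> enat n"
    using s unfolding semi_fredholm_on_def upper_semi_fredholm_iff lower_semi_fredholm_iff[OF op]
    by (metis enat_ord_simps(4) less_infinityE order_refl)
  then show ?thesis using kato_decomposition[OF op] unfolding fd_nilpotent_on_def by blast
qed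

lemma semi_fredholm_closed_range:
  assumes "op_on M S" "semi_fredholm_on M S"
  shows "closed (S ` M)"
  using assms defect_finite_closed_range[OF assms(1)]
  unfolding semi_fredholm_on_def upper_semi_fredholm_iff lower_semi_fredholm_iff[OF assms(1)] by blast

text \<open>Allows the nilpotent remainder of a Kato decomposition to be moved into the Riesz
  summand.\<close>

lemma riesz_extend_fdim_nilpotent:
  assumes r: "reduces L F N S" and F: "fd_nilpotent_on F S" and N: "riesz_on N S"
  shows "riesz_on L S"
  unfolding riesz_on_def
proof (intro allI impI)
  fix l :: complex assume l: "l \<noteq> 0"
  note rl = reduces_shift[OF r, of l]
  have "index_zero_browder_on F (shift S l)"
    using index_zero_browder_fdim_nilpotent[OF reducesD(2)[OF r]] F unfolding fd_nilpotent_on_def by blast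
  moreover have "fredholm_on N (shift S l)" using N l unfolding riesz_on_def by blast
  ultimately show "fredholm_on L (shift S l)"
    unfolding fredholm_iff[OF reducesD(1)[OF rl]] fredholm_iff[OF reducesD(3)[OF rl]]
      reduces_nullity[OF rl] reduces_defect[OF rl] index_zero_browder_on_def
    by (auto elim!: less_infinityE)
qed

text \<open>The semi-Fredholm summand is split into a Kato part and a finite-dimensional nilpotent
  part, and the latter is regrouped with the Riesz summand.\<close>

lemma decomp_semi_fredholm_riesz_imp_kato_riesz:
  assumes S: "bop S" and d: "decomp R riesz_on S"
    and R: "\<And>M. op_on M S \<Longrightarrow> R M S \<Longrightarrow> semi_fredholm_on M S"
  shows "decomp kato_on riesz_on S"
proof -
  obtain M N where r: "reduces UNIV M N S" "R M S" "riesz_on N S" using d unfolding decomp_iff[OF S] by blast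
  obtain Y F where YF: "reduces M Y F S" "kato_on Y S" "fd_nilpotent_on F S"
    using semi_fredholm_kato_decomposition[OF reducesD(2)[OF r(1)]] R[OF reducesD(2)[OF r(1)] r(2)] by blast
  have F: "fdim F" using YF(3) unfolding fd_nilpotent_on_def by simp
  note ra = reduces_assoc[OF r(1) YF(1) F]
  from riesz_extend_fdim_nilpotent[OF ra(2) YF(3) r(3)] ra(1) YF(2)
  show ?thesis unfolding decomp_iff[OF S] by blast
qed

section \<open>Index conditions as comparisons of nullity and defect\<close>

lemma index_le0_iff:
  assumes "op_on M S"
  shows "index_le0_on M S \<longleftrightarrow> nullity M S \<le> defect M S"
proof (cases "fin_codim M (S ` M)")
  case False
  then have "defect M S = \<infinity>"
    using lower_semi_fredholm_iff[OF assms] unfolding lower_semi_fredholm_on_def by simp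
  then show ?thesis using False unfolding index_le0_on_def by simp
next
  case True
  have sK: "subspace (ker_on M S)" and sR: "subspace (S ` M)"
    using op_onD(5,6)[OF assms] by (simp_all add: subspace_ker_on subspace_image)
  obtain F where F: "is_compl M (S ` M) F" using True unfolding fin_codim_def by blast
  have d: "defect M S = enat (dim F)" if "is_compl M (S ` M) F" for F
    unfolding defect_def using is_compl_rdim[OF that sR] .
  show ?thesis
  proof
    assume "index_le0_on M S"
    then obtain F where "is_compl M (S ` M) F" "fdim (ker_on M S)" "dim (ker_on M S) \<le> dim F"
      using True unfolding index_le0_on_def by blast
    then show "nullity M S \<le> defect M S" using d sK unfolding nullity_def by (simp add: rdim_zero_eq_dim)
  next
    assume le: "nullity M S \<le> defect M S"
    have "nullity M S < \<infinity>" using le d[OF F] le_less_trans[of _ "enat (dim F)" \<infinity>] by simp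
    then have "fdim (ker_on M S)" unfolding fdim_iff_rdim nullity_def .
    then show "index_le0_on M S"
      using le d[OF F] F sK unfolding index_le0_on_def nullity_def by (auto simp: rdim_zero_eq_dim)
  qed
qed

lemma index_ge0_iff:
  assumes "op_on M S"
  shows "index_ge0_on M S \<longleftrightarrow> defect M S \<le> nullity M S"
proof (cases "fdim (ker_on M S)")
  case False
  then have "nullity M S = \<infinity>" unfolding fdim_iff_rdim nullity_def by simp
  then show ?thesis using False unfolding index_ge0_on_def by simp
next
  case True
  have sK: "subspace (ker_on M S)" and sR: "subspace (S ` M)"
    using op_onD(5,6)[OF assms] by (simp_all add: subspace_ker_on subspace_image)
  have n: "nullity M S = enat (dim (ker_on M S))" unfolding nullity_def using True sK by (rule rdim_zero_eq_dim)
  have d: "defect M S = enat (dim F)" if "is_compl M (S ` M) F" for F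
    unfolding defect_def using is_compl_rdim[OF that sR] .
  show ?thesis
  proof
    assume "index_ge0_on M S"
    then obtain F where "is_compl M (S ` M) F" "dim F \<le> dim (ker_on M S)"
      using True unfolding index_ge0_on_def by blast
    then show "defect M S \<le> nullity M S" using d n by simp
  next
    assume le: "defect M S \<le> nullity M S"
    then have "defect M S < \<infinity>" using n le_less_trans[of _ "enat (dim (ker_on M S))" \<infinity>] by simp
    then obtain F where F: "is_compl M (S ` M) F"
      using lower_semi_fredholm_iff[OF assms] unfolding lower_semi_fredholm_on_def fin_codim_def by blast
    then show "index_ge0_on M S" using le d[OF F] n unfolding index_ge0_on_def by auto
  qed
qed

lemma index_eq0_iff:
  assumes "op_on M S"
  shows "index_eq0_on M S \<longleftrightarrow> nullity M S = defect M S \<and> defect M S < \<infinity>"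
proof -
  have sK: "subspace (ker_on M S)" and sR: "subspace (S ` M)"
    using op_onD(5,6)[OF assms] by (simp_all add: subspace_ker_on subspace_image)
  have d: "defect M S = enat (dim F)" if "is_compl M (S ` M) F" for F
    unfolding defect_def using is_compl_rdim[OF that sR] .
  show ?thesis
  proof
    assume "index_eq0_on M S"
    then obtain F where F: "is_compl M (S ` M) F" "fdim (ker_on M S)" "dim F = dim (ker_on M S)"
      unfolding index_eq0_on_def by blast
    then show "nullity M S = defect M S \<and> defect M S < \<infinity>"
      using d[OF F(1)] sK unfolding nullity_def by (simp add: rdim_zero_eq_dim)
  next
    assume a: "nullity M S = defect M S \<and> defect M S < \<infinity>"
    then obtain F where F: "is_compl M (S ` M) F"
      using lower_semi_fredholm_iff[OF assms] unfolding lower_semi_fredholm_on_def fin_codim_def by blast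
    have "fdim (ker_on M S)" using a unfolding fdim_iff_rdim nullity_def by simp
    then show "index_eq0_on M S"
      using a d[OF F] F sK unfolding index_eq0_on_def nullity_def by (auto simp: rdim_zero_eq_dim)
  qed
qed

text \<open>Here \<open>a\<close> and \<open>b\<close> will be the nullity and defect of the Kato
  part, not of the operator itself; this is why finite ascent appears as \<open>a = 0\<close> and
  finite descent as \<open>b = 0\<close>.\<close>

definition fredholm_data :: "'a::complex_banach set \<Rightarrow> ('a \<Rightarrow> 'a) \<Rightarrow> enat \<Rightarrow> enat \<Rightarrow> bool" where
  "fredholm_data M S a b \<longleftrightarrow>
    (upper_semi_fredholm_on M S \<longleftrightarrow> a < \<infinity>) \<and> (lower_semi_fredholm_on M S \<longleftrightarrow> b < \<infinity>) \<and>
    (finite_ascent_on M S \<longleftrightarrow> a = 0) \<and> (finite_descent_on M S \<longleftrightarrow> b = 0) \<and>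
    (index_le0_on M S \<longleftrightarrow> a \<le> b) \<and> (index_ge0_on M S \<longleftrightarrow> b \<le> a) \<and>
    (index_eq0_on M S \<longleftrightarrow> a = b \<and> b < \<infinity>)"

text \<open>Near \<open>0\<close> the Riesz part only contributes a Browder operator of index zero, so every class is
  decided by the constant nullity and defect of the Kato part.\<close>
lemma kato_riesz_punctured:
  assumes S: "bop S" and d: "decomp kato_on riesz_on S"
  shows "\<exists>e>0. \<exists>a b :: enat. \<forall>l. l \<noteq> 0 \<longrightarrow> cmod l < e \<longrightarrow>
      fredholm_data UNIV (shift S l) a b"
proof -
  obtain M N where r: "reduces UNIV M N S" "kato_on M S" "riesz_on N S" using d unfolding decomp_iff[OF S] by blast
  obtain e where e: "e > 0" "\<And>m. cmod m < e \<Longrightarrow> kato_on M (shift S m)"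
    "\<And>m. cmod m < e \<Longrightarrow> nullity M (shift S m) = nullity M S"
    "\<And>m. cmod m < e \<Longrightarrow> defect M (shift S m) = defect M S"
    using kato_stability[OF reducesD(2)[OF r(1)] r(2)] by metis
  show ?thesis
  proof (rule exI[of _ e], rule conjI[OF e(1)], rule exI[of _ "nullity M S"],
      rule exI[of _ "defect M S"], rule allI, rule impI, rule impI)
    fix l assume l: "l \<noteq> 0" "cmod l < e"
    note rl = reduces_shift[OF r(1), of l]
    note opU = reducesD(1)[OF rl] and opM = reducesD(2)[OF rl] and opN = reducesD(3)[OF rl]
    have br: "index_zero_browder_on N (shift S l)"
      by (rule riesz_shift_browder[OF reducesD(3)[OF r(1)] r(3) l(1)])
    \<comment> \<open>One finite \<open>k\<close> serves for both, by index zero; adding it to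
      nullity and defect changes neither finiteness nor their comparison.\<close>
    then obtain k where k: "nullity N (shift S l) = enat k" "defect N (shift S l) = enat k"
      unfolding index_zero_browder_on_def by auto
    have nU: "nullity UNIV (shift S l) = nullity M S + enat k"
      using reduces_nullity[OF rl] k e(3)[OF l(2)] by simp
    have dU: "defect UNIV (shift S l) = defect M S + enat k"
      using reduces_defect[OF rl] k e(4)[OF l(2)] by simp
    have "closed (shift S l ` M)" using e(2)[OF l(2)] unfolding kato_on_def by blast
    moreover have "closed (shift S l ` N)" using defect_finite_closed_range[OF opN] k by simp
    ultimately have cl: "closed (range (shift S l))" using reduces_closed_image_iff[OF rl] by blast
    have asc: "finite_ascent_on UNIV (shift S l) \<longleftrightarrow> nullity M S = 0"
      using reduces_finite_ascent_iff[OF rl] br kato_finite_ascent_iff[OF opM e(2)[OF l(2)]] e(3)[OF l(2)]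
      unfolding index_zero_browder_on_def by simp
    have desc: "finite_descent_on UNIV (shift S l) \<longleftrightarrow> defect M S = 0"
      using reduces_finite_descent_iff[OF rl] br kato_finite_descent_iff[OF opM e(2)[OF l(2)]] e(4)[OF l(2)]
      unfolding index_zero_browder_on_def by simp
    show "fredholm_data UNIV (shift S l) (nullity M S) (defect M S)"
      unfolding fredholm_data_def upper_semi_fredholm_iff lower_semi_fredholm_iff[OF opU] index_le0_iff[OF opU]
        index_ge0_iff[OF opU] index_eq0_iff[OF opU] asc desc nU dU
      using cl by (cases "nullity M S"; cases "defect M S") auto
  qed
qed

definition fredholm_classes :: "('a::complex_banach set \<Rightarrow> ('a \<Rightarrow> 'a) \<Rightarrow> bool) set" where
  "fredholm_classes = {browder_plus_on, browder_minus_on, browder_on, upper_semi_fredholm_on,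
     lower_semi_fredholm_on, fredholm_on, weyl_plus_on, weyl_minus_on, weyl_on}"

lemmas fredholm_class_defs = browder_plus_on_def browder_minus_on_def browder_on_def fredholm_on_def
  weyl_plus_on_def weyl_minus_on_def weyl_on_def

lemma fredholm_class_constant_near:
  assumes S: "bop S" and d: "decomp kato_on riesz_on S" and R: "R \<in> fredholm_classes"
  shows "\<exists>e>0. \<forall>l m. l \<noteq> 0 \<longrightarrow> cmod l < e \<longrightarrow> m \<noteq> 0 \<longrightarrow> cmod m < e \<longrightarrow>
    R UNIV (shift S l) \<longrightarrow> R UNIV (shift S m)"
proof -
  obtain e and a b :: enat where e: "e > 0" and cl: "\<forall>l. l \<noteq> 0 \<longrightarrow> cmod l < e \<longrightarrow>
      fredholm_data UNIV (shift S l) a b"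
    using kato_riesz_punctured[OF S d] by (elim exE conjE)
  show ?thesis
  proof (rule exI[of _ e], rule conjI[OF e], intro allI impI)
    fix l m
    assume lm: "l \<noteq> 0" "cmod l < e" "m \<noteq> 0" "cmod m < e" and Rl: "R UNIV (shift S l)"
    note l = cl[rule_format, OF lm(1,2), unfolded fredholm_data_def]
      and m = cl[rule_format, OF lm(3,4), unfolded fredholm_data_def]
    from R Rl show "R UNIV (shift S m)"
      unfolding fredholm_classes_def by (elim insertE emptyE; hypsubst) (simp_all add: fredholm_class_defs l m)
  qed
qed

lemma class_imp_semi_fredholm:
  assumes "R \<in> fredholm_classes" "R M S"
  shows "semi_fredholm_on M S"
  using assms unfolding semi_fredholm_on_def fredholm_classes_def
  by (elim insertE emptyE; hypsubst) (simp_all add: fredholm_class_defs)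

section \<open>Bounded below, surjective and invertible operators\<close>

lemma bounded_below_imp:
  assumes op: "op_on M S" and b: "bounded_below_on M S"
  shows "nullity M S = 0" "closed (S ` M)"
proof -
  obtain c where c: "c > 0" "\<And>x. x \<in> M \<Longrightarrow> c * norm x \<le> norm (S x)"
    using b unfolding bounded_below_on_def by blast
  show "nullity M S = 0"
    unfolding nullity_0_iff[OF op] using c by (metis mult_le_0_iff norm_le_zero_iff norm_zero not_le)
  have "bounded_preimages (1 / c) S M"
    unfolding bounded_preimages_def using c by (intro ballI bexI) (auto simp: field_simps)
  then show "closed (S ` M)" using closed_range_iff_bounded_preimages[OF op] c(1) by (metis zero_less_divide_1_iff)
qed

lemma invertible_imp:
  assumes op: "op_on M S" and b: "invertible_on M S"
  shows "nullity M S = 0" "defect M S = 0"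
proof -
  obtain R where R: "\<And>x. x \<in> M \<Longrightarrow> R x \<in> M \<and> R (S x) = x \<and> S (R x) = x"
    using b unfolding invertible_on_def by blast
  have "S 0 = 0" using linear_0[OF op_onD(6)[OF op]] .
  then show "nullity M S = 0"
    unfolding nullity_0_iff[OF op] using R subspace_0[OF op_onD(5)[OF op]] by metis
  show "defect M S = 0"
    unfolding defect_0_iff[OF op] using R op_onD(4)[OF op] by (metis image_eqI subsetI subset_antisym image_subset_iff)
qed

lemma kato_on_if_injective_or_onto:
  assumes op: "op_on M S" and "closed (S ` M)" "nullity M S = 0 \<or> defect M S = 0"
  shows "kato_on M S"
proof -
  have "ker_on M S \<subseteq> (S ^^ n) ` M" for n
  proof (cases "nullity M S = 0")
    case True
    then have "ker_on M S \<subseteq> {0}" unfolding nullity_0_iff[OF op] ker_on_def by blast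
    moreover have "0 \<in> (S ^^ n) ` M"
      using subspace_0[OF op_onD(5)[OF op]] bop_power_zero[OF op_onD(1)[OF op], of n] by (metis image_eqI)
    ultimately show ?thesis by blast
  next
    case False
    then have S: "S ` M = M" using assms(3) defect_0_iff[OF op] by blast
    have "(S ^^ n) ` M = M"
    proof (induction n)
      case (Suc n)
      have "(S ^^ Suc n) ` M = S ` (S ^^ n) ` M" by (simp add: image_comp)
      then show ?case using Suc S by simp
    qed simp
    then show ?thesis unfolding ker_on_def by blast
  qed
  then show ?thesis using assms(2) unfolding kato_on_def by blast
qed

lemma pair_class_imp:
  assumes op: "op_on M S"
    and R: "(R, R') \<in> {(bounded_below_on, browder_plus_on), (surj_on, browder_minus_on), (invertible_on, browder_on)}"
    and "R M S"
  shows "kato_on M S" "R' M S"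
proof -
  have "kato_on M S \<and> R' M S"
    using R
  proof (elim insertE emptyE)
    assume "(R, R') = (bounded_below_on, browder_plus_on)"
    then have b: "bounded_below_on M S" and R': "R' = browder_plus_on" using assms(3) by auto
    note imp = bounded_below_imp[OF op b]
    show ?thesis
      using kato_on_if_injective_or_onto[OF op imp(2)] imp nullity_0_finite_ascent[OF op]
      by (simp add: R' browder_plus_on_def upper_semi_fredholm_iff)
  next
    assume "(R, R') = (surj_on, browder_minus_on)"
    then have "S ` M = M" and R': "R' = browder_minus_on" using assms(3) unfolding surj_on_def by auto
    then have "defect M S = 0" "closed (S ` M)" using defect_0_iff[OF op] op_onD(3)[OF op] by auto
    then show ?thesis
      using kato_on_if_injective_or_onto[OF op] defect_0_finite_descent[OF op]
      by (simp add: R' browder_minus_on_def lower_semi_fredholm_iff[OF op])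
  next
    assume "(R, R') = (invertible_on, browder_on)"
    then have b: "invertible_on M S" and R': "R' = browder_on" using assms(3) by auto
    note imp = invertible_imp[OF op b]
    have "closed (S ` M)" using imp defect_finite_closed_range[OF op] by simp
    then show ?thesis
      using kato_on_if_injective_or_onto[OF op] imp nullity_0_finite_ascent[OF op] defect_0_finite_descent[OF op]
      by (simp add: R' browder_on_def fredholm_iff[OF op])
  qed
  then show "kato_on M S" "R' M S" by auto
qed

text \<open>Serves both halves of the theorem: \<open>R' = R\<close> for the Fredholm-type classes,
  and the given pairs otherwise, where \<open>R\<close> is contained in \<open>R'\<close>.\<close>

lemma spectrum_subset_spec_gKR:
  assumes T: "bop T"
    and R': "R' \<in> fredholm_classes"
    and RR': "\<And>l. R UNIV (shift T l) \<Longrightarrow> R' UNIV (shift T l)"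
    and fr: "spec_cls R T = frontier (spec_cls R T)" and acc: "frontier (spec_cls R T) \<subseteq> acc (spec_cls R' T)"
  shows "spec_cls R T \<subseteq> spec_gKR T"
proof
  fix l assume l: "l \<in> spec_cls R T"
  show "l \<in> spec_gKR T"
  proof (rule ccontr)
    assume "l \<notin> spec_gKR T"
    then have d: "decomp kato_on riesz_on (shift T l)" unfolding spec_dec_def by simp
    from fredholm_class_constant_near[OF bop_shift[OF T] d R']
    obtain e where e: "e > 0" "\<forall>a b. a \<noteq> 0 \<longrightarrow> cmod a < e \<longrightarrow> b \<noteq> 0 \<longrightarrow> cmod b < e \<longrightarrow>
        R' UNIV (shift (shift T l) a) \<longrightarrow> R' UNIV (shift (shift T l) b)"
      by (elim exE conjE)
    have lf: "l \<in> frontier (spec_cls R T)" by (rule subsetD[OF equalityD1[OF fr] l])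
    then obtain m where m: "m \<notin> spec_cls R T" "dist l m < e"
      unfolding frontier_straddle using e(1) by blast
    \<comment> \<open>\<open>l\<close> itself is in the spectrum, so the regular point
      \<open>m\<close> differs from it and falls in the punctured disc.\<close>
    then have Rm: "R UNIV (shift T m)" "m \<noteq> l" using l unfolding spec_cls_def by auto
    have "l islimpt spec_cls R' T" using subsetD[OF acc lf] unfolding acc_def by simp
    then obtain n where n: "n \<in> spec_cls R' T" "n \<noteq> l" "dist n l < e"
      unfolding islimpt_approachable using e(1) by blast
    have "R' UNIV (shift (shift T l) (m - l))" using RR'[OF Rm(1)] by (simp add: shift_shift)
    moreover have "m - l \<noteq> 0" "cmod (m - l) < e" "n - l \<noteq> 0" "cmod (n - l) < e"
      using Rm(2) m(2) n(2,3) by (auto simp: dist_norm norm_minus_commute)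
    ultimately have "R' UNIV (shift (shift T l) (n - l))" using e(2) by blast
    then show False using n(1) unfolding spec_cls_def by (simp add: shift_shift)
  qed
qed

section \<open>Inclusions between the spectra and the closing of the circle\<close>

lemma spec_dec_antimono:
  assumes T: "bop T"
    and "\<And>l M N. reduces UNIV M N (shift T l) \<Longrightarrow> P' M (shift T l) \<Longrightarrow> Q' N (shift T l) \<Longrightarrow>
      P M (shift T l) \<and> Q N (shift T l)"
  shows "spec_dec P Q T \<subseteq> spec_dec P' Q' T"
proof
  fix l assume "l \<in> spec_dec P Q T"
  then have "\<not> decomp P Q (shift T l)" unfolding spec_dec_def by simp
  moreover have "decomp P Q (shift T l)" if "decomp P' Q' (shift T l)"
    by (rule decomp_mono[OF bop_shift[OF T] that]) (rule assms(2))
  ultimately have "\<not> decomp P' Q' (shift T l)" by blast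
  then show "l \<in> spec_dec P' Q' T" unfolding spec_dec_def by simp
qed

lemma spectrum_inclusions:
  assumes T: "bop T"
  shows "spec_gKR T \<subseteq> spec_gK T" "spec_gK T \<subseteq> spec_Kt T" "spec_Kt T \<subseteq> spec_eK T" "spec_eK T \<subseteq> spec_K T"
    "spec_gDR R T \<subseteq> spec_cls R T"
proof -
  have b: "bop (shift T l)" for l using T by (rule bop_shift)
  show "spec_gKR T \<subseteq> spec_gK T"
    by (rule spec_dec_antimono[OF T]) (simp add: quasinilpotent_imp_riesz reducesD(3))
  show "spec_gK T \<subseteq> spec_Kt T"
    by (rule spec_dec_antimono[OF T]) (simp add: nilpotent_imp_quasinilpotent reducesD(3))
  show "spec_Kt T \<subseteq> spec_eK T"
    by (rule spec_dec_antimono[OF T]) (simp add: fd_nilpotent_on_def)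
  show "spec_eK T \<subseteq> spec_K T"
    unfolding spec_dec_def spec_cls_def
    using decomp_trivial[OF b, where Q = fd_nilpotent_on and P = kato_on] fdim_zero nilpotent_on_zero
    unfolding fd_nilpotent_on_def by blast
  show "spec_gDR R T \<subseteq> spec_cls R T"
    unfolding spec_dec_def spec_cls_def using decomp_trivial[OF b, where P = R] riesz_on_zero[OF b] by blast
qed

text \<open>Two chains lead from \<open>spec_gKR T\<close> back to \<open>spec_cls R T\<close>:
  through \<open>spec_gK\<close>, \<open>spec_Kt\<close> and \<open>spec_eK\<close>, closed by the
  Kato decomposition of semi-Fredholm operators, and through \<open>spec_gDR R T\<close>.\<close>

lemma spectra_coincide_fredholm_classes:
  assumes T: "bop T"
    and R: "R \<in> fredholm_classes"
  shows "spec_cls R T = frontier (spec_cls R T) \<and> frontier (spec_cls R T) = acc (spec_cls R T)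
    \<longrightarrow> spec_ec T \<subseteq> spec_gKR T \<and> spec_gKR T = spec_gK T \<and> spec_gK T = spec_Kt T
    \<and> spec_Kt T = spec_eK T \<and> spec_eK T = spec_cls R T \<and> spec_cls R T = spec_gDR R T"
    (is "_ \<longrightarrow> ?C")
proof (intro impI, elim conjE)
  assume fr: "spec_cls R T = frontier (spec_cls R T)" and fa: "frontier (spec_cls R T) = acc (spec_cls R T)"
  note acc = equalityD1[OF fa]
  have b: "bop (shift T l)" for l using T by (rule bop_shift)
  have sf: "semi_fredholm_on M S" if "R M S" for M and S :: "'a \<Rightarrow> 'a"
    using class_imp_semi_fredholm[OF R that] .
  have 1: "spec_cls R T \<subseteq> spec_gKR T" using spectrum_subset_spec_gKR[OF T R _ fr acc] by blast
  have 2: "spec_eK T \<subseteq> spec_cls R T"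
    unfolding spec_dec_def spec_cls_def decomp_iff[OF b]
    using semi_fredholm_kato_decomposition[OF op_on_UNIV[OF b]] sf by blast
  have 3: "spec_ec T \<subseteq> spec_cls R T"
    unfolding spec_ec_def spec_cls_def using semi_fredholm_closed_range[OF op_on_UNIV[OF b]] sf by blast
  have 4: "spec_gKR T \<subseteq> spec_gDR R T"
    unfolding spec_dec_def using decomp_semi_fredholm_riesz_imp_kato_riesz[OF b] sf by blast
  show "?C" using 1 2 3 4 spectrum_inclusions(1-4)[OF T] spectrum_inclusions(5)[OF T, of R] by blast
qed

text \<open>Operators in these classes are Kato themselves, so \<open>spec_K T\<close> can be
  inserted between \<open>spec_eK T\<close> and \<open>spec_cls R T\<close>, and the summand in
  \<open>R\<close> directly gives a Kato-Riesz decomposition.\<close>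

lemma spectra_coincide_injective_surjective:
  assumes T: "bop T"
    and R: "(R, R') \<in> {(bounded_below_on, browder_plus_on), (surj_on, browder_minus_on), (invertible_on, browder_on)}"
  shows "spec_cls R T = frontier (spec_cls R T) \<and> frontier (spec_cls R T) \<subseteq> acc (spec_cls R' T)
    \<longrightarrow> spec_ec T \<subseteq> spec_gKR T \<and> spec_gKR T = spec_gK T \<and> spec_gK T = spec_Kt T
    \<and> spec_Kt T = spec_eK T \<and> spec_eK T = spec_K T \<and> spec_K T = spec_cls R T \<and> spec_cls R T = spec_gDR R T"
    (is "_ \<longrightarrow> ?C")
proof (intro impI, elim conjE)
  assume fr: "spec_cls R T = frontier (spec_cls R T)" and acc: "frontier (spec_cls R T) \<subseteq> acc (spec_cls R' T)"
  have b: "bop (shift T l)" for l using T by (rule bop_shift)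
  have R': "R' \<in> fredholm_classes" using R unfolding fredholm_classes_def by auto
  have 1: "spec_cls R T \<subseteq> spec_gKR T"
    using spectrum_subset_spec_gKR[OF T R' _ fr acc] pair_class_imp(2)[OF op_on_UNIV[OF b] R] by blast
  have 2: "spec_K T \<subseteq> spec_cls R T"
    unfolding spec_cls_def using pair_class_imp(1)[OF op_on_UNIV[OF b] R] by blast
  have 3: "spec_ec T \<subseteq> spec_K T" unfolding spec_ec_def spec_cls_def kato_on_def by blast
  have 4: "spec_gKR T \<subseteq> spec_gDR R T"
    by (rule spec_dec_antimono[OF T]) (simp add: pair_class_imp(1)[OF reducesD(2) R])
  show "?C" using 1 2 3 4 spectrum_inclusions(1-4)[OF T] spectrum_inclusions(5)[OF T, of R] by blast
qed

theorem theorem3p21: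
  fixes T :: "'a::complex_banach \<Rightarrow> 'a"
  assumes inf_dim: "\<not> fdim (UNIV :: 'a set)"
    and T: "bop T"
  shows "(\<forall>R \<in> {browder_plus_on, browder_minus_on, browder_on,
                 upper_semi_fredholm_on, lower_semi_fredholm_on, fredholm_on,
                 weyl_plus_on, weyl_minus_on, weyl_on}.
            spec_cls R T = frontier (spec_cls R T) \<and> frontier (spec_cls R T) = acc (spec_cls R T)
            \<longrightarrow> spec_ec T \<subseteq> spec_gKR T \<and> spec_gKR T = spec_gK T \<and> spec_gK T = spec_Kt T
                \<and> spec_Kt T = spec_eK T \<and> spec_eK T = spec_cls R T
                \<and> spec_cls R T = spec_gDR R T)
       \<and> (\<forall>(R, R') \<in> {(bounded_below_on, browder_plus_on), (surj_on, browder_minus_on),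
                       (invertible_on, browder_on)}.
            spec_cls R T = frontier (spec_cls R T) \<and> frontier (spec_cls R T) \<subseteq> acc (spec_cls R' T)
            \<longrightarrow> spec_ec T \<subseteq> spec_gKR T \<and> spec_gKR T = spec_gK T \<and> spec_gK T = spec_Kt T
                \<and> spec_Kt T = spec_eK T \<and> spec_eK T = spec_K T \<and> spec_K T = spec_cls R T
                \<and> spec_cls R T = spec_gDR R T)"
proof (rule conjI; rule ballI)
qed (rule spectra_coincide_fredholm_classes[OF T], simp only: fredholm_classes_def,
    rule case_prodI2, hypsubst, rule spectra_coincide_injective_surjective[OF T], assumption)

end
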